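(* In the setting described in the context (in particular under assumptions (A1), (A2), (T1), (T2), (T3)), let $1<p<\infty$, $q=p/(p-1)$ and $p^*=\max(p,q)$. Let $f:X\to\mathbb{R}$ and $\mathbf{g}=(g_1,\ldots,g_d):X\to\mathbb{R}^d$ with $f\in\mathcal{D}$ and $g_i\in\mathcal{D}_i$ for $i=1,\ldots,d$. Put, for $x\in X$, $t>0$, $$F(x,t)=P_t\Pi f(x),\qquad G(x,t)=\big(Q_t^1g_1(x),\ldots,Q_t^dg_d(x)\big).$$ Then $$\int_0^\infty\int_X|F(x,t)|_*\,|G(x,t)|_*\,d\mu(x)\,t\,dt\le 6\,(p^*-1)\,\|\Pi f\|_p\,\|\mathbf{g}\|_q.$$
   Context: All functions are real-valued and $\mathbb{N}=\{0,1,2,\ldots\}$. Let $d\ge 1$. For $i=1,\ldots,d$ let $X_i=(\sigma_i,\Sigma_i)$, $-\infty\le\sigma_i<\Sigma_i\le\infty$, and let $d\mu_i(x_i)=w_i(x_i)\,dx_i$ with $w_i\in C^\infty(X_i)$ positive. Put $X=X_1\times\cdots\times X_d$, $\mu=\mu_1\otimes\cdots\otimes\mu_d$, $L^p=L^p(X,\mu)$, $\|\cdot\|_p=\|\cdot\|_{L^p}$; for vector-valued $\mathbf{g}=(g_1,\ldots,g_N)$, $\|\mathbf{g}\|_p=\big(\int_X|\mathbf{g}|^p\,d\mu\big)^{1/p}$ with $|\cdot|$ the Euclidean norm. Let $p_i,q_i\in C^\infty(X_i)$ be real-valued with $p_i(x_i)\ne0$ for all $x_i\in X_i$, and let $a_i\ge0$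 be constants (the functions $p_i,q_i$ carry an index and are not to be confused with the exponents $p,q$). Define (acting in the variable $x_i$) $\delta_i=p_i\partial_{x_i}+q_i$, its formal adjoint $\delta_i^*f=-\frac{1}{w_i}\partial_{x_i}(p_iw_if)+q_if$, and $\mathfrak{d}_i=p_i\partial_{x_i}$. The commutator $[\delta_i,\delta_i^*]=\delta_i\delta_i^*-\delta_i^*\delta_i$ is multiplication by the function $v_i=p_i\big(2q_i'-(p_i\frac{w_i'}{w_i})'-p_i''\big)$. Put $L_i=\delta_i^*\delta_i+a_i$ and $L=\sum_{i=1}^dL_i$. One has $L_i=\mathfrak{d}_i^*\mathfrak{d}_i+r_i$ with $\mathfrak{d}_i^*f=-\frac1{w_i}\partial_{x_i}(p_iw_if)$ and $r_i=a_i+q_i^2-p_iq_i'-p_i'q_i-p_iq_i\frac{w_i'}{w_i}$; put $r(x)=\sum_{i=1}^dr_i(x_i)$. Assume that for each $i$ there is an orthonormal basis $\{\varphi^i_{k_i}\}_{k_i\in\mathbb{N}}$ of $L^2(X_i,\mu_i)$ with $L_i\varphi^i_{k_i}=\lambda^i_{k_i}\varphi^i_{k_i}$, where $\lambda^i_{k_i}\ge0$, the sequence $\{\lambda^i_{k_i}\}_{k_i}$ is strictly increasing and tends to $\infty$ (the $\varphi^i_{k_i}$ are then $C^\infty$ by ellipticity). For $k\in\mathbb{N}^d$ put $\varphi_k=\varphi^1_{k_1}\otimes\cdots\otimes\varphi^d_{k_d}$ and $\lambda_k=\lambda^1_{k_1}+\cdots+\lambda^d_{k_d}$. Put $\mathcal{D}=\mathrm{lin}\{\varphi_k:k\in\mathbb{N}^d\}$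 and $\mathcal{D}_i=\mathrm{lin}\{\delta_i\varphi_k:k\in\mathbb{N}^d\}$. Assumptions: (A1) each $v_i$, $i=1,\ldots,d$, is non-negative. (A2) there is a constant $K\ge0$ with $\sum_{i=1}^dq_i^2(x_i)\le K\,r(x)$ for all $x\in X$. (T1) $\langle\delta_i\varphi^i_{k_i},\delta_i\varphi^i_{m_i}\rangle_{L^2(X_i,\mu_i)}=\langle\delta_i^*\delta_i\varphi^i_{k_i},\varphi^i_{m_i}\rangle_{L^2(X_i,\mu_i)}$ for all $i$ and $k_i,m_i\in\mathbb{N}$. (This implies that, for fixed $i$, the functions $\delta_i\varphi_k$, $k\in\mathbb{N}^d$, are pairwise orthogonal in $L^2$.) (T2) for each $i$, each $z_i\in\{\sigma_i,\Sigma_i\}$, all $k_i\in\mathbb{N}$ and all $s_1,s_2>0$: $\lim_{x_i\to z_i}\big[(1+|\varphi^i_{k_i}|^{s_1}+|\delta_i\varphi^i_{k_i}|^{s_2})\,p_i^2w_i\,\partial_{x_i}\varphi^i_{k_i}\big](x_i)=0$ and $\lim_{x_i\to z_i}\big[(1+|\varphi^i_{k_i}|^{s_1}+|\delta_i\varphi^i_{k_i}|^{s_2})\,p_i^2w_i\,\partial_{x_i}\delta_i\varphi^i_{k_i}\big](x_i)=0$. (T3) $\mathcal{D}$ and each $\mathcal{D}_i$, $i=1,\ldots,d$, are dense subspaces of $L^p$ for every $1\le p<\infty$. Let $\Lambda_0=\lambda^1_0+\cdots+\lambda^d_0$; put $\mathbb{N}^d_\Lambda=\mathbb{N}^d$ if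 $\Lambda_0>0$ and $\mathbb{N}^d_\Lambda=\mathbb{N}^d\setminus\{(0,\ldots,0)\}$ if $\Lambda_0=0$, and $\Pi f=\sum_{k\in\mathbb{N}^d_\Lambda}\langle f,\varphi_k\rangle_{L^2}\varphi_k$. Let $c^i_k=\|\delta_i\varphi_k\|_2^{-1}$ if $\delta_i\varphi_k\neq0$ and $c^i_k=0$ otherwise. For $t>0$ define the semigroups $P_tf=\sum_{k\in\mathbb{N}^d}e^{-t\lambda_k^{1/2}}\langle f,\varphi_k\rangle_{L^2}\varphi_k$ and $Q^i_tf=\sum_{k\in\mathbb{N}^d}e^{-t\lambda_k^{1/2}}\langle f,c^i_k\delta_i\varphi_k\rangle_{L^2}\,c^i_k\delta_i\varphi_k$. For $F=(f_1,\ldots,f_N):X\times(0,\infty)\to\mathbb{R}^N$ put $|F|_*^2=r|F|^2+|\partial_tF|^2+\sum_{i=1}^d|\mathfrak{d}_iF|^2$, where $|\cdot|$ on the right is the Euclidean norm on $\mathbb{R}^N$ and $\partial_t$, $\mathfrak{d}_i$ act componentwise. *)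

theory Defs
  imports "HOL-Analysis.Analysis"
begin

text \<open>The index type \<open>'n\<close> plays the role of \<open>{1, ..., d}\<close>, so \<open>d = CARD('n) \<ge> 1\<close>. Points of
  \<open>X\<close> are functions \<open>'n \<Rightarrow> real\<close>, multi-indices in \<open>\<nat>\<^sup>d\<close> are functions \<open>'n \<Rightarrow> nat\<close>. A function
  on an open interval is a total function whose values outside the interval are irrelevant.\<close>

definition smooth_on :: "real set \<Rightarrow> (real \<Rightarrow> real) \<Rightarrow> bool" where
  \<comment> \<open>used for open sets only\<close>
  "smooth_on S f \<longleftrightarrow> (\<forall>n. (deriv ^^ n) f differentiable_on S)"

subsection \<open>Measures, Lebesgue spaces\<close>

definition weighted_measure :: "ereal \<Rightarrow> ereal \<Rightarrow> (real \<Rightarrow> real) \<Rightarrow> real measure" where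
  "weighted_measure a b w = density (restrict_space lborel (einterval a b)) (\<lambda>x. ennreal (w x))"

definition product_weighted_measure ::
    "('n::finite \<Rightarrow> ereal) \<Rightarrow> ('n \<Rightarrow> ereal) \<Rightarrow> ('n \<Rightarrow> real \<Rightarrow> real) \<Rightarrow> ('n \<Rightarrow> real) measure" where
  "product_weighted_measure \<sigma> \<Sigma> w = (\<Pi>\<^sub>M i\<in>UNIV. weighted_measure (\<sigma> i) (\<Sigma> i) (w i))"

definition Lp_norm :: "'a measure \<Rightarrow> real \<Rightarrow> ('a \<Rightarrow> 'b::real_normed_vector) \<Rightarrow> real" where
  "Lp_norm M p f = (\<integral>x. norm (f x) powr p \<partial>M) powr (1 / p)"

definition Lp_space :: "'a measure \<Rightarrow> real \<Rightarrow> ('a \<Rightarrow> real) set" where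
  "Lp_space M p = {f \<in> borel_measurable M. integrable M (\<lambda>x. norm (f x) powr p)}"

definition L2_inner :: "'a measure \<Rightarrow> ('a \<Rightarrow> real) \<Rightarrow> ('a \<Rightarrow> real) \<Rightarrow> real" where
  "L2_inner M f g = (\<integral>x. f x * g x \<partial>M)"

definition lin :: "'a measure \<Rightarrow> ('k \<Rightarrow> 'a \<Rightarrow> real) \<Rightarrow> ('a \<Rightarrow> real) set" where
  "lin M b = {f. \<exists>K c. finite K \<and> (\<forall>x\<in>space M. f x = (\<Sum>k\<in>K. c k * b k x))}"

definition dense_in_Lp :: "'a measure \<Rightarrow> real \<Rightarrow> ('a \<Rightarrow> real) set \<Rightarrow> bool" where
  "dense_in_Lp M p D \<longleftrightarrow> D \<subseteq> Lp_space M p \<and>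
     (\<forall>f\<in>Lp_space M p. \<forall>\<epsilon>>0. \<exists>g\<in>D. Lp_norm M p (\<lambda>x. f x - g x) < \<epsilon>)"

definition orthonormal_basis_L2 :: "'a measure \<Rightarrow> ('k \<Rightarrow> 'a \<Rightarrow> real) \<Rightarrow> bool" where
  "orthonormal_basis_L2 M b \<longleftrightarrow> range b \<subseteq> Lp_space M 2 \<and>
     (\<forall>k m. L2_inner M (b k) (b m) = (if k = m then 1 else 0)) \<and> dense_in_Lp M 2 (lin M b)"

subsection \<open>One-dimensional operators\<close>

definition \<delta> :: "(real \<Rightarrow> real) \<Rightarrow> (real \<Rightarrow> real) \<Rightarrow> (real \<Rightarrow> real) \<Rightarrow> real \<Rightarrow> real" where
  "\<delta> p q f x = p x * deriv f x + q x * f x"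

definition \<delta>_adj ::
    "(real \<Rightarrow> real) \<Rightarrow> (real \<Rightarrow> real) \<Rightarrow> (real \<Rightarrow> real) \<Rightarrow> (real \<Rightarrow> real) \<Rightarrow> real \<Rightarrow> real" where
  "\<delta>_adj w p q f x = - (1 / w x) * deriv (\<lambda>y. p y * w y * f y) x + q x * f x"

definition \<dd> :: "(real \<Rightarrow> real) \<Rightarrow> (real \<Rightarrow> real) \<Rightarrow> real \<Rightarrow> real" where
  "\<dd> p f x = p x * deriv f x"

definition L_op :: "(real \<Rightarrow> real) \<Rightarrow> (real \<Rightarrow> real) \<Rightarrow> (real \<Rightarrow> real) \<Rightarrow> real \<Rightarrow>
    (real \<Rightarrow> real) \<Rightarrow> real \<Rightarrow> real" where
  "L_op w p q a f x = \<delta>_adj w p q (\<delta> p q f) x + a * f x"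

definition commutator_fun :: "(real \<Rightarrow> real) \<Rightarrow> (real \<Rightarrow> real) \<Rightarrow> (real \<Rightarrow> real) \<Rightarrow> real \<Rightarrow> real" where
  "commutator_fun w p q x =
     p x * (2 * deriv q x - deriv (\<lambda>y. p y * (deriv w y / w y)) x - deriv (deriv p) x)"

definition potential1 ::
    "(real \<Rightarrow> real) \<Rightarrow> (real \<Rightarrow> real) \<Rightarrow> (real \<Rightarrow> real) \<Rightarrow> real \<Rightarrow> real \<Rightarrow> real" where
  "potential1 w p q a x =
     a + (q x)\<^sup>2 - p x * deriv q x - deriv p x * q x - p x * q x * (deriv w x / w x)"

definition vanishes_at_endpoints :: "ereal \<Rightarrow> ereal \<Rightarrow> (real \<Rightarrow> real) \<Rightarrow> bool" where
  \<comment> \<open>the filters live on the extended reals, so infinite endpoints are covered\<close>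
  "vanishes_at_endpoints a b h \<longleftrightarrow>
     ((h \<circ> real_of_ereal) \<longlongrightarrow> 0) (at_right a) \<and> ((h \<circ> real_of_ereal) \<longlongrightarrow> 0) (at_left b)"

subsection \<open>Several variables\<close>

definition in_var :: "'n \<Rightarrow> ((real \<Rightarrow> real) \<Rightarrow> real \<Rightarrow> real) \<Rightarrow> (('n \<Rightarrow> real) \<Rightarrow> real) \<Rightarrow>
    ('n \<Rightarrow> real) \<Rightarrow> real" where
  \<comment> \<open>lets a one-dimensional operator act in the variable \<open>x i\<close>\<close>
  "in_var i T f x = T (\<lambda>s. f (x(i := s))) (x i)"

definition tensor :: "('n::finite \<Rightarrow> nat \<Rightarrow> real \<Rightarrow> real) \<Rightarrow> ('n \<Rightarrow> nat) \<Rightarrow> ('n \<Rightarrow> real) \<Rightarrow> real" where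
  "tensor \<phi> k x = (\<Prod>i\<in>UNIV. \<phi> i (k i) (x i))"

definition potential :: "('n::finite \<Rightarrow> real \<Rightarrow> real) \<Rightarrow> ('n \<Rightarrow> real \<Rightarrow> real) \<Rightarrow> ('n \<Rightarrow> real \<Rightarrow> real) \<Rightarrow>
    ('n \<Rightarrow> real) \<Rightarrow> ('n \<Rightarrow> real) \<Rightarrow> real" where
  "potential w p q a x = (\<Sum>i\<in>UNIV. potential1 (w i) (p i) (q i) (a i) (x i))"

definition star_norm :: "(('n::finite \<Rightarrow> real) \<Rightarrow> real) \<Rightarrow> ('n \<Rightarrow> real \<Rightarrow> real) \<Rightarrow>
    (('n \<Rightarrow> real) \<Rightarrow> real \<Rightarrow> real ^ 'm::finite) \<Rightarrow> ('n \<Rightarrow> real) \<Rightarrow> real \<Rightarrow> real" where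
  "star_norm r p F x t = sqrt (r x * (norm (F x t))\<^sup>2
     + (norm (\<chi> j. deriv (\<lambda>s. F x s $ j) t))\<^sup>2
     + (\<Sum>i\<in>UNIV. (norm (\<chi> j. in_var i (\<dd> (p i)) (\<lambda>y. F y t $ j) x))\<^sup>2))"

subsection \<open>Spectral operators\<close>

text \<open>The series below are summed pointwise rather than in \<open>L\<^sup>2\<close>. They are applied only to elements
  of \<open>lin M b\<close> for the orthogonal family \<open>b\<close> in question, where all but finitely many terms vanish
  identically; the two readings then coincide, and the pointwise one gives the smooth representative
  that can be differentiated. \<open>\<Lambda> k\<close> is the eigenvalue belonging to \<open>b k\<close>.\<close>

definition proj_Pi :: "'a measure \<Rightarrow> (('n::finite \<Rightarrow> nat) \<Rightarrow> 'a \<Rightarrow> real) \<Rightarrow> (('n \<Rightarrow> nat) \<Rightarrow> real) \<Rightarrow>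
    ('a \<Rightarrow> real) \<Rightarrow> 'a \<Rightarrow> real" where
  \<comment> \<open>\<open>\<Lambda> (\<lambda>_. 0)\<close> is the lowest eigenvalue\<close>
  "proj_Pi M b \<Lambda> f x =
     (\<Sum>\<^sub>\<infinity>k\<in>(if \<Lambda> (\<lambda>_. 0) > 0 then UNIV else UNIV - {\<lambda>_. 0}). L2_inner M f (b k) * b k x)"

definition semigroup_P :: "'a measure \<Rightarrow> ('k \<Rightarrow> 'a \<Rightarrow> real) \<Rightarrow> ('k \<Rightarrow> real) \<Rightarrow> real \<Rightarrow>
    ('a \<Rightarrow> real) \<Rightarrow> 'a \<Rightarrow> real" where
  "semigroup_P M b \<Lambda> t f x = (\<Sum>\<^sub>\<infinity>k. exp (- t * sqrt (\<Lambda> k)) * L2_inner M f (b k) * b k x)"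

definition normalizer :: "'a measure \<Rightarrow> ('a \<Rightarrow> real) \<Rightarrow> real" where
  "normalizer M g = (if \<exists>x\<in>space M. g x \<noteq> 0 then inverse (Lp_norm M 2 g) else 0)"

definition semigroup_Q :: "'a measure \<Rightarrow> ('k \<Rightarrow> 'a \<Rightarrow> real) \<Rightarrow> ('k \<Rightarrow> real) \<Rightarrow> real \<Rightarrow>
    ('a \<Rightarrow> real) \<Rightarrow> 'a \<Rightarrow> real" where
  "semigroup_Q M b \<Lambda> t f x = (\<Sum>\<^sub>\<infinity>k. exp (- t * sqrt (\<Lambda> k))
     * L2_inner M f (\<lambda>y. normalizer M (b k) * b k y) * (normalizer M (b k) * b k x))"

end

theory Submission
  imports Defs
begin

text \<open>Let \<open>u = (F, G)\<close>. For a function \<open>\<Phi>\<close> of \<open>X = |F|\<^sup>2 + \<epsilon>\<close> and \<open>Y = |G|\<^sup>2 + \<epsilon>\<close> of Nazarov--Treil type the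
  chain rule and the equations \<open>\<partial>\<^sub>t\<^sup>2 F = L F\<close>, \<open>\<partial>\<^sub>t\<^sup>2 G\<^sub>j = (L + v\<^sub>j) G\<^sub>j\<close> bound
  \<open>(\<partial>\<^sub>t\<^sup>2 - \<Sum>\<^sub>i \<dd>\<^sub>i\<^sup>* \<dd>\<^sub>i) \<Phi>(X, Y)\<close> from below by \<open>2 \<kappa> |F|\<^sub>* |G|\<^sub>*\<close>. Integrating over a compact
  box times \<open>[0, T]\<close> leaves \<open>\<integral> \<Phi>\<close> at \<open>t = 0\<close>, a term at \<open>t = T\<close> that decays, and fluxes through the
  faces of the box. One lets \<open>\<epsilon> \<rightarrow> 0\<close> first, then the box exhaust \<open>X\<close>, then \<open>T \<rightarrow> \<infinity>\<close>; as
  \<open>\<Phi> \<le> 5/4 (X powr (p/2) + Y powr (q/2))\<close>, replacing \<open>(f, g)\<close> by \<open>(l f, g / l)\<close> and choosing \<open>l\<close>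
  turns the resulting sum into the product of the norms.\<close>

subsection \<open>A smooth Bellman function\<close>

text \<open>The product of the two energies comes from a pointwise weight: convexity yields \<kappa>
  \<tau> times the energy of F plus \<kappa> / \<tau> times that of G, and the arithmetic-geometric
  mean inequality removes \<tau>. F and G share one lower bound because applying \<delta>_i to an
  eigenfunction raises the potential by v_i, which is non-negative by (A1), while (A2) makes r
  non-negative. The weight t is used through t b'' = (t b' - b)'. The obstacle is the flux: it
  contains products of different eigenfunctions, whereas (T2) treats one index at a time. Small
  fluxes are found only for suitable positions of the faces. This suffices because the integrand is
  non-negative, so any box may be enlarged to such faces. Moreover the measure may be infinite;
  hence majorants keep a factor that is small where the eigenfunctions are, and \<epsilon> tends to
  0 on a fixed box. The factor 6 is (2 * 5/4) / (2 * 5/24): \<Phi> is at most 5/4 of the sum of the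
  two powers, and \<kappa> = 5/24 / (max p q - 1).\<close>

text \<open>\<open>X\<close> and \<open>Y\<close> stand for the squares of the two radial variables. In these coordinates \<open>hessian\<close>
  says that the radial part of the Hessian dominates \<open>\<kappa> diag(\<tau>, 1/\<tau>)\<close>; together with \<open>grad_x\<close> and
  \<open>grad_y\<close> this gives the same for the full Hessian on vectors. \<open>growth\<close> is uniform down to
  \<open>X, Y \<rightarrow> 0\<close>, so that bounds on fluxes survive removing the regularisation.\<close>

locale bellman =
  fixes \<Phi> \<Phi>x \<Phi>y \<Phi>xx \<Phi>xy \<Phi>yy \<tau> :: "real \<Rightarrow> real \<Rightarrow> real" and \<kappa> :: real
  assumes chain: "\<And>X Y X' Y' t A. \<lbrakk>(X has_real_derivative X') (at t within A);
      (Y has_real_derivative Y') (at t within A); X t > 0; Y t > 0\<rbrakk> \<Longrightarrow>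
      ((\<lambda>t. \<Phi> (X t) (Y t)) has_real_derivative \<Phi>x (X t) (Y t) * X' + \<Phi>y (X t) (Y t) * Y') (at t within A)"
    and chain_x: "\<And>X Y X' Y' t A. \<lbrakk>(X has_real_derivative X') (at t within A);
      (Y has_real_derivative Y') (at t within A); X t > 0; Y t > 0\<rbrakk> \<Longrightarrow>
      ((\<lambda>t. \<Phi>x (X t) (Y t)) has_real_derivative \<Phi>xx (X t) (Y t) * X' + \<Phi>xy (X t) (Y t) * Y') (at t within A)"
    and chain_y: "\<And>X Y X' Y' t A. \<lbrakk>(X has_real_derivative X') (at t within A);
      (Y has_real_derivative Y') (at t within A); X t > 0; Y t > 0\<rbrakk> \<Longrightarrow>
      ((\<lambda>t. \<Phi>y (X t) (Y t)) has_real_derivative \<Phi>xy (X t) (Y t) * X' + \<Phi>yy (X t) (Y t) * Y') (at t within A)"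
    and continuous: "\<And>\<Psi>. \<Psi> \<in> {\<Phi>, \<Phi>x, \<Phi>y, \<Phi>xx, \<Phi>xy, \<Phi>yy} \<Longrightarrow>
      continuous_on ({0<..} \<times> {0<..}) (\<lambda>z. \<Psi> (fst z) (snd z))"
    and measurable: "\<And>\<Psi>. \<Psi> \<in> {\<Phi>, \<Phi>x, \<Phi>y, \<Phi>xx, \<Phi>xy, \<Phi>yy} \<Longrightarrow>
      (\<lambda>z. \<Psi> (fst z) (snd z)) \<in> borel_measurable (borel \<Otimes>\<^sub>M borel)"
    and nonneg: "\<And>X Y. X > 0 \<Longrightarrow> Y > 0 \<Longrightarrow> \<Phi> X Y \<ge> 0"
    and kappa_nonneg: "\<kappa> \<ge> 0"
    and tau_pos: "\<And>X Y. X > 0 \<Longrightarrow> Y > 0 \<Longrightarrow> \<tau> X Y > 0"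
    and grad_x: "\<And>X Y. X > 0 \<Longrightarrow> Y > 0 \<Longrightarrow> \<kappa> * \<tau> X Y \<le> 2 * \<Phi>x X Y"
    and grad_y: "\<And>X Y. X > 0 \<Longrightarrow> Y > 0 \<Longrightarrow> \<kappa> / \<tau> X Y \<le> 2 * \<Phi>y X Y"
    and hessian: "\<And>X Y a b. X > 0 \<Longrightarrow> Y > 0 \<Longrightarrow> \<kappa> * \<tau> X Y * a\<^sup>2 + \<kappa> / \<tau> X Y * b\<^sup>2 \<le>
      (2 * \<Phi>x X Y + 4 * X * \<Phi>xx X Y) * a\<^sup>2 + 8 * (sqrt X * sqrt Y * \<Phi>xy X Y) * (a * b)
        + (2 * \<Phi>y X Y + 4 * Y * \<Phi>yy X Y) * b\<^sup>2"
    and growth: "\<exists>C N. \<forall>X>0. \<forall>Y>0. \<Phi>x X Y * sqrt X \<le> C * (1 + X + Y) ^ N \<and>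
      \<Phi>y X Y * sqrt Y \<le> C * (1 + X + Y) ^ N"

text \<open>The two blocks play symmetric roles once \<open>\<tau>\<close> is replaced by its
  reciprocal. In this way exponents \<open>p < 2\<close> are reduced to their conjugates, which
  exceed 2.\<close>

lemma (in bellman) swap:
  "bellman (\<lambda>X Y. \<Phi> Y X) (\<lambda>X Y. \<Phi>y Y X) (\<lambda>X Y. \<Phi>x Y X) (\<lambda>X Y. \<Phi>yy Y X) (\<lambda>X Y. \<Phi>xy Y X)
     (\<lambda>X Y. \<Phi>xx Y X) (\<lambda>X Y. 1 / \<tau> Y X) \<kappa>"
proof unfold_locales
  fix X Y :: "real \<Rightarrow> real" and X' Y' t A
  assume *: "(X has_real_derivative X') (at t within A)" "(Y has_real_derivative Y') (at t within A)"
    "X t > 0" "Y t > 0"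
  show "((\<lambda>t. \<Phi> (Y t) (X t)) has_real_derivative \<Phi>y (Y t) (X t) * X' + \<Phi>x (Y t) (X t) * Y') (at t within A)"
    using chain[OF *(2,1,4,3)] by (simp add: add.commute)
  show "((\<lambda>t. \<Phi>y (Y t) (X t)) has_real_derivative \<Phi>yy (Y t) (X t) * X' + \<Phi>xy (Y t) (X t) * Y') (at t within A)"
    using chain_y[OF *(2,1,4,3)] by (simp add: add.commute)
  show "((\<lambda>t. \<Phi>x (Y t) (X t)) has_real_derivative \<Phi>xy (Y t) (X t) * X' + \<Phi>xx (Y t) (X t) * Y') (at t within A)"
    using chain_x[OF *(2,1,4,3)] by (simp add: add.commute)
next
  fix \<Psi> assume "\<Psi> \<in> {\<lambda>X Y. \<Phi> Y X, \<lambda>X Y. \<Phi>y Y X, \<lambda>X Y. \<Phi>x Y X, \<lambda>X Y. \<Phi>yy Y X, \<lambda>X Y. \<Phi>xy Y X, \<lambda>X Y. \<Phi>xx Y X}"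
  then have m: "(\<lambda>X Y. \<Psi> Y X) \<in> {\<Phi>, \<Phi>x, \<Phi>y, \<Phi>xx, \<Phi>xy, \<Phi>yy}" by auto
  have "continuous_on ({0<..} \<times> {0<..}) ((\<lambda>z. \<Psi> (snd z) (fst z)) \<circ> prod.swap)"
    by (rule continuous_on_compose) (auto intro!: continuous_on_subset[OF continuous[OF m]] continuous_on_swap)
  then show "continuous_on ({0<..} \<times> {0<..}) (\<lambda>z. \<Psi> (fst z) (snd z))" by (simp add: o_def)
  have "(\<lambda>z. (snd z, fst z)) \<in> borel \<Otimes>\<^sub>M borel \<rightarrow>\<^sub>M (borel \<Otimes>\<^sub>M borel :: (real \<times> real) measure)" by measurable
  from measurable_compose[OF this measurable[OF m]]
  show "(\<lambda>z. \<Psi> (fst z) (snd z)) \<in> borel_measurable (borel \<Otimes>\<^sub>M borel)" by simp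
next
  fix X Y :: real assume X: "X > 0" "Y > 0"
  show "0 \<le> \<Phi> Y X" "0 < 1 / \<tau> Y X" "\<kappa> * (1 / \<tau> Y X) \<le> 2 * \<Phi>y Y X" "\<kappa> / (1 / \<tau> Y X) \<le> 2 * \<Phi>x Y X"
    using nonneg[OF X(2,1)] tau_pos[OF X(2,1)] grad_y[OF X(2,1)] grad_x[OF X(2,1)] by auto
  fix a b :: real
  show "\<kappa> * (1 / \<tau> Y X) * a\<^sup>2 + \<kappa> / (1 / \<tau> Y X) * b\<^sup>2
       \<le> (2 * \<Phi>y Y X + 4 * X * \<Phi>yy Y X) * a\<^sup>2 + 8 * (sqrt X * sqrt Y * \<Phi>xy Y X) * (a * b) +
          (2 * \<Phi>x Y X + 4 * Y * \<Phi>xx Y X) * b\<^sup>2"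
    using hessian[OF X(2,1), of b a] by (simp add: algebra_simps)
next
  show "\<kappa> \<ge> 0" by (rule kappa_nonneg)
  from growth obtain C N where "\<forall>X>0. \<forall>Y>0. \<Phi>x X Y * sqrt X \<le> C * (1 + X + Y) ^ N \<and>
      \<Phi>y X Y * sqrt Y \<le> C * (1 + X + Y) ^ N" by blast
  moreover have "1 + X + Y = 1 + Y + X" for X Y :: real by simp
  ultimately show "\<exists>C N. \<forall>X>0. \<forall>Y>0. \<Phi>y Y X * sqrt X \<le> C * (1 + X + Y) ^ N \<and> \<Phi>x Y X * sqrt Y \<le> C * (1 + X + Y) ^ N"
    by metis
qed

text \<open>Here \<open>u\<close> and \<open>d1\<close> stand for \<open>X powr (p - 2)\<close> and
  \<open>nt_D X Y powr (- (q / 2) - 1)\<close>. The two sides differ by an explicit multiple of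
  \<open>(p - 1) * q - p\<close>, the one relation between the exponents that enters.\<close>

lemma nt_x_aux: fixes p q u d1 D X X' Y' :: real
  assumes "(p - 1) * q = p"
  shows "((1 - q / 2) * (D * d1) * ((p - 1) * u * X' + Y') +
     ((p - 2) / 2 * ((p - 1) * u * X') * (D * d1) +
      - (q / 2) * d1 * ((p - 1) * u * X' + Y') * ((p - 2) / 2 * (X * u)))) =
     (p * (p - 2) / 2 * u * (D * d1) - p * (p - 2) / 4 * (u * (X * u)) * d1) * X' +
     ((1 - q / 2) * d1 * (D - p / 2 * (X * u))) * Y'" (is "?l = ?r")
proof -
  have "?l - ?r = - ((p - 1) * q - p) * (D * d1 * u * X' / 2 + (p - 2) / 4 * (u * X * u * d1) * X' + X * u * d1 * Y' / 2)"
    by (simp add: field_simps)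
  then show ?thesis using assms by simp
qed
lemma nt_y_aux: fixes p q u d1 D X X' Y' :: real
  assumes "(p - 1) * q = p"
  shows "((1 - q / 2) * X' * (D * d1) + - (q / 2) * d1 * ((p - 1) * u * X' + Y') * ((1 - q / 2) * X)) =
     ((1 - q / 2) * d1 * (D - p / 2 * (X * u))) * X' - ((1 - q / 2) * (q / 2) * X * d1) * Y'"  (is "?l = ?r")
proof -
  have "?l - ?r = - ((p - 1) * q - p) * ((1 - q / 2) * d1 * X * u * X' / 2)"
    by (simp add: field_simps)
  then show ?thesis using assms by simp
qed

section \<open>The explicit Bellman function for p at least 2\<close>

context
  fixes p q :: real
  assumes p: "2 \<le> p" and q: "q = p / (p - 1)"
begin

lemma q_bounds: "1 < q" "q \<le> 2" "(p - 1) * (q - 1) = 1" "(p - 1) * q = p"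
  using p by (auto simp: q field_simps)

text \<open>The usual Nazarov--Treil function is only \<open>C\<^sup>1\<close>: its mixed term is \<open>X * Y powr (1 - q/2)\<close> where
  \<open>X powr (p - 1) \<le> Y\<close> and a sum of powers elsewhere. Replacing \<open>Y\<close> in the mixed term by \<open>X powr (p - 1) + Y\<close> keeps the
  function smooth for \<open>X, Y > 0\<close>, so no mollification is needed; the convexity constant obtained is
  still good enough for the factor 6.\<close>

definition nt_D :: "real \<Rightarrow> real \<Rightarrow> real" where
  "nt_D X Y = X powr (p - 1) + Y"

text \<open>For \<open>p > 2\<close> the pure powers alone fail: as \<open>X\<close> tends to 0 with
  \<open>Y\<close> fixed, the curvature in the first variable degenerates while that in the second
  stays bounded. The mixed term restores a curvature of order
  \<open>nt_D X Y powr (1 - q / 2)\<close>; the coefficient \<open>(q - 1) / 8\<close> keeps its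
  unfavourable contributions small enough to be absorbed.\<close>

definition nt :: "real \<Rightarrow> real \<Rightarrow> real" where
  "nt X Y = X powr (p / 2) + Y powr (q / 2) + (q - 1) / 8 * (X * nt_D X Y powr (1 - q / 2))"

definition nt_x :: "real \<Rightarrow> real \<Rightarrow> real" where
  "nt_x X Y = p / 2 * X powr (p / 2 - 1) + (q - 1) / 8 *
     (nt_D X Y powr (1 - q / 2) + (p - 2) / 2 * X powr (p - 1) * nt_D X Y powr (- (q / 2)))"

definition nt_y :: "real \<Rightarrow> real \<Rightarrow> real" where
  "nt_y X Y = q / 2 * Y powr (q / 2 - 1) + (q - 1) / 8 * ((1 - q / 2) * X * nt_D X Y powr (- (q / 2)))"

definition nt_xx :: "real \<Rightarrow> real \<Rightarrow> real" where
  "nt_xx X Y = p / 2 * (p / 2 - 1) * X powr (p / 2 - 2) + (q - 1) / 8 *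
     (p * (p - 2) / 2 * X powr (p - 2) * nt_D X Y powr (- (q / 2))
      - p * (p - 2) / 4 * X powr (2 * p - 3) * nt_D X Y powr (- (q / 2) - 1))"

definition nt_xy :: "real \<Rightarrow> real \<Rightarrow> real" where
  "nt_xy X Y = (q - 1) / 8 * ((1 - q / 2) * nt_D X Y powr (- (q / 2) - 1) * (nt_D X Y - p / 2 * X powr (p - 1)))"

definition nt_yy :: "real \<Rightarrow> real \<Rightarrow> real" where
  "nt_yy X Y = q / 2 * (q / 2 - 1) * Y powr (q / 2 - 2) -
     (q - 1) / 8 * ((1 - q / 2) * (q / 2) * X * nt_D X Y powr (- (q / 2) - 1))"

lemma nt_D_pos: "X > 0 \<Longrightarrow> Y > 0 \<Longrightarrow> nt_D X Y > 0"
  by (simp add: nt_D_def add_nonneg_pos)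

lemma nt_D_chain:
  assumes "(X has_real_derivative X') (at t within A)" "(Y has_real_derivative Y') (at t within A)"
    "X t > 0" "Y t > 0"
  shows "((\<lambda>t. nt_D (X t) (Y t)) has_real_derivative (p - 1) * X t powr (p - 2) * X' + Y') (at t within A)"
  unfolding nt_D_def by (rule derivative_eq_intros assms refl | simp)+ 

lemma powr_chain:
  assumes "(X has_real_derivative X') (at t within A)" "X t > 0"
  shows "((\<lambda>t. X t powr c) has_real_derivative c * X t powr (c - 1) * X') (at t within A)"
  by (rule derivative_eq_intros assms refl | simp)+ 

text \<open>Stated along curves, so that it applies directly to the flow. A single
  \<open>nt_xy\<close> serves as both mixed derivatives; their agreement rests on
  \<open>(p - 1) * q = p\<close>.\<close>

lemma nt_chain:
  assumes X: "(X has_real_derivative X') (at t within A)" and Y: "(Y has_real_derivative Y') (at t within A)"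
    and pos: "X t > 0" "Y t > 0"
  shows "((\<lambda>t. nt (X t) (Y t)) has_real_derivative nt_x (X t) (Y t) * X' + nt_y (X t) (Y t) * Y') (at t within A)"
    and "((\<lambda>t. nt_x (X t) (Y t)) has_real_derivative nt_xx (X t) (Y t) * X' + nt_xy (X t) (Y t) * Y') (at t within A)"
    and "((\<lambda>t. nt_y (X t) (Y t)) has_real_derivative nt_xy (X t) (Y t) * X' + nt_yy (X t) (Y t) * Y') (at t within A)"
proof -
  note D = nt_D_chain[OF X Y pos]
  note Dp = nt_D_pos[OF pos]
  note ch = powr_chain[OF X pos(1)] powr_chain[OF Y pos(2)] powr_chain[OF D Dp]
  let ?X = "X t" and ?Y = "Y t" and ?D = "nt_D (X t) (Y t)"
  \<comment> \<open>The powers occurring in the mixed term are rewritten over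
    \<open>X powr (p - 2)\<close> and \<open>D powr (- (q / 2) - 1)\<close>, after which only
    polynomial identities remain.\<close>
  have X1: "?X powr (p - 1) = ?X * ?X powr (p - 2)"
    using pos powr_add[of ?X 1 "p - 2"] by simp
  have X3: "?X powr (2 * p - 3) = ?X powr (p - 2) * ?X powr (p - 1)"
    using powr_add[of ?X "p - 2" "p - 1"] by (simp add: algebra_simps)
  have D1: "?D powr (- (q / 2)) = ?D * ?D powr (- (q / 2) - 1)"
    using powr_add[of ?D 1 "- (q / 2) - 1"] Dp by simp
  have e1: "(1 - q / 2) * (p - 1) = (p - 2) / 2"
    using q_bounds(4) by (auto simp: field_simps)
  note ders = ch X Y DERIV_cmult DERIV_mult DERIV_add DERIV_diff
  have ex: "p / 2 - 1 - 1 = p / 2 - 2" "q / 2 - 1 - 1 = q / 2 - 2" "1 - q / 2 - 1 = - (q / 2)" "p - 1 - 1 = p - 2"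
    by simp_all
  show "((\<lambda>t. nt (X t) (Y t)) has_real_derivative nt_x (X t) (Y t) * X' + nt_y (X t) (Y t) * Y') (at t within A)"
    unfolding nt_def
    apply (rule DERIV_cong, (rule ders)+)
    unfolding nt_x_def nt_y_def X1 ex e1[symmetric] by (simp add: field_simps)
  show "((\<lambda>t. nt_x (X t) (Y t)) has_real_derivative nt_xx (X t) (Y t) * X' + nt_xy (X t) (Y t) * Y') (at t within A)"
    unfolding nt_x_def
    apply (rule DERIV_cong, (rule ders)+)
    unfolding nt_xx_def nt_xy_def X3 X1 ex D1 unfolding nt_x_aux[OF q_bounds(4)] by (simp add: field_simps)
  show "((\<lambda>t. nt_y (X t) (Y t)) has_real_derivative nt_xy (X t) (Y t) * X' + nt_yy (X t) (Y t) * Y') (at t within A)"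
    unfolding nt_y_def
    apply (rule DERIV_cong, (rule ders)+)
    unfolding nt_yy_def nt_xy_def X3 X1 ex D1 unfolding nt_y_aux[OF q_bounds(4)] by (simp add: algebra_simps)
qed

text \<open>Subtracting \<open>c1\<close> and \<open>c2\<close> from the diagonal leaves entries of
  at least \<open>M1\<close> and \<open>M2\<close>. The remaining form is non-negative because the
  squared off-diagonal entry is at most \<open>M1 * M2\<close>.\<close>

lemma quadratic_form_mono:
  fixes M1 M2 E1 E2 E3 a b c1 c2 :: real
  assumes "E1 - c1 \<ge> M1" "E2 - c2 \<ge> M2" "M1 \<ge> 0" "M2 \<ge> 0" "E3\<^sup>2 \<le> M1 * M2"
  shows "c1 * a\<^sup>2 + c2 * b\<^sup>2 \<le> E1 * a\<^sup>2 + 2 * E3 * (a * b) + E2 * b\<^sup>2"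
proof -
  have "\<bar>E3\<bar> \<le> sqrt M1 * sqrt M2"
    using real_sqrt_le_mono[OF assms(5)] by (simp add: real_sqrt_mult)
  then have "\<bar>E3 * (a * b)\<bar> \<le> (sqrt M1 * \<bar>a\<bar>) * (sqrt M2 * \<bar>b\<bar>)"
    using mult_right_mono[of "\<bar>E3\<bar>" "sqrt M1 * sqrt M2" "\<bar>a\<bar> * \<bar>b\<bar>"] by (simp add: abs_mult mult_ac)
  moreover have "2 * ((sqrt M1 * \<bar>a\<bar>) * (sqrt M2 * \<bar>b\<bar>)) \<le> (sqrt M1 * \<bar>a\<bar>)\<^sup>2 + (sqrt M2 * \<bar>b\<bar>)\<^sup>2"
    using sum_squares_bound[of "sqrt M1 * \<bar>a\<bar>" "sqrt M2 * \<bar>b\<bar>"] by simp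
  ultimately have "0 \<le> M1 * a\<^sup>2 + 2 * (E3 * (a * b)) + M2 * b\<^sup>2"
    using assms by (simp add: power_mult_distrib)
  moreover have "M1 * a\<^sup>2 \<le> (E1 - c1) * a\<^sup>2" "M2 * b\<^sup>2 \<le> (E2 - c2) * b\<^sup>2"
    using assms by (auto intro!: mult_right_mono)
  ultimately show ?thesis by (simp add: algebra_simps)
qed

text \<open>The first two bounds are immediate; \<open>(p - 1) * (q - 1) = 1\<close> turns the first
  of them into the third.\<close>

lemma nt_D_bounds:
  assumes "X > 0" "Y > 0"
  shows "X powr (p - 1) \<le> nt_D X Y" "Y \<le> nt_D X Y" "X \<le> nt_D X Y powr (q - 1)"
proof -
  show *: "X powr (p - 1) \<le> nt_D X Y" "Y \<le> nt_D X Y" using assms by (auto simp: nt_D_def)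
  have "X = (X powr (p - 1)) powr (q - 1)" using assms q_bounds by (simp add: powr_powr)
  also have "\<dots> \<le> nt_D X Y powr (q - 1)" using * q_bounds by (intro powr_mono2) auto
  finally show "X \<le> nt_D X Y powr (q - 1)" .
qed

text \<open>The diagonal entries are at least \<open>(q - 1) / 4 * d + p * (p - 1) * x\<close> and
  \<open>(q - 1) * y\<close>, with \<open>d\<close>, \<open>x\<close>, \<open>y\<close> as in the
  proof and \<open>1 / d \<le> y\<close>. A share of 5/12 of the \<open>d\<close>-part and of the
  second entry is given away: \<open>\<tau> = d / 2\<close> makes the two shares equal and produces
  \<open>5 / 24 * (q - 1)\<close>. The remaining 7/12 control the mixed derivative.\<close>

lemma nt_hessian:
  assumes pos: "X > 0" "Y > 0"
  shows "5 / 24 * (q - 1) * (nt_D X Y powr (1 - q / 2) / 2) * a\<^sup>2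
      + 5 / 24 * (q - 1) / (nt_D X Y powr (1 - q / 2) / 2) * b\<^sup>2 \<le>
      (2 * nt_x X Y + 4 * X * nt_xx X Y) * a\<^sup>2 + 8 * (sqrt X * sqrt Y * nt_xy X Y) * (a * b)
        + (2 * nt_y X Y + 4 * Y * nt_yy X Y) * b\<^sup>2"
proof -
  define D where "D = nt_D X Y"
  have D: "D > 0" "X powr (p - 1) \<le> D" "Y \<le> D" "X \<le> D powr (q - 1)"
    unfolding D_def using nt_D_pos[OF pos] nt_D_bounds[OF pos] by auto
  define u where "u = X powr (p - 1)"
  define y where "y = Y powr (q / 2 - 1)"
  define x where "x = X powr (p / 2 - 1)"
  define d where "d = D powr (1 - q / 2)"
  define d1 where "d1 = D powr (- (q / 2) - 1)"
  have nn: "u > 0" "y > 0" "x > 0" "d > 0" "d1 > 0" using pos D by (auto simp: u_def y_def x_def d_def d1_def)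
  have p0: "p > 0" "p - 1 > 0" using p by auto
  note q = q_bounds
  have D2: "D powr (- (q / 2)) = D * d1" and Dd: "d = D * (D * d1)"
    using powr_add[of D 1 "- (q / 2) - 1"] powr_add[of D 2 "- (q / 2) - 1"] D(1)
    by (simp_all add: d_def d1_def powr_numeral power2_eq_square)
  have X1: "X * X powr (p / 2 - 2) = x" "X * X powr (p - 2) = u" "X * X powr (2 * p - 3) = u * u"
    using pos powr_add[of X 1 "p / 2 - 2"] powr_add[of X 1 "p - 2"] powr_add[of X 1 "2 * p - 3"]
      powr_add[of X "p - 1" "p - 1"] by (simp_all add: x_def u_def)
  have Y1: "Y * Y powr (q / 2 - 2) = y"
    using pos powr_add[of Y 1 "q / 2 - 2"] by (simp add: y_def)
  \<comment> \<open>\<open>f1\<close> to \<open>f4\<close> are homogeneity estimates: bounding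
    single factors by powers of \<open>D\<close>, or of \<open>Y\<close>, makes the exponents add up
    to those of \<open>d\<close>, \<open>x\<close> and \<open>y\<close>.\<close>
  have f1: "1 / d \<le> y"
  proof -
    have "1 / d = D powr (q / 2 - 1)" using D(1) by (simp add: d_def powr_minus_divide[symmetric])
    also have "\<dots> \<le> y" unfolding y_def using D pos q by (intro powr_mono2') auto
    finally show ?thesis .
  qed
  have f2: "X * Y * d1 \<le> y"
  proof -
    have "X * d1 \<le> D powr (q - 1) * d1" using D nn by (intro mult_right_mono) auto
    also have "\<dots> = D powr (q / 2 - 2)" unfolding d1_def by (simp add: powr_add[symmetric])
    also have "\<dots> \<le> Y powr (q / 2 - 2)" using D pos q by (intro powr_mono2') auto
    finally have "Y * (X * d1) \<le> Y * Y powr (q / 2 - 2)" using pos by (intro mult_left_mono) auto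
    then show ?thesis using Y1 by (simp add: mult_ac)
  qed
  have Y2: "Y = y * Y powr (2 - q / 2)" using pos powr_add[of Y "q / 2 - 1" "2 - q / 2"] by (simp add: y_def)
  have Y3: "Y powr (2 - q / 2) \<le> D powr (2 - q / 2)" using D pos q by (intro powr_mono2) auto
  have f3: "X * Y * (D * d1)\<^sup>2 \<le> d * y"
  proof -
    have s: "(D * d1)\<^sup>2 = D powr (- q)"
      unfolding D2[symmetric] power2_eq_square by (simp add: powr_add[symmetric])
    have "X * Y * (D * d1)\<^sup>2 = y * (X * Y powr (2 - q / 2) * D powr (- q))"
      unfolding s by (subst Y2) simp
    also have "\<dots> \<le> y * (D powr (q - 1) * D powr (2 - q / 2) * D powr (- q))"
      using nn D Y3 pos by (intro mult_left_mono mult_right_mono mult_mono) auto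
    also have "\<dots> = y * d" by (simp add: d_def powr_add[symmetric])
    finally show ?thesis by (simp add: mult.commute)
  qed
  have f4: "X * Y * (u * d1)\<^sup>2 \<le> x * y"
  proof -
    have s: "d1\<^sup>2 = D powr (- q - 2)"
      unfolding d1_def power2_eq_square by (simp add: powr_add[symmetric])
    have pq: "(q - 1) * (3 * p / 2) = 3 * q / 2" using q(3,4) by algebra
    have "X * u\<^sup>2 = x * X powr (3 * p / 2)"
      unfolding u_def x_def power2_eq_square using pos powr_add[of X 1 "(p - 1) + (p - 1)"]
      by (simp add: powr_add[symmetric] algebra_simps)
    also have "X powr (3 * p / 2) \<le> (D powr (q - 1)) powr (3 * p / 2)"
      using D pos p0 by (intro powr_mono2) auto
    also have "(D powr (q - 1)) powr (3 * p / 2) = D powr (3 * q / 2)" unfolding powr_powr pq ..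
    finally have Xu: "X * u\<^sup>2 \<le> x * D powr (3 * q / 2)" using nn by (simp add: mult_left_mono)
    have "X * Y * (u * d1)\<^sup>2 = (X * u\<^sup>2) * (y * Y powr (2 - q / 2)) * D powr (- q - 2)"
      unfolding power_mult_distrib s by (subst Y2) simp
    also have "\<dots> \<le> (x * D powr (3 * q / 2)) * (y * D powr (2 - q / 2)) * D powr (- q - 2)"
      using nn pos by (intro mult_right_mono[OF mult_mono[OF Xu mult_left_mono[OF Y3]]]) auto
    also have "\<dots> = x * y * D powr (3 * q / 2 + (2 - q / 2) + (- q - 2))" by (simp only: powr_add mult_ac)
    also have "\<dots> = x * y" using D(1) by simp
    finally show ?thesis .
  qed
  let ?E1 = "2 * nt_x X Y + 4 * X * nt_xx X Y" and ?E2 = "2 * nt_y X Y + 4 * Y * nt_yy X Y"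
    and ?E3 = "4 * (sqrt X * sqrt Y * nt_xy X Y)"
  have E1: "?E1 = p * (p - 1) * x + (q - 1) / 8 * (2 * d + (p - 2) * u * (D * d1) + 2 * (p - 2) * p * u * (D * d1)
      - (p - 2) * p * u * u * d1)"
  proof -
    have "4 * X * nt_xx X Y = 4 * (p / 2 * (p / 2 - 1) * (X * X powr (p / 2 - 2)) + (q - 1) / 8 *
       (p * (p - 2) / 2 * (X * X powr (p - 2)) * D powr (- (q / 2))
        - p * (p - 2) / 4 * (X * X powr (2 * p - 3)) * D powr (- (q / 2) - 1)))"
      unfolding nt_xx_def D_def by (simp only: algebra_simps)
    then show ?thesis
      unfolding X1 nt_x_def D_def[symmetric] d_def[symmetric] d1_def[symmetric] D2 u_def[symmetric] x_def[symmetric]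
      by (simp add: field_simps)
  qed
  \<comment> \<open>The only negative term of \<open>?E1\<close> is absorbed by the one before it
    since \<open>u \<le> D\<close>; the other terms with a factor \<open>p - 2\<close> are
    non-negative because \<open>p \<ge> 2\<close>.\<close>
  have "u * u * d1 \<le> u * D * d1" using D nn unfolding u_def[symmetric] by (intro mult_right_mono mult_left_mono) auto
  then have "(p - 2) * p * (u * u * d1) \<le> (p - 2) * p * (u * D * d1)" using p by (intro mult_left_mono) auto
  moreover have "0 \<le> (p - 2) * p * (u * D * d1)" "0 \<le> (p - 2) * (u * D * d1)" using p nn D by auto
  ultimately have "2 * d \<le> 2 * d + (p - 2) * u * (D * d1) + 2 * (p - 2) * p * u * (D * d1)
      - (p - 2) * p * u * u * d1" by (simp only: mult.assoc)
  then have "(q - 1) / 8 * (2 * d) \<le> (q - 1) / 8 * (2 * d + (p - 2) * u * (D * d1) + 2 * (p - 2) * p * u * (D * d1)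
      - (p - 2) * p * u * u * d1)" using q by (intro mult_left_mono) auto
  then have E1': "?E1 \<ge> p * (p - 1) * x + (q - 1) / 4 * d" unfolding E1 by simp
  have uD: "D = u + Y" by (simp add: D_def u_def nt_D_def)
  have E2: "?E2 = q * (q - 1) * y + (q - 1) / 8 * (2 - q) * X * d1 * (D - q * Y)"
  proof -
    have "4 * Y * nt_yy X Y = 4 * (q / 2 * (q / 2 - 1) * (Y * Y powr (q / 2 - 2)) -
       (q - 1) / 8 * ((1 - q / 2) * (q / 2) * X * Y * D powr (- (q / 2) - 1)))"
      unfolding nt_yy_def D_def by (simp only: algebra_simps)
    then show ?thesis
      unfolding Y1 nt_y_def D_def[symmetric] d1_def[symmetric] D2 y_def[symmetric] by (simp add: field_simps)
  qed
  \<comment> \<open>\<open>D - q * Y\<close> may be negative but never falls below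
    \<open>- (q - 1) * Y\<close>, as \<open>D \<ge> Y\<close>. By \<open>f2\<close> this costs a
    small multiple of \<open>y\<close>.\<close>
  have "- ((q - 1) * Y) \<le> D - q * Y" using uD nn by (simp add: algebra_simps)
  then have "(q - 1) / 8 * (2 - q) * X * d1 * (- ((q - 1) * Y)) \<le> (q - 1) / 8 * (2 - q) * X * d1 * (D - q * Y)"
    using q nn pos by (intro mult_left_mono) auto
  moreover have "(q - 1) / 8 * (2 - q) * (q - 1) * (X * Y * d1) \<le> (q - 1) / 8 * (2 - q) * (q - 1) * y"
    using f2 q by (intro mult_left_mono) auto
  moreover have "(q - 1) / 8 * (2 - q) * X * d1 * (- ((q - 1) * Y)) = - ((q - 1) / 8 * (2 - q) * (q - 1) * (X * Y * d1))"
    "(q - 1) * y * (q - (2 - q) * (q - 1) / 8) = q * (q - 1) * y - (q - 1) / 8 * (2 - q) * (q - 1) * y"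
    by (simp_all add: field_simps)
  ultimately have "?E2 \<ge> (q - 1) * y * (q - (2 - q) * (q - 1) / 8)" unfolding E2 by linarith
  moreover have "q - (2 - q) * (q - 1) / 8 \<ge> 1"
  proof -
    have "(2 - q) * (q - 1) \<le> 1 * (q - 1)" using q by (intro mult_right_mono) auto
    then have "(2 - q) * (q - 1) / 8 \<le> (q - 1) / 8" by simp
    also have "\<dots> \<le> q - 1" using q by simp
    finally show ?thesis by linarith
  qed
  then have "(q - 1) * y * (q - (2 - q) * (q - 1) / 8) \<ge> (q - 1) * y * 1"
    using q nn by (intro mult_left_mono) auto
  ultimately have E2': "?E2 \<ge> (q - 1) * y" by simp
  have E3: "?E3\<^sup>2 = ((q - 1) / 8)\<^sup>2 * (2 - q)\<^sup>2 * (X * Y * d1\<^sup>2 * (2 * D - p * u)\<^sup>2)"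
    unfolding nt_xy_def D_def[symmetric] d1_def[symmetric] u_def[symmetric] power_mult_distrib
    using pos by (simp add: power_divide) (simp add: power2_eq_square field_simps)
  \<comment> \<open>The term \<open>- 4 * p * D * u\<close> of the square is non-positive and is
    dropped.\<close>
  have "(2 * D - p * u)\<^sup>2 \<le> 4 * D\<^sup>2 + p\<^sup>2 * u\<^sup>2"
    using p nn D(1) by (simp add: power2_eq_square algebra_simps)
  then have "X * Y * d1\<^sup>2 * (2 * D - p * u)\<^sup>2 \<le> X * Y * d1\<^sup>2 * (4 * D\<^sup>2 + p\<^sup>2 * u\<^sup>2)"
    using pos by (intro mult_left_mono) auto
  also have "\<dots> = 4 * (X * Y * (D * d1)\<^sup>2) + p\<^sup>2 * (X * Y * (u * d1)\<^sup>2)" by (simp add: power_mult_distrib algebra_simps)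
  also have "\<dots> \<le> 4 * (d * y) + p\<^sup>2 * (x * y)" by (intro add_mono mult_left_mono f3 f4) auto
  finally have E3': "X * Y * d1\<^sup>2 * (2 * D - p * u)\<^sup>2 \<le> 4 * (d * y) + p\<^sup>2 * (x * y)" .
  have "?E3\<^sup>2 \<le> ((q - 1) / 8)\<^sup>2 * 1 * (4 * (d * y) + p\<^sup>2 * (x * y))"
    unfolding E3 using q pos nn by (intro mult_mono E3' power_le_one mult_nonneg_nonneg add_nonneg_nonneg) auto
  also have "\<dots> = (q - 1)\<^sup>2 / 16 * (d * y) + q\<^sup>2 / 64 * (x * y)"
  proof -
    have "(q - 1) * p = q" using q(3,4) by algebra
    then have "(q - 1)\<^sup>2 * p\<^sup>2 = q\<^sup>2" by (simp add: power_mult_distrib[symmetric])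
    then show ?thesis by (simp add: power_divide algebra_simps)
  qed
  \<comment> \<open>\<open>49 / 576\<close> is the product of the shares \<open>7 / 48\<close> and
    \<open>7 / 12\<close>, against the required \<open>1 / 16 = 36 / 576\<close>. In the
    \<open>x * y\<close> term the relation \<open>(p - 1) * (q - 1) = 1\<close> is used.\<close>
  also have "\<dots> \<le> (q - 1)\<^sup>2 * 49 / 576 * (d * y) + 7 / 12 * p * (x * y)"
  proof (intro add_mono mult_right_mono)
    have "q\<^sup>2 \<le> 2\<^sup>2" using q by (intro power_mono) auto
    then show "q\<^sup>2 / 64 \<le> 7 / 12 * p" using p by simp
  qed (use nn in auto)
  also have "\<dots> = ((q - 1) * 7 / 48 * d + p * (p - 1) * x) * ((q - 1) * 7 / 12 * y)"
    using q(3) by algebra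
  finally have E3'': "?E3\<^sup>2 \<le> ((q - 1) * 7 / 48 * d + p * (p - 1) * x) * ((q - 1) * 7 / 12 * y)" .
  have "5 / 24 * (q - 1) * (d / 2) * a\<^sup>2 + 5 / 24 * (q - 1) / (d / 2) * b\<^sup>2
    \<le> ?E1 * a\<^sup>2 + 2 * ?E3 * (a * b) + ?E2 * b\<^sup>2"
  proof (rule quadratic_form_mono[OF _ _ _ _ E3''])
    show "(q - 1) * 7 / 48 * d + p * (p - 1) * x \<le> ?E1 - 5 / 24 * (q - 1) * (d / 2)"
      using E1' by (simp add: field_simps)
    have "5 / 24 * (q - 1) / (d / 2) = 5 / 12 * (q - 1) * (1 / d)" using nn by (simp add: field_simps)
    also have "\<dots> \<le> 5 / 12 * (q - 1) * y" using f1 q by (intro mult_left_mono) auto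
    finally show "(q - 1) * 7 / 12 * y \<le> ?E2 - 5 / 24 * (q - 1) / (d / 2)" using E2' by (simp add: field_simps)
  qed (use q p nn in auto)
  then show ?thesis unfolding d_def D_def by (simp add: mult_ac)
qed

text \<open>The factor \<open>sqrt Y\<close> compensates the singularity of
  \<open>Y powr (q / 2 - 1)\<close> at 0 and leaves the exponent \<open>(q - 1) / 2\<close>. The
  mixed terms are bounded by non-negative powers of \<open>nt_D X Y\<close>, which is at most
  \<open>2 * R powr (p - 1)\<close> with \<open>R = 1 + X + Y\<close>.\<close>

lemma nt_growth:
  assumes pos: "X > 0" "Y > 0"
  shows "nt_x X Y * sqrt X \<le> (2 * p + 2) * (1 + X + Y) ^ (nat \<lceil>p\<rceil> + 1)"
    "nt_y X Y * sqrt Y \<le> (2 * p + 2) * (1 + X + Y) ^ (nat \<lceil>p\<rceil> + 1)"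
proof -
  define R where "R = 1 + X + Y"
  define N where "N = nat \<lceil>p\<rceil>"
  have R: "1 \<le> R" "X \<le> R" "Y \<le> R" using pos by (auto simp: R_def)
  have N: "p \<le> real N" unfolding N_def by linarith
  note q = q_bounds
  have RN: "R powr c \<le> R ^ N" if "c \<le> p" for c
    using powr_mono[of c "real N" R] that N R by (simp add: powr_realpow)
  define D where "D = nt_D X Y"
  have D: "D > 0" "X powr (p - 1) \<le> D" "Y \<le> D" "X \<le> D powr (q - 1)"
    unfolding D_def using nt_D_pos[OF pos] nt_D_bounds[OF pos] by auto
  have "X powr (p - 1) \<le> R powr (p - 1)" using R p pos by (intro powr_mono2) auto
  moreover have "Y \<le> R powr (p - 1)" using R p powr_mono[of 1 "p - 1" R] by simp
  ultimately have DR: "D \<le> 2 * R powr (p - 1)" unfolding D_def nt_D_def by simp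
  have R1: "1 \<le> 2 * R powr (p - 1)" using R p ge_one_powr_ge_zero[of R "p - 1"] by simp
  have Dc: "D powr c \<le> 2 * R ^ N" if "0 \<le> c" "c \<le> 1" for c
  proof -
    have "D powr c \<le> (2 * R powr (p - 1)) powr c" using D DR that by (intro powr_mono2) auto
    also have "\<dots> \<le> (2 * R powr (p - 1)) powr 1" using R1 that by (intro powr_mono) auto
    also have "\<dots> \<le> 2 * R ^ N" using RN[of "p - 1"] R1 by simp
    finally show ?thesis .
  qed
  have s: "sqrt X = X powr (1 / 2)" "sqrt Y = Y powr (1 / 2)" using pos by (simp_all add: powr_half_sqrt)
  have sR: "sqrt X \<le> R" using pos R by (intro real_le_lsqrt) (auto simp: power2_eq_square intro: order.trans[OF _ mult_mono[of 1 R R R]])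
  have RNN: "R ^ N \<le> R ^ (N + 1)" using R by (intro power_increasing) auto
  have RN0: "0 \<le> R ^ N" using R by simp
  have "X powr (p / 2 - 1) * sqrt X = X powr ((p - 1) / 2)"
    unfolding s by (simp add: powr_add[symmetric] algebra_simps diff_divide_distrib)
  also have "\<dots> \<le> R powr ((p - 1) / 2)" using R p pos by (intro powr_mono2) auto
  also have "\<dots> \<le> R ^ N" using p by (intro RN) simp
  finally have x1: "p / 2 * X powr (p / 2 - 1) * sqrt X \<le> p / 2 * R ^ (N + 1)"
    using p RNN by (simp only: mult.assoc, intro mult_left_mono) auto
  have "X powr (p - 1) * D powr (- (q / 2)) \<le> D powr 1 * D powr (- (q / 2))" using D by (intro mult_right_mono) auto
  also have "\<dots> = D powr (1 - q / 2)" unfolding powr_add[symmetric] by simp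
  finally have x2: "X powr (p - 1) * D powr (- (q / 2)) \<le> D powr (1 - q / 2)" .
  have "D powr (1 - q / 2) + (p - 2) / 2 * X powr (p - 1) * D powr (- (q / 2))
     \<le> D powr (1 - q / 2) + (p - 2) / 2 * D powr (1 - q / 2)"
    using mult_left_mono[OF x2, of "(p - 2) / 2"] p by simp
  also have "\<dots> = p / 2 * D powr (1 - q / 2)" by (simp add: field_simps)
  also have "\<dots> \<le> p / 2 * (2 * R ^ N)" using q p by (intro mult_left_mono Dc) auto
  finally have "(q - 1) / 8 * (D powr (1 - q / 2) + (p - 2) / 2 * X powr (p - 1) * D powr (- (q / 2))) * sqrt X
     \<le> 1 * (p / 2 * (2 * R ^ N)) * R"
    using q sR p pos R by (intro mult_mono) auto
  also have "\<dots> = p * R ^ (N + 1)" by simp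
  finally have "nt_x X Y * sqrt X \<le> p / 2 * R ^ (N + 1) + p * R ^ (N + 1)"
    using x1 unfolding nt_x_def D_def[symmetric] distrib_right[of _ _ "sqrt X"] by (intro add_mono)
  also have "\<dots> \<le> (2 * p + 2) * R ^ (N + 1)" using p R by (simp add: algebra_simps)
  finally show "nt_x X Y * sqrt X \<le> (2 * p + 2) * (1 + X + Y) ^ (nat \<lceil>p\<rceil> + 1)" unfolding R_def N_def .
  have "Y powr (q / 2 - 1) * sqrt Y = Y powr ((q - 1) / 2)"
    unfolding s by (simp add: powr_add[symmetric] algebra_simps diff_divide_distrib)
  also have "\<dots> \<le> R powr ((q - 1) / 2)" using R q pos by (intro powr_mono2) auto
  also have "\<dots> \<le> R ^ N" using p q by (intro RN) simp
  finally have "q / 2 * (Y powr (q / 2 - 1) * sqrt Y) \<le> 1 * R ^ N"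
    using q pos by (intro mult_mono) auto
  then have y1: "q / 2 * Y powr (q / 2 - 1) * sqrt Y \<le> R ^ N" by (simp add: mult_ac)
  have "X * sqrt Y * D powr (- (q / 2)) \<le> D powr (q - 1) * D powr (1 / 2) * D powr (- (q / 2))"
    unfolding s using D pos by (intro mult_right_mono mult_mono powr_mono2) auto
  also have "\<dots> = D powr (q / 2 - 1 / 2)"
    unfolding powr_add[symmetric] by (rule arg_cong[of _ _ "\<lambda>c. D powr c"]) (simp add: field_simps)
  also have "\<dots> \<le> 2 * R ^ N" using q by (intro Dc) auto
  finally have y2: "X * sqrt Y * D powr (- (q / 2)) \<le> 2 * R ^ N" .
  have "((q - 1) / 8 * (1 - q / 2)) * (X * sqrt Y * D powr (- (q / 2))) \<le> (1 * 1) * (2 * R ^ N)"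
    using q pos by (intro mult_mono y2) auto
  moreover have "nt_y X Y * sqrt Y = q / 2 * Y powr (q / 2 - 1) * sqrt Y +
      ((q - 1) / 8 * (1 - q / 2)) * (X * sqrt Y * D powr (- (q / 2)))"
    unfolding nt_y_def D_def[symmetric] by (simp only: distrib_right distrib_left mult_ac)
  ultimately have "nt_y X Y * sqrt Y \<le> 3 * R ^ N" using y1 by linarith
  also have "\<dots> \<le> (2 * p + 2) * R ^ (N + 1)" using p R RNN by (intro mult_mono) auto
  finally show "nt_y X Y * sqrt Y \<le> (2 * p + 2) * (1 + X + Y) ^ (nat \<lceil>p\<rceil> + 1)" unfolding R_def N_def .
qed

lemma nt_bellman:
  "bellman nt nt_x nt_y nt_xx nt_xy nt_yy (\<lambda>X Y. nt_D X Y powr (1 - q / 2) / 2) (5 / 24 * (q - 1))"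
proof unfold_locales
  fix \<Psi> assume \<Psi>: "\<Psi> \<in> {nt, nt_x, nt_y, nt_xx, nt_xy, nt_yy}"
  have D: "X > 0 \<Longrightarrow> Y > 0 \<Longrightarrow> nt_D X Y \<noteq> 0" for X Y
    using nt_D_pos by force
  have cD: "continuous_on ({0<..} \<times> {0<..}) (\<lambda>z. nt_D (fst z) (snd z))"
    unfolding nt_D_def by (intro continuous_intros) auto
  show "continuous_on ({0<..} \<times> {0<..}) (\<lambda>z. \<Psi> (fst z) (snd z))"
    using \<Psi> unfolding nt_def nt_x_def nt_y_def nt_xx_def nt_xy_def nt_yy_def insert_iff empty_iff
    by (elim disjE) (auto intro!: continuous_intros cD simp: D)
  show "(\<lambda>z. \<Psi> (fst z) (snd z)) \<in> borel_measurable (borel \<Otimes>\<^sub>M borel)"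
    using \<Psi> unfolding nt_def nt_x_def nt_y_def nt_xx_def nt_xy_def nt_yy_def nt_D_def insert_iff empty_iff
    by (elim disjE) simp_all
next
  fix X Y :: real assume X: "X > 0" "Y > 0"
  note D = nt_D_pos[OF X]
  show "0 \<le> nt X Y" unfolding nt_def using X q_bounds by auto
  show "0 < nt_D X Y powr (1 - q / 2) / 2" using D by simp
  have "0 \<le> p / 2 * X powr (p / 2 - 1)" "0 \<le> (p - 2) / 2 * X powr (p - 1) * nt_D X Y powr (- (q / 2))"
    using p by auto
  moreover have "(q - 1) / 8 * nt_D X Y powr (1 - q / 2) \<le> (q - 1) / 8 *
     (nt_D X Y powr (1 - q / 2) + (p - 2) / 2 * X powr (p - 1) * nt_D X Y powr (- (q / 2)))"
    using p q_bounds by (intro mult_left_mono) auto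
  moreover have "0 \<le> (q - 1) * nt_D X Y powr (1 - q / 2)" using q_bounds by simp
  ultimately have "(q - 1) / 8 * nt_D X Y powr (1 - q / 2) \<le> nt_x X Y"
    unfolding nt_x_def by (intro add_increasing)
  with \<open>0 \<le> (q - 1) * nt_D X Y powr (1 - q / 2)\<close>
  show "5 / 24 * (q - 1) * (nt_D X Y powr (1 - q / 2) / 2) \<le> 2 * nt_x X Y" by (simp add: field_simps)
  have "5 / 24 * (q - 1) / (nt_D X Y powr (1 - q / 2) / 2) = 5 / 12 * (q - 1) * (1 / nt_D X Y powr (1 - q / 2))"
    using D by (simp add: field_simps)
  also have "\<dots> = 5 / 12 * (q - 1) * nt_D X Y powr (q / 2 - 1)" by (simp add: powr_minus_divide[symmetric])
  also have "\<dots> \<le> q * Y powr (q / 2 - 1)"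
    using q_bounds X nt_D_bounds[OF X] by (intro mult_mono powr_mono2') auto
  also have "\<dots> \<le> 2 * nt_y X Y" unfolding nt_y_def using q_bounds X by simp
  finally show "5 / 24 * (q - 1) / (nt_D X Y powr (1 - q / 2) / 2) \<le> 2 * nt_y X Y" .
  fix a b
  show "5 / 24 * (q - 1) * (nt_D X Y powr (1 - q / 2) / 2) * a\<^sup>2
      + 5 / 24 * (q - 1) / (nt_D X Y powr (1 - q / 2) / 2) * b\<^sup>2 \<le>
      (2 * nt_x X Y + 4 * X * nt_xx X Y) * a\<^sup>2 + 8 * (sqrt X * sqrt Y * nt_xy X Y) * (a * b)
        + (2 * nt_y X Y + 4 * Y * nt_yy X Y) * b\<^sup>2" by (rule nt_hessian[OF X])
next
  show "0 \<le> 5 / 24 * (q - 1)" using q_bounds by simp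
  show "\<exists>C N. \<forall>X>0. \<forall>Y>0. nt_x X Y * sqrt X \<le> C * (1 + X + Y) ^ N \<and> nt_y X Y * sqrt Y \<le> C * (1 + X + Y) ^ N"
    using nt_growth by blast
next
  fix X Y :: "real \<Rightarrow> real" and X' Y' t A
  assume "(X has_real_derivative X') (at t within A)" "(Y has_real_derivative Y') (at t within A)" "0 < X t" "0 < Y t"
  note ch = nt_chain[OF this]
  show "((\<lambda>t. nt (X t) (Y t)) has_real_derivative nt_x (X t) (Y t) * X' + nt_y (X t) (Y t) * Y') (at t within A)"
    and "((\<lambda>t. nt_x (X t) (Y t)) has_real_derivative nt_xx (X t) (Y t) * X' + nt_xy (X t) (Y t) * Y') (at t within A)"
    and "((\<lambda>t. nt_y (X t) (Y t)) has_real_derivative nt_xy (X t) (Y t) * X' + nt_yy (X t) (Y t) * Y') (at t within A)"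
    by (fact ch)+
qed

text \<open>With \<open>M\<close> the larger of the two powers, homogeneity gives
  \<open>X \<le> M powr (2 / p)\<close> and \<open>nt_D X Y \<le> 2 * M powr (2 / q)\<close>. Hence
  the mixed product is at most \<open>2 * M\<close>, and \<open>(q - 1) / 8 \<le> 1 / 8\<close>
  leaves the extra quarter in \<open>5 / 4\<close>.\<close>

lemma nt_upper:
  assumes pos: "X > 0" "Y > 0"
  shows "nt X Y \<le> 5 / 4 * (X powr (p / 2) + Y powr (q / 2))"
proof -
  define M where "M = max (X powr (p / 2)) (Y powr (q / 2))"
  have M: "M > 0" "X powr (p / 2) \<le> M" "Y powr (q / 2) \<le> M" "M \<le> X powr (p / 2) + Y powr (q / 2)"
    using pos by (auto simp: M_def less_max_iff_disj)
  note q = q_bounds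
  have pq: "2 / p * (p - 1) = 2 / q" using q(4) p q(1) by (simp add: field_simps)
  have "X = (X powr (p / 2)) powr (2 / p)" using pos p by (simp add: powr_powr)
  also have "\<dots> \<le> M powr (2 / p)" using M p by (intro powr_mono2) auto
  finally have X: "X \<le> M powr (2 / p)" .
  have "X powr (p - 1) \<le> (M powr (2 / p)) powr (p - 1)" using X pos p by (intro powr_mono2) auto
  also have "\<dots> = M powr (2 / q)" unfolding powr_powr pq ..
  finally have X': "X powr (p - 1) \<le> M powr (2 / q)" .
  have "Y = (Y powr (q / 2)) powr (2 / q)" using pos q by (simp add: powr_powr)
  also have "\<dots> \<le> M powr (2 / q)" using M q by (intro powr_mono2) auto
  finally have "nt_D X Y \<le> 2 * M powr (2 / q)" using X' unfolding nt_D_def by simp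
  then have "nt_D X Y powr (1 - q / 2) \<le> (2 * M powr (2 / q)) powr (1 - q / 2)"
    using q nt_D_pos[OF pos] by (intro powr_mono2) auto
  also have "\<dots> = 2 powr (1 - q / 2) * M powr (2 / q - 1)"
    using q unfolding powr_mult powr_powr by (simp add: right_diff_distrib)
  also have "\<dots> \<le> 2 powr 1 * M powr (2 / q - 1)" using q by (intro mult_right_mono powr_mono) auto
  finally have "X * nt_D X Y powr (1 - q / 2) \<le> M powr (2 / p) * (2 powr 1 * M powr (2 / q - 1))"
    using X pos by (intro mult_mono) auto
  also have "\<dots> = 2 * M powr (2 / p + (2 / q - 1))" unfolding powr_add by simp
  also have "2 / p + (2 / q - 1) = 1" using q(4) p q(1) by (simp add: field_simps)
  finally have "X * nt_D X Y powr (1 - q / 2) \<le> 2 * M" using M by simp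
  then have "(q - 1) / 8 * (X * nt_D X Y powr (1 - q / 2)) \<le> (q - 1) / 8 * (2 * M)"
    using q by (intro mult_left_mono) auto
  also have "\<dots> \<le> 1 / 8 * (2 * M)" using q M by (intro mult_right_mono) auto
  finally have "(q - 1) / 8 * (X * nt_D X Y powr (1 - q / 2)) \<le> M / 4" by simp
  then show ?thesis unfolding nt_def using M by simp
qed

end

subsection \<open>Fluxes and energies near an endpoint\<close>

text \<open>Compare with the maximum \<open>m\<close> of 1 and all \<open>f k\<close>: the base is
  at most \<open>1 + card K\<close> times \<open>m\<close>, and \<open>m ^ n\<close> is one of the
  terms on the right.\<close>

lemma power_one_plus_sum_le:
  fixes f :: "'k \<Rightarrow> real"
  assumes "finite K" "\<And>k. k \<in> K \<Longrightarrow> 0 \<le> f k"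
  shows "(1 + sum f K) ^ n \<le> (1 + real (card K)) ^ n * (1 + (\<Sum>k\<in>K. f k ^ n))"
proof -
  have "\<exists>m\<ge>1. (\<forall>k\<in>K. f k \<le> m) \<and> m ^ n \<le> 1 + (\<Sum>k\<in>K. f k ^ n)"
    using assms
  proof (induction rule: finite_induct)
    case empty
    then show ?case by (intro exI[of _ 1]) auto
  next
    case (insert k K)
    then obtain m where m: "m \<ge> 1" "\<forall>k\<in>K. f k \<le> m" "m ^ n \<le> 1 + (\<Sum>k\<in>K. f k ^ n)" by auto
    have nn: "0 \<le> (\<Sum>k\<in>K. f k ^ n)" "0 \<le> f k ^ n" using insert.prems by (auto intro!: sum_nonneg)
    show ?case
    proof (cases "f k \<le> m")
      case True
      then show ?thesis using m nn insert.hyps by (intro exI[of _ m]) auto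
    next
      case False
      then show ?thesis using m nn insert.hyps by (intro exI[of _ "f k"]) (auto intro: less_imp_le)
    qed
  qed
  then obtain m where m: "m \<ge> 1" "\<forall>k\<in>K. f k \<le> m" "m ^ n \<le> 1 + (\<Sum>k\<in>K. f k ^ n)" by blast
  have "1 + sum f K \<le> m + (\<Sum>k\<in>K. m)" using m by (intro add_mono sum_mono) auto
  also have "\<dots> = (1 + real (card K)) * m" by (simp add: algebra_simps)
  finally have "(1 + sum f K) ^ n \<le> ((1 + real (card K)) * m) ^ n"
    using assms by (intro power_mono add_nonneg_nonneg sum_nonneg) auto
  also have "\<dots> \<le> (1 + real (card K)) ^ n * (1 + (\<Sum>k\<in>K. f k ^ n))"
    unfolding power_mult_distrib using m by (intro mult_left_mono) auto
  finally show ?thesis .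
qed

lemma is_interval_Icc_subset:
  fixes I :: "real set"
  assumes "is_interval I" "x \<in> I" "y \<in> I"
  shows "{x..y} \<subseteq> I"
proof
  fix s assume "s \<in> {x..y}"
  then show "s \<in> I" using mem_is_interval_1_I[OF assms, of s] by simp
qed

text \<open>The limit 0 at the right end, phrased through points of \<open>I\<close> so that finite
  and infinite end points are treated alike.\<close>

definition vanishes_right :: "real set \<Rightarrow> (real \<Rightarrow> real) \<Rightarrow> bool" where
  "vanishes_right I h \<longleftrightarrow> (\<forall>e>0. \<exists>c\<in>I. \<forall>s\<in>I. c < s \<longrightarrow> \<bar>h s\<bar> < e)"

lemma vanishes_right_all:
  assumes "finite K" "\<And>k. k \<in> K \<Longrightarrow> vanishes_right I (h k)" "I \<noteq> {}" "(e::real) > 0"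
  shows "\<exists>c\<in>I. \<forall>s\<in>I. c < s \<longrightarrow> (\<forall>k\<in>K. \<bar>h k s\<bar> < e)"
  using assms(1,2)
proof (induction rule: finite_induct)
  case empty
  then show ?case using assms by auto
next
  case (insert k K)
  then obtain c where c: "c \<in> I" "\<forall>s\<in>I. c < s \<longrightarrow> (\<forall>k\<in>K. \<bar>h k s\<bar> < e)" by auto
  obtain c' where c': "c' \<in> I" "\<forall>s\<in>I. c' < s \<longrightarrow> \<bar>h k s\<bar> < e"
    using insert.prems[of k] assms(4) unfolding vanishes_right_def by auto
  then show ?case using c by (intro bexI[of _ "max c c'"]) (auto simp: max_def)
qed

text \<open>The decay hypotheses only control each \<open>\<theta> k\<close> by itself; mixed products such as
  \<open>P * \<theta> j ^ N * d\<theta> k\<close> need not tend to zero. But they cannot stay away from zero: otherwise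
  \<open>1 / (P * W)\<close>, with \<open>W = 1 + (\<Sum>k. \<theta> k ^ (2 * M))\<close>, is dominated by the integrable
  energy density, so \<open>ln W\<close> and hence all \<open>\<theta> k\<close> are bounded.\<close>

lemma flux_liminf_right:
  fixes P :: "real \<Rightarrow> real" and \<theta> d\<theta> :: "'k \<Rightarrow> real \<Rightarrow> real"
  assumes I: "open I" "is_interval I" "I \<noteq> {}" and K: "finite K"
    and P_pos: "\<And>s. s \<in> I \<Longrightarrow> P s > 0" and P_cont: "continuous_on I P"
    and deriv: "\<And>k s. k \<in> K \<Longrightarrow> s \<in> I \<Longrightarrow> (\<theta> k has_real_derivative d\<theta> k s) (at s)"
    and d_cont: "\<And>k. k \<in> K \<Longrightarrow> continuous_on I (d\<theta> k)"
    and energy: "\<And>k. k \<in> K \<Longrightarrow> \<exists>C. \<forall>x\<in>I. \<forall>y\<in>I. x \<le> y \<longrightarrow> integral {x..y} (\<lambda>s. P s * (d\<theta> k s)\<^sup>2) \<le> C"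
    and decay: "\<And>k m. k \<in> K \<Longrightarrow> vanishes_right I (\<lambda>s. P s * (1 + \<bar>\<theta> k s\<bar> ^ m) * d\<theta> k s)"
    and e: "e > 0" and c: "c \<in> I"
  shows "\<exists>s\<in>I. s > c \<and> P s * (\<Sum>k\<in>K. \<bar>d\<theta> k s\<bar>) * (1 + (\<Sum>k\<in>K. \<bar>\<theta> k s\<bar>)) ^ N < e"
proof (rule ccontr)
  assume contr: "\<not> ?thesis"
  \<comment> \<open>\<open>2 * M\<close> exceeds \<open>2 * N\<close>, so \<open>W\<close> dominates
    the square of the polynomial weight; it is at least 2 even for \<open>N = 0\<close>, so that
    \<open>W\<close> still bounds each \<open>\<theta> k\<close>. An even exponent keeps
    \<open>W\<close> smooth and at least 1.\<close>
  define M where "M = Suc N"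
  define W where "W s = 1 + (\<Sum>k\<in>K. \<theta> k s ^ (2 * M))" for s
  define dW where "dW s = (\<Sum>k\<in>K. real (2 * M) * \<theta> k s ^ (2 * M - 1) * d\<theta> k s)" for s
  define S where "S s = (\<Sum>k\<in>K. (d\<theta> k s)\<^sup>2)" for s
  define n where "n = real (card K)"
  have lower: "e \<le> P s * (\<Sum>k\<in>K. \<bar>d\<theta> k s\<bar>) * (1 + (\<Sum>k\<in>K. \<bar>\<theta> k s\<bar>)) ^ N" if "s \<in> I" "s > c" for s
    using contr that by force
  have K_ne: "K \<noteq> {}"
  proof
    assume "K = {}"
    obtain d where d: "d > 0" "cball c d \<subseteq> I" using I(1) c open_contains_cball by blast
    then have "c + d \<in> I" by (auto simp: dist_real_def)
    from lower[OF this] d \<open>K = {}\<close> e show False by simp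
  qed
  then have n: "n \<ge> 1" unfolding n_def using K by (simp add: Suc_le_eq card_gt_0_iff)
  have even: "0 \<le> \<theta> k s ^ (2 * M)" for k s by (simp add: power_mult)
  have W1: "W s \<ge> 1" for s unfolding W_def using even by (simp add: sum_nonneg)
  have W_deriv: "(W has_real_derivative dW s) (at s)" if "s \<in> I" for s
    unfolding W_def dW_def using that
    by (auto intro!: derivative_eq_intros deriv sum.cong simp: mult_ac)
  \<comment> \<open>\<open>2 * M - 1\<close> is the power of \<open>\<theta> k\<close> occurring in
    \<open>dW\<close>, so the decay of each function by itself already bounds
    \<open>P * \<bar>dW\<bar>\<close>.\<close>
  have "\<exists>c1\<in>I. \<forall>s\<in>I. c1 < s \<longrightarrow> (\<forall>k\<in>K. \<bar>P s * (1 + \<bar>\<theta> k s\<bar> ^ (2 * M - 1)) * d\<theta> k s\<bar> < 1)"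
    by (intro vanishes_right_all K I decay) auto
  then obtain c1 where c1: "c1 \<in> I"
    "\<And>s k. s \<in> I \<Longrightarrow> c1 < s \<Longrightarrow> k \<in> K \<Longrightarrow> \<bar>P s * (1 + \<bar>\<theta> k s\<bar> ^ (2 * M - 1)) * d\<theta> k s\<bar> < 1" by blast
  define C1 where "C1 = n * real (2 * M)"
  have PdW: "P s * \<bar>dW s\<bar> \<le> C1" if "s \<in> I" "s > c1" for s
  proof -
    have "P s * \<bar>dW s\<bar> \<le> P s * (\<Sum>k\<in>K. \<bar>real (2 * M) * \<theta> k s ^ (2 * M - 1) * d\<theta> k s\<bar>)"
      unfolding dW_def using P_pos[OF that(1)] by (intro mult_left_mono sum_abs) auto
    also have "\<dots> = (\<Sum>k\<in>K. real (2 * M) * (P s * \<bar>\<theta> k s\<bar> ^ (2 * M - 1) * \<bar>d\<theta> k s\<bar>))"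
      by (simp add: sum_distrib_left abs_mult power_abs mult_ac)
    also have "\<dots> \<le> (\<Sum>k\<in>K. real (2 * M) * 1)"
    proof (intro sum_mono mult_left_mono)
      fix k assume k: "k \<in> K"
      have "P s * \<bar>\<theta> k s\<bar> ^ (2 * M - 1) * \<bar>d\<theta> k s\<bar> \<le> P s * (1 + \<bar>\<theta> k s\<bar> ^ (2 * M - 1)) * \<bar>d\<theta> k s\<bar>"
        using P_pos[OF that(1)] by (intro mult_right_mono mult_left_mono) auto
      also have "\<dots> = \<bar>P s * (1 + \<bar>\<theta> k s\<bar> ^ (2 * M - 1)) * d\<theta> k s\<bar>"
        using P_pos[OF that(1)] by (simp add: abs_mult)
      finally show "P s * \<bar>\<theta> k s\<bar> ^ (2 * M - 1) * \<bar>d\<theta> k s\<bar> \<le> 1" using c1(2)[OF that k] by simp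
    qed auto
    finally show ?thesis by (simp add: C1_def n_def)
  qed
  define C0 where "C0 = (1 + n) ^ (2 * N) * (2 + n)"
  have C0: "C0 > 0" using n by (simp add: C0_def)
  have ZW: "((1 + (\<Sum>k\<in>K. \<bar>\<theta> k s\<bar>)) ^ N)\<^sup>2 \<le> C0 * W s" for s
  proof -
    have "((1 + (\<Sum>k\<in>K. \<bar>\<theta> k s\<bar>)) ^ N)\<^sup>2 = (1 + (\<Sum>k\<in>K. \<bar>\<theta> k s\<bar>)) ^ (2 * N)"
      by (simp add: power_mult[symmetric] mult.commute)
    also have "\<dots> \<le> (1 + n) ^ (2 * N) * (1 + (\<Sum>k\<in>K. \<bar>\<theta> k s\<bar> ^ (2 * N)))"
      unfolding n_def by (intro power_one_plus_sum_le K) auto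
    also have "(\<Sum>k\<in>K. \<bar>\<theta> k s\<bar> ^ (2 * N)) \<le> (\<Sum>k\<in>K. 1 + \<theta> k s ^ (2 * M))"
    proof (intro sum_mono)
      fix k
      have "\<bar>\<theta> k s\<bar> ^ (2 * N) \<le> 1 + \<bar>\<theta> k s\<bar> ^ (2 * M)"
      proof (cases "\<bar>\<theta> k s\<bar> \<le> 1")
        case True
        then have "\<bar>\<theta> k s\<bar> ^ (2 * N) \<le> 1" by (intro power_le_one) auto
        then show ?thesis by (simp add: add_increasing2)
      next
        case False
        then have "\<bar>\<theta> k s\<bar> ^ (2 * N) \<le> \<bar>\<theta> k s\<bar> ^ (2 * M)" unfolding M_def by (intro power_increasing) auto
        then show ?thesis by simp
      qed
      then show "\<bar>\<theta> k s\<bar> ^ (2 * N) \<le> 1 + \<theta> k s ^ (2 * M)" by (simp add: power_even_abs)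
    qed
    also have "1 + (\<Sum>k\<in>K. 1 + \<theta> k s ^ (2 * M)) = n + W s" by (simp add: sum.distrib n_def W_def)
    also have "n + W s \<le> (2 + n) * W s"
    proof -
      have "n * 1 \<le> n * W s" using n W1[of s] by (intro mult_left_mono) auto
      then show ?thesis using W1[of s] by (simp add: algebra_simps)
    qed
    finally show ?thesis using n by (simp add: C0_def mult.assoc)
  qed
  define C4 where "C4 = C1 * (n * C0) / e\<^sup>2"
  have C1: "C1 \<ge> 0" and C4: "C4 \<ge> 0" using n C0 by (auto simp: C1_def C4_def)
  have S0: "S s \<ge> 0" for s unfolding S_def by (intro sum_nonneg) auto
  \<comment> \<open>By Cauchy-Schwarz the contradiction hypothesis reads
    \<open>e\<^sup>2 \<le> n * C0 * P\<^sup>2 * S * W\<close>. Multiplied by the bound on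
    \<open>P * \<bar>dW\<bar>\<close>, it loses one factor \<open>P\<close> and bounds the
    logarithmic derivative of \<open>W\<close> by the energy density.\<close>
  have key: "\<bar>dW s\<bar> / W s \<le> C4 * (P s * S s)" if "s \<in> I" "s > max c c1" for s
  proof -
    have s: "s > c" "s > c1" using that by auto
    note Ps = P_pos[OF that(1)]
    have "e\<^sup>2 \<le> (P s * (\<Sum>k\<in>K. \<bar>d\<theta> k s\<bar>) * (1 + (\<Sum>k\<in>K. \<bar>\<theta> k s\<bar>)) ^ N)\<^sup>2"
      using lower[OF that(1) s(1)] e by (intro power_mono) auto
    also have "\<dots> = (P s)\<^sup>2 * (\<Sum>k\<in>K. \<bar>d\<theta> k s\<bar>)\<^sup>2 * ((1 + (\<Sum>k\<in>K. \<bar>\<theta> k s\<bar>)) ^ N)\<^sup>2"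
      by (simp add: power_mult_distrib)
    also have "\<dots> \<le> (P s)\<^sup>2 * (n * S s) * (C0 * W s)"
    proof (intro mult_mono mult_left_mono ZW)
      show "(\<Sum>k\<in>K. \<bar>d\<theta> k s\<bar>)\<^sup>2 \<le> n * S s"
        using sum_squared_le_sum_of_squares[of "\<lambda>k. \<bar>d\<theta> k s\<bar>" K] K by (simp add: n_def S_def mult.commute)
    qed (use n S0 in auto)
    finally have "e\<^sup>2 \<le> P s * (P s * S s) * (n * C0) * W s" by (simp add: power2_eq_square mult_ac)
    then have "P s * \<bar>dW s\<bar> * e\<^sup>2 \<le> C1 * (P s * (P s * S s) * (n * C0) * W s)"
      using PdW[OF that(1) s(2)] C1 by (intro mult_mono) auto
    then have "P s * (\<bar>dW s\<bar> * e\<^sup>2) \<le> P s * (C1 * (n * C0) * (P s * S s) * W s)" by (simp add: mult_ac)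
    then have "\<bar>dW s\<bar> * e\<^sup>2 \<le> C1 * (n * C0) * (P s * S s) * W s" using Ps by simp
    then show ?thesis using e W1[of s] by (simp add: C4_def field_simps)
  qed
  have "\<exists>C. \<forall>k\<in>K. \<forall>x\<in>I. \<forall>y\<in>I. x \<le> y \<longrightarrow> integral {x..y} (\<lambda>s. P s * (d\<theta> k s)\<^sup>2) \<le> C"
  proof -
    have "\<exists>C. \<forall>k\<in>K. \<forall>x\<in>I. \<forall>y\<in>I. x \<le> y \<longrightarrow> integral {x..y} (\<lambda>s. P s * (d\<theta> k s)\<^sup>2) \<le> C k"
      by (intro bchoice ballI energy)
    then obtain C where C: "\<forall>k\<in>K. \<forall>x\<in>I. \<forall>y\<in>I. x \<le> y \<longrightarrow> integral {x..y} (\<lambda>s. P s * (d\<theta> k s)\<^sup>2) \<le> C k" ..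
    have "C k \<le> Max (C ` K)" if "k \<in> K" for k using K that by simp
    with C show ?thesis by (meson order.trans)
  qed
  then obtain C2 where C2: "\<And>k x y. k \<in> K \<Longrightarrow> x \<in> I \<Longrightarrow> y \<in> I \<Longrightarrow> x \<le> y \<Longrightarrow> integral {x..y} (\<lambda>s. P s * (d\<theta> k s)\<^sup>2) \<le> C2"
    by blast
  define x1 where "x1 = max c c1"
  have x1I: "x1 \<in> I" using c c1 by (auto simp: x1_def max_def)
  have sub: "{x1..y} \<subseteq> I" if "y \<in> I" for y
    by (rule is_interval_Icc_subset[OF I(2) x1I that])
  have PScont: "continuous_on I (\<lambda>s. P s * S s)" unfolding S_def by (intro continuous_intros P_cont d_cont)
  have intPS: "integral {x1..y} (\<lambda>s. P s * S s) \<le> n * C2" if y: "y \<in> I" "x1 \<le> y" for y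
  proof -
    have "integral {x1..y} (\<lambda>s. P s * S s) = (\<Sum>k\<in>K. integral {x1..y} (\<lambda>s. P s * (d\<theta> k s)\<^sup>2))"
      unfolding S_def sum_distrib_left
      by (intro integral_sum K integrable_continuous_real continuous_intros
          continuous_on_subset[OF P_cont] continuous_on_subset[OF d_cont] sub y)
    also have "\<dots> \<le> (\<Sum>k\<in>K. C2)" using y x1I by (intro sum_mono C2) auto
    finally show ?thesis by (simp add: n_def)
  qed
  have lnW: "ln (W y) \<le> ln (W x1) + C4 * (n * C2)" if y: "y \<in> I" "x1 \<le> y" for y
  proof -
    \<comment> \<open>Non-increasing by \<open>key\<close>; comparing its values at the ends bounds
      \<open>ln W\<close> through the total energy.\<close>
    let ?g = "\<lambda>s. ln (W s) - C4 * integral {x1..s} (\<lambda>s. P s * S s)"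
    have "?g y \<le> ?g x1"
    proof (rule DERIV_nonpos_imp_decreasing_open[OF y(2)])
      fix s assume s: "x1 < s" "s < y"
      have sI: "s \<in> I" using sub[OF y(1)] s by auto
      have "((\<lambda>u. integral {x1..u} (\<lambda>s. P s * S s)) has_real_derivative P s * S s) (at s within {x1..y})"
        by (intro integral_has_real_derivative continuous_on_subset[OF PScont] sub y) (use s in auto)
      then have 1: "((\<lambda>u. integral {x1..u} (\<lambda>s. P s * S s)) has_real_derivative P s * S s) (at s)"
        using s by (simp add: at_within_Icc_at)
      have "(?g has_real_derivative (dW s / W s - C4 * (P s * S s))) (at s)"
        using W1[of s] by (auto intro!: derivative_eq_intros 1 W_deriv sI simp: field_simps)
      moreover have "dW s / W s \<le> \<bar>dW s\<bar> / W s" using W1[of s] by (intro divide_right_mono) auto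
      then have "dW s / W s - C4 * (P s * S s) \<le> 0" using key[OF sI] s by (simp add: x1_def)
      ultimately show "\<exists>d. (?g has_real_derivative d) (at s) \<and> d \<le> 0" by blast
    next
      show "continuous_on {x1..y} ?g"
      proof (intro continuous_intros indefinite_integral_continuous_1
            integrable_continuous_real[OF continuous_on_subset[OF PScont sub[OF y(1)]]])
        show "continuous_on {x1..y} W"
        proof (rule DERIV_atLeastAtMost_imp_continuous_on)
          fix s assume "x1 \<le> s" "s \<le> y"
          then have "s \<in> I" using sub[OF y(1)] by auto
          then show "\<exists>d. (W has_real_derivative d) (at s)" using W_deriv by blast
        qed
        show "\<forall>s\<in>{x1..y}. W s \<noteq> 0" using W1 by (metis not_one_le_zero)
      qed
    qed
    then have "ln (W y) \<le> ln (W x1) + C4 * integral {x1..y} (\<lambda>s. P s * S s)" by simp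
    also have "\<dots> \<le> ln (W x1) + C4 * (n * C2)" using intPS[OF y] C4 by (intro add_left_mono mult_left_mono) auto
    finally show ?thesis .
  qed
  define B where "B = exp (ln (W x1) + C4 * (n * C2))"
  have WB: "W y \<le> B" if "y \<in> I" "x1 \<le> y" for y
  proof -
    have "exp (ln (W y)) \<le> B" unfolding B_def using lnW[OF that] by simp
    then show ?thesis using W1[of y] by simp
  qed
  have ZB: "(1 + (\<Sum>k\<in>K. \<bar>\<theta> k y\<bar>)) ^ N \<le> (1 + n * B) ^ N" if y: "y \<in> I" "x1 \<le> y" for y
  proof (intro power_mono add_left_mono)
    have "\<bar>\<theta> k y\<bar> \<le> B" if k: "k \<in> K" for k
    proof -
      have "\<bar>\<theta> k y\<bar> \<le> 1 + \<theta> k y ^ (2 * M)"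
      proof (cases "\<bar>\<theta> k y\<bar> \<le> 1")
        case True
        then show ?thesis using even[of k y] by linarith
      next
        case False
        then have "\<bar>\<theta> k y\<bar> ^ 1 \<le> \<bar>\<theta> k y\<bar> ^ (2 * M)" unfolding M_def by (intro power_increasing) auto
        then show ?thesis by (simp add: power_even_abs)
      qed
      also have "\<dots> \<le> W y" unfolding W_def
        using member_le_sum[of k K "\<lambda>k. \<theta> k y ^ (2 * M)"] k K even by simp
      also have "\<dots> \<le> B" by (rule WB[OF y])
      finally show ?thesis .
    qed
    then have "(\<Sum>k\<in>K. \<bar>\<theta> k y\<bar>) \<le> (\<Sum>k\<in>K. B)" by (intro sum_mono) auto
    then show "(\<Sum>k\<in>K. \<bar>\<theta> k y\<bar>) \<le> n * B" by (simp add: n_def)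
  qed (auto intro!: add_nonneg_nonneg sum_nonneg)
  have B: "B > 0" by (simp add: B_def)
  \<comment> \<open>Once the weight is bounded by \<open>(1 + n * B) ^ N\<close>, decay of each bare
    \<open>P * d\<theta> k\<close> below this \<open>e'\<close> brings the product down to
    \<open>e / 2\<close>, against \<open>lower\<close>.\<close>
  define e' where "e' = e / (2 * n * (1 + n * B) ^ N)"
  have q: "(1 + n * B) ^ N > 0" using B n by (intro zero_less_power) (auto intro: add_pos_nonneg)
  have e': "e' > 0" using e n q by (simp add: e'_def)
  have "\<exists>c2\<in>I. \<forall>s\<in>I. c2 < s \<longrightarrow> (\<forall>k\<in>K. \<bar>P s * (1 + \<bar>\<theta> k s\<bar> ^ 0) * d\<theta> k s\<bar> < e')"
    by (intro vanishes_right_all K I decay e')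
  then obtain c2 where c2: "c2 \<in> I" "\<And>s k. s \<in> I \<Longrightarrow> c2 < s \<Longrightarrow> k \<in> K \<Longrightarrow> \<bar>P s * (1 + \<bar>\<theta> k s\<bar> ^ 0) * d\<theta> k s\<bar> < e'"
    by blast
  define x2 where "x2 = max x1 c2"
  have "x2 \<in> I" using c2 x1I by (auto simp: x2_def max_def)
  then obtain d where d: "d > 0" "cball x2 d \<subseteq> I" using I(1) open_contains_cball by blast
  define s where "s = x2 + d"
  have s: "s \<in> I" "s > x2" using d by (auto simp: s_def dist_real_def)
  note Ps = P_pos[OF s(1)]
  have "e \<le> P s * (\<Sum>k\<in>K. \<bar>d\<theta> k s\<bar>) * (1 + (\<Sum>k\<in>K. \<bar>\<theta> k s\<bar>)) ^ N"
    using s by (intro lower) (auto simp: x2_def x1_def)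
  also have "\<dots> \<le> P s * (\<Sum>k\<in>K. \<bar>d\<theta> k s\<bar>) * (1 + n * B) ^ N"
    using Ps s by (intro mult_left_mono ZB mult_nonneg_nonneg sum_nonneg) (auto simp: x2_def)
  also have "P s * (\<Sum>k\<in>K. \<bar>d\<theta> k s\<bar>) \<le> (\<Sum>k\<in>K. e')"
  proof -
    have "P s * (\<Sum>k\<in>K. \<bar>d\<theta> k s\<bar>) = (\<Sum>k\<in>K. P s * \<bar>d\<theta> k s\<bar>)" by (simp add: sum_distrib_left)
    also have "\<dots> \<le> (\<Sum>k\<in>K. e')"
    proof (intro sum_mono)
      fix k assume k: "k \<in> K"
      have "P s * \<bar>d\<theta> k s\<bar> \<le> \<bar>P s * (1 + \<bar>\<theta> k s\<bar> ^ 0) * d\<theta> k s\<bar>" using Ps by (simp add: abs_mult)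
      then show "P s * \<bar>d\<theta> k s\<bar> \<le> e'" using c2(2)[OF s(1) _ k] s by (simp add: x2_def)
    qed
    finally show ?thesis .
  qed
  also have "(\<Sum>k\<in>K. e') * (1 + n * B) ^ N = e / 2" using q n less_imp_neq[OF q] by (simp add: e'_def n_def[symmetric] field_simps)
  finally show False using e q by simp
qed


definition vanishes_left :: "real set \<Rightarrow> (real \<Rightarrow> real) \<Rightarrow> bool" where
  "vanishes_left I h \<longleftrightarrow> (\<forall>e>0. \<exists>c\<in>I. \<forall>s\<in>I. s < c \<longrightarrow> \<bar>h s\<bar> < e)"

lemma vanishes_right_reflect: "vanishes_right (uminus ` I) h \<longleftrightarrow> vanishes_left I (\<lambda>s. h (- s))"
proof -
  have "(\<forall>s\<in>uminus ` I. - c < s \<longrightarrow> \<bar>h s\<bar> < e) \<longleftrightarrow> (\<forall>s\<in>I. s < c \<longrightarrow> \<bar>h (- s)\<bar> < e)" for c e by auto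
  then show ?thesis unfolding vanishes_right_def vanishes_left_def by simp
qed

text \<open>Reflection at the origin. The sign of \<open>d\<theta>\<close> changes, but only its
  absolute value and its square matter.\<close>

lemma flux_liminf_left:
  fixes P :: "real \<Rightarrow> real" and \<theta> d\<theta> :: "'k \<Rightarrow> real \<Rightarrow> real"
  assumes I: "open I" "is_interval I" "I \<noteq> {}" and K: "finite K"
    and P_pos: "\<And>s. s \<in> I \<Longrightarrow> P s > 0" and P_cont: "continuous_on I P"
    and deriv: "\<And>k s. k \<in> K \<Longrightarrow> s \<in> I \<Longrightarrow> (\<theta> k has_real_derivative d\<theta> k s) (at s)"
    and d_cont: "\<And>k. k \<in> K \<Longrightarrow> continuous_on I (d\<theta> k)"
    and energy: "\<And>k. k \<in> K \<Longrightarrow> \<exists>C. \<forall>x\<in>I. \<forall>y\<in>I. x \<le> y \<longrightarrow> integral {x..y} (\<lambda>s. P s * (d\<theta> k s)\<^sup>2) \<le> C"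
    and decay: "\<And>k m. k \<in> K \<Longrightarrow> vanishes_left I (\<lambda>s. P s * (1 + \<bar>\<theta> k s\<bar> ^ m) * d\<theta> k s)"
    and e: "e > 0" and c: "c \<in> I"
  shows "\<exists>s\<in>I. s < c \<and> P s * (\<Sum>k\<in>K. \<bar>d\<theta> k s\<bar>) * (1 + (\<Sum>k\<in>K. \<bar>\<theta> k s\<bar>)) ^ N < e"
proof -
  let ?J = "uminus ` I"
  have "\<exists>s\<in>?J. s > - c \<and> P (- s) * (\<Sum>k\<in>K. \<bar>- d\<theta> k (- s)\<bar>) * (1 + (\<Sum>k\<in>K. \<bar>\<theta> k (- s)\<bar>)) ^ N < e"
  proof (rule flux_liminf_right[where I = ?J and P = "\<lambda>s. P (- s)" and
        \<theta> = "\<lambda>k s. \<theta> k (- s)" and d\<theta> = "\<lambda>k s. - d\<theta> k (- s)"])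
    show "open ?J" using I(1) by (rule open_negations)
    show "is_interval ?J" using I(2) by simp
    show "continuous_on ?J (\<lambda>s. P (- s))"
      by (rule continuous_on_compose2[OF P_cont]) (auto intro!: continuous_intros)
    show "continuous_on ?J (\<lambda>s. - d\<theta> k (- s))" if "k \<in> K" for k
      by (intro continuous_intros continuous_on_compose2[OF d_cont[OF that]]) auto
    show "((\<lambda>s. \<theta> k (- s)) has_real_derivative - d\<theta> k (- s)) (at s)" if "k \<in> K" "s \<in> ?J" for k s
    proof -
      have "(\<theta> k has_real_derivative d\<theta> k (- s)) (at (- s))" using that by (intro deriv) auto
      then show ?thesis using DERIV_mirror[of "\<theta> k" "d\<theta> k (- s)" s] by simp
    qed
    show "\<exists>C. \<forall>x\<in>?J. \<forall>y\<in>?J. x \<le> y \<longrightarrow> integral {x..y} (\<lambda>s. P (- s) * (- d\<theta> k (- s))\<^sup>2) \<le> C" if k: "k \<in> K" for k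
    proof -
      obtain C where C: "\<forall>x\<in>I. \<forall>y\<in>I. x \<le> y \<longrightarrow> integral {x..y} (\<lambda>s. P s * (d\<theta> k s)\<^sup>2) \<le> C"
        using energy[OF k] by blast
      have "integral {- y..- x} (\<lambda>s. P (- s) * (- d\<theta> k (- s))\<^sup>2) = integral {x..y} (\<lambda>s. P s * (d\<theta> k s)\<^sup>2)" for x y
        using Henstock_Kurzweil_Integration.integral_reflect_real[of y x "\<lambda>s. P s * (d\<theta> k s)\<^sup>2"] by simp
      from this[of "- _" "- _"] C show ?thesis by (intro exI[of _ C]) (simp add: ball_simps)
    qed
    show "vanishes_right ?J (\<lambda>s. P (- s) * (1 + \<bar>\<theta> k (- s)\<bar> ^ m) * - d\<theta> k (- s))" if "k \<in> K" for k m
      using decay[OF that, of m] unfolding vanishes_right_reflect by (simp add: vanishes_left_def)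
    show "P (- s) > 0" if "s \<in> ?J" for s using that P_pos by auto
    show "?J \<noteq> {}" using I(3) by simp
    show "- c \<in> ?J" using c by simp
    show "finite K" "e > 0" by (fact K, fact e)
  qed
  then obtain s where "s \<in> ?J" "s > - c" "P (- s) * (\<Sum>k\<in>K. \<bar>- d\<theta> k (- s)\<bar>) * (1 + (\<Sum>k\<in>K. \<bar>\<theta> k (- s)\<bar>)) ^ N < e"
    by blast
  then show ?thesis by (intro bexI[of _ "- s"]) auto
qed

lemma vanishing_bounded:
  assumes I: "is_interval I" and h: "continuous_on I h" "vanishes_left I h" "vanishes_right I h"
  shows "\<exists>B. \<forall>s\<in>I. \<bar>h s\<bar> \<le> B"
proof -
  from h(2,3) obtain c d where cd: "c \<in> I" "\<forall>s\<in>I. s < c \<longrightarrow> \<bar>h s\<bar> < 1" "d \<in> I" "\<forall>s\<in>I. d < s \<longrightarrow> \<bar>h s\<bar> < 1"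
    unfolding vanishes_left_def vanishes_right_def by (metis zero_less_one)
  have "{c..d} \<subseteq> I" by (rule is_interval_Icc_subset[OF I cd(1,3)])
  then have "bounded (h ` {c..d})"
    by (intro compact_imp_bounded compact_continuous_image continuous_on_subset[OF h(1)]) auto
  then obtain B where B: "\<forall>s\<in>{c..d}. \<bar>h s\<bar> \<le> B" by (auto simp: bounded_iff)
  have "\<bar>h s\<bar> \<le> max 1 B" if "s \<in> I" for s
    using cd that B by (cases "s < c"; cases "d < s") (auto intro: less_imp_le simp: le_max_iff_disj)
  then show ?thesis by blast
qed

text \<open>Test the equation with \<open>\<theta>\<close>: the derivative of
  \<open>P * d\<theta> * \<theta>\<close> is
  \<open>P * d\<theta>\<^sup>2 + w * (V - l) * \<theta>\<^sup>2\<close>. The boundary values are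
  bounded because they vanish at the ends, and the second term is at least a negative multiple of
  the mass since \<open>V\<close> is bounded below. Both bounds are independent of the
  subinterval.\<close>

lemma energy_bound:
  fixes P w V \<theta> d\<theta> :: "real \<Rightarrow> real"
  assumes I: "is_interval I"
    and deriv: "\<And>s. s \<in> I \<Longrightarrow> (\<theta> has_real_derivative d\<theta> s) (at s)"
    and flux: "\<And>s. s \<in> I \<Longrightarrow> ((\<lambda>s. P s * d\<theta> s) has_real_derivative w s * (V s - l) * \<theta> s) (at s)"
    and cont: "continuous_on I P" "continuous_on I w" "continuous_on I V" "continuous_on I d\<theta>"
    and w: "\<And>s. s \<in> I \<Longrightarrow> w s \<ge> 0"
    and V: "\<And>s. s \<in> I \<Longrightarrow> V s \<ge> - c"
    and mass: "\<And>x y. x \<in> I \<Longrightarrow> y \<in> I \<Longrightarrow> x \<le> y \<Longrightarrow> integral {x..y} (\<lambda>s. w s * (\<theta> s)\<^sup>2) \<le> C"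
    and decay: "vanishes_left I (\<lambda>s. P s * d\<theta> s * \<theta> s)" "vanishes_right I (\<lambda>s. P s * d\<theta> s * \<theta> s)"
  shows "\<exists>C. \<forall>x\<in>I. \<forall>y\<in>I. x \<le> y \<longrightarrow> integral {x..y} (\<lambda>s. P s * (d\<theta> s)\<^sup>2) \<le> C"
proof -
  have c\<theta>: "continuous_on I \<theta>"
    using deriv by (intro continuous_at_imp_continuous_on ballI DERIV_isCont) blast
  have "continuous_on I (\<lambda>s. P s * d\<theta> s * \<theta> s)" by (intro continuous_intros cont c\<theta>)
  from vanishing_bounded[OF I this decay] obtain B where B: "\<forall>s\<in>I. \<bar>P s * d\<theta> s * \<theta> s\<bar> \<le> B" by blast
  have "integral {x..y} (\<lambda>s. P s * (d\<theta> s)\<^sup>2) \<le> 2 * B + (\<bar>c\<bar> + \<bar>l\<bar>) * C" if xy: "x \<in> I" "y \<in> I" "x \<le> y" for x y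
  proof -
    have sub: "{x..y} \<subseteq> I" by (rule is_interval_Icc_subset[OF I xy(1,2)])
    note sub_cont = cont[THEN continuous_on_subset, OF sub] continuous_on_subset[OF c\<theta> sub]
    note int = integrable_continuous_real continuous_intros sub_cont
    have "((\<lambda>s. P s * (d\<theta> s)\<^sup>2 + w s * (V s - l) * (\<theta> s)\<^sup>2) has_integral P y * d\<theta> y * \<theta> y - P x * d\<theta> x * \<theta> x) {x..y}"
    proof (rule fundamental_theorem_of_calculus[OF xy(3)])
      fix s assume "s \<in> {x..y}"
      then have s: "s \<in> I" using sub by auto
      have "((\<lambda>s. P s * d\<theta> s * \<theta> s) has_real_derivative P s * (d\<theta> s)\<^sup>2 + w s * (V s - l) * (\<theta> s)\<^sup>2) (at s)"
        by (rule DERIV_cong[OF DERIV_mult[OF flux[OF s] deriv[OF s]]]) (simp add: power2_eq_square algebra_simps)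
      then show "((\<lambda>s. P s * d\<theta> s * \<theta> s) has_vector_derivative P s * (d\<theta> s)\<^sup>2 + w s * (V s - l) * (\<theta> s)\<^sup>2) (at s within {x..y})"
        unfolding has_real_derivative_iff_has_vector_derivative[symmetric] by (rule has_field_derivative_at_within)
    qed
    from integral_unique[OF this]
    have "integral {x..y} (\<lambda>s. P s * (d\<theta> s)\<^sup>2) + integral {x..y} (\<lambda>s. w s * (V s - l) * (\<theta> s)\<^sup>2)
       = P y * d\<theta> y * \<theta> y - P x * d\<theta> x * \<theta> x"
      by (subst integral_add[symmetric]) (intro int refl, intro int refl, simp)
    moreover have "P y * d\<theta> y * \<theta> y - P x * d\<theta> x * \<theta> x \<le> 2 * B"
      using bspec[OF B xy(1)] bspec[OF B xy(2)] by linarith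
    moreover have "- ((\<bar>c\<bar> + \<bar>l\<bar>) * C) \<le> integral {x..y} (\<lambda>s. w s * (V s - l) * (\<theta> s)\<^sup>2)"
    proof -
      have "- ((\<bar>c\<bar> + \<bar>l\<bar>) * C) \<le> - ((\<bar>c\<bar> + \<bar>l\<bar>) * integral {x..y} (\<lambda>s. w s * (\<theta> s)\<^sup>2))"
        using mass[OF xy] by (simp add: mult_left_mono)
      also have "\<dots> = integral {x..y} (\<lambda>s. - (\<bar>c\<bar> + \<bar>l\<bar>) * (w s * (\<theta> s)\<^sup>2))"
        unfolding Henstock_Kurzweil_Integration.integral_mult_right by (simp only: minus_mult_left)
      also have "\<dots> \<le> integral {x..y} (\<lambda>s. w s * (V s - l) * (\<theta> s)\<^sup>2)"
      proof (rule integral_le)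
        fix s assume "s \<in> {x..y}"
        then have s: "s \<in> I" using sub by auto
        have "- (\<bar>c\<bar> + \<bar>l\<bar>) \<le> V s - l" using V[OF s] by linarith
        then have "- (\<bar>c\<bar> + \<bar>l\<bar>) * (w s * (\<theta> s)\<^sup>2) \<le> (V s - l) * (w s * (\<theta> s)\<^sup>2)"
          using w[OF s] by (intro mult_right_mono) auto
        then show "- (\<bar>c\<bar> + \<bar>l\<bar>) * (w s * (\<theta> s)\<^sup>2) \<le> w s * (V s - l) * (\<theta> s)\<^sup>2" by (simp add: mult_ac)
      qed (intro int)+
      finally show ?thesis .
    qed
    ultimately show ?thesis by linarith
  qed
  then show ?thesis by blast
qed

subsection \<open>Convexity along vector-valued functions\<close>

context bellman
begin

text \<open>The first differential, in direction \<open>\<omega>\<close>, of \<open>\<Phi>\<close>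
  composed with the regularised squared norms of the two blocks of \<open>h\<close>.
  \<open>X\<close> and \<open>Y\<close> are separate arguments because the regularisation makes them
  larger than the bare sums of squares.\<close>

definition form1 :: "'j set \<Rightarrow> 'j set \<Rightarrow> real \<Rightarrow> real \<Rightarrow> ('j \<Rightarrow> real) \<Rightarrow> ('j \<Rightarrow> real) \<Rightarrow> real" where
  "form1 J1 J2 X Y h \<omega> = 2 * \<Phi>x X Y * (\<Sum>j\<in>J1. h j * \<omega> j) + 2 * \<Phi>y X Y * (\<Sum>j\<in>J2. h j * \<omega> j)"

text \<open>The second differential of the same composition, evaluated twice in the direction
  \<open>\<omega>\<close>.\<close>

definition form2 :: "'j set \<Rightarrow> 'j set \<Rightarrow> real \<Rightarrow> real \<Rightarrow> ('j \<Rightarrow> real) \<Rightarrow> ('j \<Rightarrow> real) \<Rightarrow> real" where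
  "form2 J1 J2 X Y h \<omega> = 2 * \<Phi>x X Y * (\<Sum>j\<in>J1. (\<omega> j)\<^sup>2) + 2 * \<Phi>y X Y * (\<Sum>j\<in>J2. (\<omega> j)\<^sup>2)
     + 4 * \<Phi>xx X Y * (\<Sum>j\<in>J1. h j * \<omega> j)\<^sup>2
     + 8 * \<Phi>xy X Y * ((\<Sum>j\<in>J1. h j * \<omega> j) * (\<Sum>j\<in>J2. h j * \<omega> j))
     + 4 * \<Phi>yy X Y * (\<Sum>j\<in>J2. h j * \<omega> j)\<^sup>2"

text \<open>Only the components of \<open>\<omega>\<close> along \<open>h\<close> meet second
  derivatives of \<open>\<Phi>\<close>; their normalised lengths \<open>a\<close> and
  \<open>b\<close> are fed into \<open>hessian\<close>. The rest of each squared norm is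
  non-negative by Cauchy-Schwarz, also with enlarged \<open>X\<close> and \<open>Y\<close>, and is
  covered by \<open>grad_x\<close> and \<open>grad_y\<close>.\<close>

lemma form2_lower:
  assumes XY: "X > 0" "Y > 0" "(\<Sum>j\<in>J1. (h j)\<^sup>2) \<le> X" "(\<Sum>j\<in>J2. (h j)\<^sup>2) \<le> Y"
  shows "\<kappa> * \<tau> X Y * (\<Sum>j\<in>J1. (\<omega> j)\<^sup>2) + \<kappa> / \<tau> X Y * (\<Sum>j\<in>J2. (\<omega> j)\<^sup>2) \<le> form2 J1 J2 X Y h \<omega>"
proof -
  define a where "a = (\<Sum>j\<in>J1. h j * \<omega> j) / sqrt X"
  define b where "b = (\<Sum>j\<in>J2. h j * \<omega> j) / sqrt Y"
  have cs: "((\<Sum>j\<in>J. h j * \<omega> j) / sqrt Z)\<^sup>2 \<le> (\<Sum>j\<in>J. (\<omega> j)\<^sup>2)" if "Z > 0" "(\<Sum>j\<in>J. (h j)\<^sup>2) \<le> Z" for J Z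
  proof -
    have "(\<Sum>j\<in>J. h j * \<omega> j)\<^sup>2 \<le> (\<Sum>j\<in>J. (h j)\<^sup>2) * (\<Sum>j\<in>J. (\<omega> j)\<^sup>2)" by (rule Cauchy_Schwarz_ineq_sum)
    also have "\<dots> \<le> Z * (\<Sum>j\<in>J. (\<omega> j)\<^sup>2)" using that by (intro mult_right_mono sum_nonneg) auto
    finally show ?thesis using that by (simp add: power_divide field_simps)
  qed
  have a: "a\<^sup>2 \<le> (\<Sum>j\<in>J1. (\<omega> j)\<^sup>2)" and b: "b\<^sup>2 \<le> (\<Sum>j\<in>J2. (\<omega> j)\<^sup>2)"
    unfolding a_def b_def using cs XY by auto
  have ab: "(\<Sum>j\<in>J1. h j * \<omega> j) = sqrt X * a" "(\<Sum>j\<in>J2. h j * \<omega> j) = sqrt Y * b"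
    using XY by (auto simp: a_def b_def)
  have "\<kappa> * \<tau> X Y * ((\<Sum>j\<in>J1. (\<omega> j)\<^sup>2) - a\<^sup>2) \<le> 2 * \<Phi>x X Y * ((\<Sum>j\<in>J1. (\<omega> j)\<^sup>2) - a\<^sup>2)"
    using a by (intro mult_right_mono grad_x XY) auto
  moreover have "\<kappa> / \<tau> X Y * ((\<Sum>j\<in>J2. (\<omega> j)\<^sup>2) - b\<^sup>2) \<le> 2 * \<Phi>y X Y * ((\<Sum>j\<in>J2. (\<omega> j)\<^sup>2) - b\<^sup>2)"
    using b by (intro mult_right_mono grad_y XY) auto
  moreover note hessian[OF XY(1,2), of a b]
  moreover have "form2 J1 J2 X Y h \<omega> = 2 * \<Phi>x X Y * ((\<Sum>j\<in>J1. (\<omega> j)\<^sup>2) - a\<^sup>2) + 2 * \<Phi>y X Y * ((\<Sum>j\<in>J2. (\<omega> j)\<^sup>2) - b\<^sup>2)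
     + ((2 * \<Phi>x X Y + 4 * X * \<Phi>xx X Y) * a\<^sup>2 + 8 * (sqrt X * sqrt Y * \<Phi>xy X Y) * (a * b)
        + (2 * \<Phi>y X Y + 4 * Y * \<Phi>yy X Y) * b\<^sup>2)"
    unfolding form2_def ab using XY by (simp add: power_mult_distrib algebra_simps)
  ultimately show ?thesis by (simp add: right_diff_distrib)
qed

lemma Phi_xy_nonneg: "X > 0 \<Longrightarrow> Y > 0 \<Longrightarrow> \<Phi>x X Y \<ge> 0" "X > 0 \<Longrightarrow> Y > 0 \<Longrightarrow> \<Phi>y X Y \<ge> 0"
  using grad_x[of X Y] grad_y[of X Y] tau_pos[of X Y] kappa_nonneg
  by (smt (verit) mult_nonneg_nonneg divide_nonneg_pos)+

text \<open>\<open>m\<close> ranges over space-time directions with coefficients \<open>c m\<close>,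
  and \<open>u j\<close> is the total potential of component \<open>j\<close>. Derivative terms and
  zero-order terms are bounded below with the same weights \<open>\<kappa> * \<tau>\<close> and
  \<open>\<kappa> / \<tau>\<close>, which disappear through
  \<open>2 * sqrt (x * y) \<le> \<tau> * x + y / \<tau>\<close>.\<close>

lemma dissipation:
  fixes h u :: "'j \<Rightarrow> real" and \<omega> :: "'m \<Rightarrow> 'j \<Rightarrow> real" and c :: "'m \<Rightarrow> real"
  assumes XY: "X > 0" "Y > 0" "(\<Sum>j\<in>J1. (h j)\<^sup>2) \<le> X" "(\<Sum>j\<in>J2. (h j)\<^sup>2) \<le> Y"
    and r: "0 \<le> r" "\<And>j. r \<le> u j"
  shows "2 * \<kappa> * (sqrt (r * (\<Sum>j\<in>J1. (h j)\<^sup>2) + (\<Sum>m\<in>A. (c m)\<^sup>2 * (\<Sum>j\<in>J1. (\<omega> m j)\<^sup>2)))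
       * sqrt (r * (\<Sum>j\<in>J2. (h j)\<^sup>2) + (\<Sum>m\<in>A. (c m)\<^sup>2 * (\<Sum>j\<in>J2. (\<omega> m j)\<^sup>2))))
    \<le> (\<Sum>m\<in>A. (c m)\<^sup>2 * form2 J1 J2 X Y h (\<omega> m)) + form1 J1 J2 X Y h (\<lambda>j. u j * h j)"
proof -
  define N where "N J = r * (\<Sum>j\<in>J. (h j)\<^sup>2) + (\<Sum>m\<in>A. (c m)\<^sup>2 * (\<Sum>j\<in>J. (\<omega> m j)\<^sup>2))" for J
  have N0: "N J \<ge> 0" for J unfolding N_def using r by (intro add_nonneg_nonneg mult_nonneg_nonneg sum_nonneg) auto
  let ?t = "\<tau> X Y"
  have t: "?t > 0" by (rule tau_pos[OF XY(1,2)])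
  have 1: "(c m)\<^sup>2 * (\<kappa> * ?t * (\<Sum>j\<in>J1. (\<omega> m j)\<^sup>2) + \<kappa> / ?t * (\<Sum>j\<in>J2. (\<omega> m j)\<^sup>2)) \<le> (c m)\<^sup>2 * form2 J1 J2 X Y h (\<omega> m)" for m
    by (intro mult_left_mono form2_lower XY) auto
  have sq: "r * (\<Sum>j\<in>J. (h j)\<^sup>2) \<le> (\<Sum>j\<in>J. h j * (u j * h j))" for J
  proof -
    have "r * (h j)\<^sup>2 \<le> h j * (u j * h j)" for j
      using mult_right_mono[OF r(2)[of j], of "(h j)\<^sup>2"] by (simp add: power2_eq_square mult_ac)
    then show ?thesis by (simp add: sum_distrib_left sum_mono)
  qed
  have sq0: "0 \<le> r * (\<Sum>j\<in>J. (h j)\<^sup>2)" for J using r by (intro mult_nonneg_nonneg sum_nonneg) auto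
  have "\<kappa> * ?t * (r * (\<Sum>j\<in>J1. (h j)\<^sup>2)) \<le> 2 * \<Phi>x X Y * (\<Sum>j\<in>J1. h j * (u j * h j))"
    using sq0 Phi_xy_nonneg[OF XY(1,2)] by (intro mult_mono grad_x XY sq) auto
  moreover have "\<kappa> / ?t * (r * (\<Sum>j\<in>J2. (h j)\<^sup>2)) \<le> 2 * \<Phi>y X Y * (\<Sum>j\<in>J2. h j * (u j * h j))"
    using sq0 Phi_xy_nonneg[OF XY(1,2)] by (intro mult_mono grad_y XY sq) auto
  moreover have "(\<Sum>m\<in>A. (c m)\<^sup>2 * (\<kappa> * ?t * (\<Sum>j\<in>J1. (\<omega> m j)\<^sup>2) + \<kappa> / ?t * (\<Sum>j\<in>J2. (\<omega> m j)\<^sup>2)))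
     \<le> (\<Sum>m\<in>A. (c m)\<^sup>2 * form2 J1 J2 X Y h (\<omega> m))" by (intro sum_mono 1)
  moreover have "(\<Sum>m\<in>A. (c m)\<^sup>2 * (\<kappa> * ?t * (\<Sum>j\<in>J1. (\<omega> m j)\<^sup>2) + \<kappa> / ?t * (\<Sum>j\<in>J2. (\<omega> m j)\<^sup>2)))
     = \<kappa> * ?t * (\<Sum>m\<in>A. (c m)\<^sup>2 * (\<Sum>j\<in>J1. (\<omega> m j)\<^sup>2)) + \<kappa> / ?t * (\<Sum>m\<in>A. (c m)\<^sup>2 * (\<Sum>j\<in>J2. (\<omega> m j)\<^sup>2))"
    by (simp add: distrib_left sum.distrib sum_distrib_left mult_ac)
  ultimately have main: "\<kappa> * ?t * N J1 + \<kappa> / ?t * N J2 \<le> (\<Sum>m\<in>A. (c m)\<^sup>2 * form2 J1 J2 X Y h (\<omega> m)) + form1 J1 J2 X Y h (\<lambda>j. u j * h j)"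
    unfolding N_def form1_def distrib_left[of _ "r * _"] by linarith
  have "2 * (sqrt (?t * N J1) * sqrt (N J2 / ?t)) \<le> ?t * N J1 + N J2 / ?t"
    using sum_squares_bound[of "sqrt (?t * N J1)" "sqrt (N J2 / ?t)"] t N0 by simp
  also have "sqrt (?t * N J1) * sqrt (N J2 / ?t) = sqrt (N J1) * sqrt (N J2)"
    using t by (simp add: real_sqrt_mult[symmetric] real_sqrt_divide field_simps)
  finally have "\<kappa> * (2 * (sqrt (N J1) * sqrt (N J2))) \<le> \<kappa> * (?t * N J1 + N J2 / ?t)"
    by (intro mult_left_mono kappa_nonneg)
  also have "\<dots> = \<kappa> * ?t * N J1 + \<kappa> / ?t * N J2" by (simp add: distrib_left)
  also note main
  finally show ?thesis unfolding N_def by (simp add: mult_ac)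
qed

lemma Phi_chain_squares:
  fixes h h' :: "'j \<Rightarrow> real \<Rightarrow> real"
  assumes h: "\<And>j. (h j has_real_derivative h' j s) (at s within A)" and c: "c > 0"
  shows "((\<lambda>s. \<Phi> (c + (\<Sum>j\<in>J1. (h j s)\<^sup>2)) (c + (\<Sum>j\<in>J2. (h j s)\<^sup>2))) has_real_derivative
      form1 J1 J2 (c + (\<Sum>j\<in>J1. (h j s)\<^sup>2)) (c + (\<Sum>j\<in>J2. (h j s)\<^sup>2)) (\<lambda>j. h j s) (\<lambda>j. h' j s)) (at s within A)"
proof -
  have D: "((\<lambda>s. c + (\<Sum>j\<in>J. (h j s)\<^sup>2)) has_real_derivative 2 * (\<Sum>j\<in>J. h j s * h' j s)) (at s within A)" for J
    by (auto intro!: derivative_eq_intros h simp: sum_distrib_left mult_ac)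
  have "0 < c + (\<Sum>j\<in>J. (h j s)\<^sup>2)" for J using c by (simp add: add_pos_nonneg sum_nonneg)
  from chain[OF D D this this] show ?thesis by (simp add: form1_def mult_ac)
qed

text \<open>\<open>\<omega>\<close> is a flux equal to \<open>P * h'\<close> at the point
  \<open>s\<close>. Its derivative is given as a whole, so the coefficient is never differentiated
  on its own. It is applied with \<open>P = 1\<close> in time and with
  \<open>P = pp\<^sup>2 * w\<close> in space.\<close>

lemma form1_chain:
  fixes h h' \<omega> \<omega>' :: "'j \<Rightarrow> real \<Rightarrow> real"
  assumes h: "\<And>j. (h j has_real_derivative h' j s) (at s within A)"
    and \<omega>: "\<And>j. (\<omega> j has_real_derivative \<omega>' j s) (at s within A)" and c: "c > 0"
    and P: "\<And>j. \<omega> j s = P * h' j s"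
  shows "((\<lambda>s. form1 J1 J2 (c + (\<Sum>j\<in>J1. (h j s)\<^sup>2)) (c + (\<Sum>j\<in>J2. (h j s)\<^sup>2)) (\<lambda>j. h j s) (\<lambda>j. \<omega> j s)) has_real_derivative
      P * form2 J1 J2 (c + (\<Sum>j\<in>J1. (h j s)\<^sup>2)) (c + (\<Sum>j\<in>J2. (h j s)\<^sup>2)) (\<lambda>j. h j s) (\<lambda>j. h' j s)
      + form1 J1 J2 (c + (\<Sum>j\<in>J1. (h j s)\<^sup>2)) (c + (\<Sum>j\<in>J2. (h j s)\<^sup>2)) (\<lambda>j. h j s) (\<lambda>j. \<omega>' j s)) (at s within A)"
proof -
  define X where "X J s = c + (\<Sum>j\<in>J. (h j s)\<^sup>2)" for J s
  define E where "E J = (\<Sum>j\<in>J. h j s * h' j s)" for J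
  have D: "(X J has_real_derivative 2 * E J) (at s within A)" for J
    unfolding X_def E_def by (auto intro!: derivative_eq_intros h simp: sum_distrib_left mult_ac)
  have pos: "0 < X J s" for J unfolding X_def using c by (simp add: add_pos_nonneg sum_nonneg)
  have F: "((\<lambda>s. \<Sum>j\<in>J. h j s * \<omega> j s) has_real_derivative P * (\<Sum>j\<in>J. (h' j s)\<^sup>2) + (\<Sum>j\<in>J. h j s * \<omega>' j s)) (at s within A)" for J
    by (rule DERIV_cong[OF DERIV_sum[OF DERIV_mult[OF h \<omega>]]])
       (simp add: P sum_distrib_left sum.distrib[symmetric] power2_eq_square mult_ac add.commute)
  have Fs: "(\<Sum>j\<in>J. h j s * \<omega> j s) = P * E J" for J
    by (simp add: E_def P sum_distrib_left mult_ac)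
  note d = DERIV_add[OF DERIV_mult[OF DERIV_cmult[OF chain_x[OF D D pos pos]] F]
        DERIV_mult[OF DERIV_cmult[OF chain_y[OF D D pos pos]] F], of 2 J1 J2 J1 2 J1 J2 J2]
  show ?thesis unfolding form1_def X_def[symmetric]
    by (rule DERIV_cong[OF d], unfold Fs form1_def form2_def E_def[symmetric] X_def[symmetric])
       (simp add: algebra_simps power2_eq_square)
qed

text \<open>Each \<open>\<bar>h j\<bar>\<close> in a block is at most the square root of the
  corresponding \<open>X\<close> or \<open>Y\<close>, so precisely the products controlled by
  \<open>growth\<close> appear. The bound does not deteriorate as the regularisation tends to
  0.\<close>

lemma form1_bound:
  fixes h \<omega> :: "'j::finite \<Rightarrow> real"
  assumes C: "\<forall>X>0. \<forall>Y>0. \<Phi>x X Y * sqrt X \<le> C * (1 + X + Y) ^ N \<and> \<Phi>y X Y * sqrt Y \<le> C * (1 + X + Y) ^ N"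
    and XY: "X > 0" "Y > 0" "(\<Sum>j\<in>J1. (h j)\<^sup>2) \<le> X" "(\<Sum>j\<in>J2. (h j)\<^sup>2) \<le> Y"
  shows "\<bar>form1 J1 J2 X Y h \<omega>\<bar> \<le> 4 * C * (1 + X + Y) ^ N * (\<Sum>j\<in>UNIV. \<bar>\<omega> j\<bar>)"
proof -
  have 1: "f * \<bar>\<Sum>j\<in>J. h j * \<omega> j\<bar> \<le> C * (1 + X + Y) ^ N * (\<Sum>j\<in>UNIV. \<bar>\<omega> j\<bar>)"
    if f: "0 \<le> f" "f * sqrt Z \<le> C * (1 + X + Y) ^ N" "(\<Sum>j\<in>J. (h j)\<^sup>2) \<le> Z" for f Z J
  proof -
    have hZ: "\<bar>h j\<bar> \<le> sqrt Z" if "j \<in> J" for j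
    proof -
      have "(h j)\<^sup>2 \<le> (\<Sum>j\<in>J. (h j)\<^sup>2)" using that by (intro member_le_sum) auto
      then show ?thesis using f(3) by (intro real_le_rsqrt) auto
    qed
    have "\<bar>\<Sum>j\<in>J. h j * \<omega> j\<bar> \<le> (\<Sum>j\<in>J. \<bar>h j\<bar> * \<bar>\<omega> j\<bar>)"
      by (rule order.trans[OF sum_abs]) (simp add: abs_mult)
    also have "\<dots> \<le> (\<Sum>j\<in>J. sqrt Z * \<bar>\<omega> j\<bar>)" using hZ by (intro sum_mono mult_right_mono) auto
    also have "\<dots> = sqrt Z * (\<Sum>j\<in>J. \<bar>\<omega> j\<bar>)" by (simp add: sum_distrib_left)
    finally have "f * \<bar>\<Sum>j\<in>J. h j * \<omega> j\<bar> \<le> f * (sqrt Z * (\<Sum>j\<in>J. \<bar>\<omega> j\<bar>))" using f by (intro mult_left_mono)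
    also have "\<dots> = (f * sqrt Z) * (\<Sum>j\<in>J. \<bar>\<omega> j\<bar>)" by simp
    also have "\<dots> \<le> (C * (1 + X + Y) ^ N) * (\<Sum>j\<in>J. \<bar>\<omega> j\<bar>)" using f by (intro mult_right_mono sum_nonneg) auto
    also have "\<dots> \<le> (C * (1 + X + Y) ^ N) * (\<Sum>j\<in>UNIV. \<bar>\<omega> j\<bar>)"
    proof (intro mult_left_mono sum_mono2)
      have "0 \<le> f * sqrt Z" using f sum_nonneg[of J "\<lambda>j. (h j)\<^sup>2"] by auto
      then show "0 \<le> C * (1 + X + Y) ^ N" using f by linarith
    qed auto
    finally show ?thesis .
  qed
  have "\<Phi>x X Y * \<bar>\<Sum>j\<in>J1. h j * \<omega> j\<bar> \<le> C * (1 + X + Y) ^ N * (\<Sum>j\<in>UNIV. \<bar>\<omega> j\<bar>)"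
    "\<Phi>y X Y * \<bar>\<Sum>j\<in>J2. h j * \<omega> j\<bar> \<le> C * (1 + X + Y) ^ N * (\<Sum>j\<in>UNIV. \<bar>\<omega> j\<bar>)"
    using C XY by (intro 1[of _ X] 1[of _ Y] Phi_xy_nonneg; simp)+
  moreover have "\<bar>form1 J1 J2 X Y h \<omega>\<bar> \<le> 2 * (\<Phi>x X Y * \<bar>\<Sum>j\<in>J1. h j * \<omega> j\<bar>) + 2 * (\<Phi>y X Y * \<bar>\<Sum>j\<in>J2. h j * \<omega> j\<bar>)"
    unfolding form1_def using Phi_xy_nonneg[OF XY(1,2)]
    by (intro order.trans[OF abs_triangle_ineq]) (simp add: abs_mult)
  ultimately show ?thesis by linarith
qed

end

subsection \<open>Tensor products of one-dimensional systems\<close>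

text \<open>If \<open>f\<close> fails to be integrable, its integral is 0 by convention; an
  integrable majorant is therefore enough.\<close>

lemma abs_integral_le:
  fixes f B :: "'a \<Rightarrow> real"
  assumes "integrable M B" "\<And>x. x \<in> space M \<Longrightarrow> \<bar>f x\<bar> \<le> B x"
  shows "\<bar>\<integral>x. f x \<partial>M\<bar> \<le> (\<integral>x. B x \<partial>M)"
proof (cases "integrable M f")
  case True
  have "\<bar>\<integral>x. f x \<partial>M\<bar> \<le> (\<integral>x. \<bar>f x\<bar> \<partial>M)" by (rule integral_abs_bound)
  also have "\<dots> \<le> (\<integral>x. B x \<partial>M)" using True assms by (intro integral_mono) auto
  finally show ?thesis .
next
  case False
  have "0 \<le> (\<integral>x. B x \<partial>M)" using assms by (intro Bochner_Integration.integral_nonneg) force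
  then show ?thesis using False by (simp add: not_integrable_integral_eq)
qed

lemma compact_PiE_UNIV: "(\<And>i. compact (S i)) \<Longrightarrow> compact (PiE UNIV S)"
  using compactin_PiE[of "\<lambda>_. euclidean" UNIV S] unfolding euclidean_product_topology by simp

lemma sigma_finite_weighted:
  assumes "open S" "continuous_on S u"
  shows "sigma_finite_measure (density (restrict_space lborel S) (\<lambda>s. ennreal (u s)))"
proof -
  interpret R: sigma_finite_measure "restrict_space lborel S"
    by (rule sigma_finite_measure_restrict_space) (use assms in \<open>auto intro: lborel.sigma_finite_measure_axioms\<close>)
  have "u \<in> borel_measurable (restrict_space lborel S)"
    using borel_measurable_continuous_on_restrict[OF assms(2)] by (simp cong: measurable_cong_sets restrict_space_sets_cong)
  then show ?thesis
    by (subst R.sigma_finite_iff_density_finite) (auto intro!: measurable_compose[of u] simp: AE_restrict_space_iff)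
qed

lemma continuous_measurable_weighted:
  fixes f :: "real \<Rightarrow> real"
  assumes "continuous_on S f"
  shows "f \<in> borel_measurable (density (restrict_space lborel S) u)"
proof -
  have "measurable (density (restrict_space lborel S) u) borel = measurable (restrict_space borel S) (borel :: real measure)"
    by (rule measurable_cong_sets) (auto simp: sets_restrict_space)
  then show ?thesis using borel_measurable_continuous_on_restrict[OF assms] by simp
qed

text \<open>One framework for both families. Component \<open>j\<close> is built from one-variable
  functions solving \<open>(pp\<^sup>2 * w * \<theta>')' = w * (V - lam) * \<theta>\<close>. For
  \<open>F\<close> the potential \<open>V\<close> is \<open>r\<close>; for \<open>G\<close> a
  commutator is added in one variable, so the common information is
  \<open>r \<le> V\<close>.\<close>

locale tensor_system =
  fixes I :: "'n::finite \<Rightarrow> real set" and w pp r :: "'n \<Rightarrow> real \<Rightarrow> real" and lam :: "'n \<Rightarrow> nat \<Rightarrow> real"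
    and \<theta> d\<theta> :: "'c::finite \<Rightarrow> 'n \<Rightarrow> nat \<Rightarrow> real \<Rightarrow> real" and V :: "'c \<Rightarrow> 'n \<Rightarrow> real \<Rightarrow> real"
    and M :: "'n \<Rightarrow> real measure"
  defines "M \<equiv> \<lambda>i. density (restrict_space lborel (I i)) (\<lambda>s. ennreal (w i s))"
  assumes I: "\<And>i. open (I i)" "\<And>i. is_interval (I i)" "\<And>i. I i \<noteq> {}"
    and w_pos: "\<And>i s. s \<in> I i \<Longrightarrow> w i s > 0" and w_cont: "\<And>i. continuous_on (I i) (w i)"
    and pp_nz: "\<And>i s. s \<in> I i \<Longrightarrow> pp i s \<noteq> 0" and pp_cont: "\<And>i. continuous_on (I i) (pp i)"
    and deriv: "\<And>j i k s. s \<in> I i \<Longrightarrow> (\<theta> j i k has_real_derivative d\<theta> j i k s) (at s)"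
    and flux: "\<And>j i k s. s \<in> I i \<Longrightarrow>
      ((\<lambda>s. (pp i s)\<^sup>2 * w i s * d\<theta> j i k s) has_real_derivative w i s * (V j i s - lam i k) * \<theta> j i k s) (at s)"
    and d_cont: "\<And>j i k. continuous_on (I i) (d\<theta> j i k)"
    and V_cont: "\<And>j i. continuous_on (I i) (V j i)" and r_cont: "\<And>i. continuous_on (I i) (r i)"
    and V_ge: "\<And>j i s. s \<in> I i \<Longrightarrow> r i s \<le> V j i s"
    and r_nonneg: "\<And>x. (\<And>i. x i \<in> I i) \<Longrightarrow> 0 \<le> (\<Sum>i\<in>UNIV. r i (x i))"
    and lam_nonneg: "\<And>i k. 0 \<le> lam i k"
    and moments: "\<And>j i k m. 1 \<le> m \<Longrightarrow> integrable (M i) (\<lambda>s. \<bar>\<theta> j i k s\<bar> ^ m)"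
    and decay_left: "\<And>j i k m. vanishes_left (I i) (\<lambda>s. (pp i s)\<^sup>2 * w i s * (1 + \<bar>\<theta> j i k s\<bar> ^ m) * d\<theta> j i k s)"
    and decay_right: "\<And>j i k m. vanishes_right (I i) (\<lambda>s. (pp i s)\<^sup>2 * w i s * (1 + \<bar>\<theta> j i k s\<bar> ^ m) * d\<theta> j i k s)"
begin

abbreviation "\<mu> \<equiv> PiM UNIV M"
definition "XX = {x. \<forall>i. x i \<in> I i}"

lemma space_M [simp]: "space (M i) = I i"
  by (simp add: M_def space_restrict_space)

lemma I_sets [measurable, simp]: "I i \<in> sets borel"
  using I(1) by auto

lemma sets_M: "sets (M i) = sets (restrict_space borel (I i))"
  by (simp add: M_def sets_restrict_space)

lemma cont_measurable: "continuous_on (I i) f \<Longrightarrow> f \<in> borel_measurable (M i)" for f :: "real \<Rightarrow> real"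
  unfolding M_def by (rule continuous_measurable_weighted)

lemma w_restrict: "w i \<in> borel_measurable (restrict_space lborel (I i))"
  using borel_measurable_continuous_on_restrict[OF w_cont[of i]] by (simp cong: measurable_cong_sets restrict_space_sets_cong)

lemma sigma_finite_M: "sigma_finite_measure (M i)"
  unfolding M_def by (rule sigma_finite_weighted[OF I(1) w_cont])

sublocale product_sigma_finite M
  by (intro product_sigma_finite.intro sigma_finite_M)

sublocale finite_product_sigma_finite M UNIV
  by standard simp

sublocale pair_sigma_finite \<mu> lborel
  by (intro pair_sigma_finite.intro sigma_finite_measure_axioms lborel.sigma_finite_measure_axioms)

lemma space_mu: "space \<mu> = XX"
  by (auto simp: space_PiM XX_def)

text \<open>Turns a slice integral into a Lebesgue integral with density \<open>w i\<close>, the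
  form to which the fundamental theorem of calculus applies.\<close>

lemma integral_M:
  assumes "g \<in> borel_measurable (M i)" "{a..b} \<subseteq> I i"
  shows "(\<integral>s. indicator {a..b} s * g s \<partial>M i) = (\<integral>s. (w i s * g s) * indicator {a..b} s \<partial>lborel)"
proof -
  have g: "g \<in> borel_measurable (restrict_space lborel (I i))"
    using assms(1) unfolding M_def by simp
  have [measurable]: "{a..b} \<inter> I i \<in> sets (restrict_space lborel (I i))"
    by (auto simp: sets_restrict_space)
  have ind: "(\<lambda>s. indicator {a..b} s :: real) \<in> borel_measurable (restrict_space lborel (I i))"
    by (intro measurable_restrict_space1) auto
  have "(\<integral>s. indicator {a..b} s * g s \<partial>M i) = (\<integral>s. w i s *\<^sub>R (indicator {a..b} s * g s) \<partial>restrict_space lborel (I i))"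
    unfolding M_def using w_pos
    by (intro integral_density w_restrict borel_measurable_times ind g) (auto simp: AE_restrict_space_iff less_imp_le)
  also have "\<dots> = (\<integral>s. indicator (I i) s *\<^sub>R (w i s *\<^sub>R (indicator {a..b} s * g s)) \<partial>lborel)"
    by (intro integral_restrict_space) auto
  also have "\<dots> = (\<integral>s. (w i s * g s) * indicator {a..b} s \<partial>lborel)"
    using assms(2) by (intro Bochner_Integration.integral_cong) (auto split: split_indicator)
  finally show ?thesis .
qed

lemma emeasure_Icc_finite:
  assumes "a \<in> I i" "b \<in> I i"
  shows "emeasure (M i) {a..b} < \<infinity>"
proof -
  have sub: "{a..b} \<subseteq> I i" by (rule is_interval_Icc_subset[OF I(2) assms])
  have "bounded (w i ` {a..b})"
    by (intro compact_imp_bounded compact_continuous_image continuous_on_subset[OF w_cont sub]) auto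
  then obtain B where B: "\<forall>s\<in>{a..b}. w i s \<le> B" by (auto simp: bounded_iff abs_le_iff)
  have s: "{a..b} \<in> sets (restrict_space lborel (I i))" using sub by (auto simp: sets_restrict_space intro!: image_eqI[of _ _ "{a..b}"])
  have "emeasure (M i) {a..b} = (\<integral>\<^sup>+s. ennreal (w i s) * indicator {a..b} s \<partial>restrict_space lborel (I i))"
    unfolding M_def by (rule emeasure_density) (use s w_restrict in auto)
  also have "\<dots> \<le> (\<integral>\<^sup>+s. ennreal B * indicator {a..b} s \<partial>restrict_space lborel (I i))"
    using B by (intro nn_integral_mono) (auto split: split_indicator intro: ennreal_leI)
  also have "\<dots> = ennreal B * emeasure lborel {a..b}"
    using s sub by (simp add: nn_integral_cmult_indicator emeasure_restrict_space)
  also have "\<dots> < \<infinity>" by (simp add: ennreal_mult_less_top emeasure_lborel_Icc_eq)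
  finally show ?thesis .
qed

section \<open>Boxes and functions on them\<close>

definition box :: "('n \<Rightarrow> real) \<Rightarrow> ('n \<Rightarrow> real) \<Rightarrow> ('n \<Rightarrow> real) set" where
  "box a b = PiE UNIV (\<lambda>i. {a i..b i})"

lemma mem_box: "x \<in> box a b \<longleftrightarrow> (\<forall>i. a i \<le> x i \<and> x i \<le> b i)"
  by (auto simp: box_def)

lemma box_subset: "a \<in> XX \<Longrightarrow> b \<in> XX \<Longrightarrow> box a b \<subseteq> XX"
  using is_interval_Icc_subset[OF I(2)] unfolding XX_def by (fastforce simp: mem_box)

lemma box_sets: "a \<in> XX \<Longrightarrow> b \<in> XX \<Longrightarrow> box a b \<in> sets \<mu>"
  unfolding box_def
proof (intro sets_PiM_I_finite)
  fix i assume "a \<in> XX" "b \<in> XX"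
  then have "{a i..b i} \<subseteq> I i" unfolding XX_def by (intro is_interval_Icc_subset[OF I(2)]) auto
  then show "{a i..b i} \<in> sets (M i)" unfolding sets_M by (auto simp: sets_restrict_space intro!: image_eqI[of _ _ "{a i..b i}"])
qed auto

lemma emeasure_box_finite: "a \<in> XX \<Longrightarrow> b \<in> XX \<Longrightarrow> emeasure \<mu> (box a b) < \<infinity>"
proof -
  assume ab: "a \<in> XX" "b \<in> XX"
  then have "{a i..b i} \<subseteq> I i" for i unfolding XX_def by (intro is_interval_Icc_subset[OF I(2)]) auto
  then have "{a i..b i} \<in> sets (M i)" for i unfolding sets_M by (auto simp: sets_restrict_space intro!: image_eqI[of _ _ "{a i..b i}"])
  then have "emeasure \<mu> (box a b) = (\<Prod>i\<in>UNIV. emeasure (M i) {a i..b i})"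
    unfolding box_def by (intro emeasure_PiM) auto
  also have "\<dots> < \<infinity>"
  proof -
    have "emeasure (M i) {a i..b i} \<noteq> top" for i
      using emeasure_Icc_finite[of "a i" i "b i"] ab by (auto simp: XX_def)
    then show ?thesis by (simp add: less_top[symmetric] ennreal_prod_eq_top)
  qed
  finally show ?thesis .
qed

text \<open>Continuity provides bounds on compact boxes and the hypotheses of the fundamental
  theorem of calculus. Measurability is carried along separately, so that the product sigma-algebra
  is never compared with the Borel sets of the function space.\<close>

definition nice :: "(('n \<Rightarrow> real) \<Rightarrow> real \<Rightarrow> real) \<Rightarrow> bool" where
  "nice f \<longleftrightarrow> (\<lambda>z. f (fst z) (snd z)) \<in> borel_measurable (\<mu> \<Otimes>\<^sub>M lborel)
     \<and> continuous_on (XX \<times> UNIV) (\<lambda>z. f (fst z) (snd z))"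

lemma nice_const: "nice (\<lambda>x t. c)"
  by (auto simp: nice_def)

lemma nice_time:
  assumes f: "continuous_on UNIV f"
  shows "nice (\<lambda>x. f)"
  unfolding nice_def
proof
  have "f \<in> borel_measurable lborel" using borel_measurable_continuous_onI[OF f] by simp
  from measurable_compose[OF measurable_snd this]
  show "(\<lambda>z. f (snd z)) \<in> borel_measurable (\<mu> \<Otimes>\<^sub>M lborel)" .
  show "continuous_on (XX \<times> UNIV) (\<lambda>z. f (snd z))"
    by (rule continuous_on_compose2[OF f]) (auto intro!: continuous_intros)
qed

lemma nice_coord: "continuous_on (I i) f \<Longrightarrow> nice (\<lambda>x t. f (x i))"
  unfolding nice_def
proof
  assume f: "continuous_on (I i) f"
  have "(\<lambda>z. fst z i) \<in> \<mu> \<Otimes>\<^sub>M lborel \<rightarrow>\<^sub>M M i"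
    by (rule measurable_compose[OF measurable_fst measurable_component_singleton]) auto
  from measurable_compose[OF this cont_measurable[OF f]]
  show "(\<lambda>z. f (fst z i)) \<in> borel_measurable (\<mu> \<Otimes>\<^sub>M lborel)" .
  have "continuous_on (XX \<times> (UNIV :: real set)) (\<lambda>z. fst z i)"
    by (rule continuous_on_product_then_coordinatewise[OF continuous_on_fst]) (auto intro!: continuous_intros)
  then show "continuous_on (XX \<times> (UNIV :: real set)) (\<lambda>z. f (fst z i))"
    by (rule continuous_on_compose2[OF f]) (auto simp: XX_def)
qed

lemma nice_add: "nice f \<Longrightarrow> nice g \<Longrightarrow> nice (\<lambda>x t. f x t + g x t)"
  and nice_mult: "nice f \<Longrightarrow> nice g \<Longrightarrow> nice (\<lambda>x t. f x t * g x t)"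
  and nice_power: "nice f \<Longrightarrow> nice (\<lambda>x t. f x t ^ n)"
  and nice_diff: "nice f \<Longrightarrow> nice g \<Longrightarrow> nice (\<lambda>x t. f x t - g x t)"
  and nice_sqrt: "nice f \<Longrightarrow> nice (\<lambda>x t. sqrt (f x t))"
  unfolding nice_def by (auto intro!: continuous_intros)

lemma nice_sum: "(\<And>k. k \<in> A \<Longrightarrow> nice (f k)) \<Longrightarrow> nice (\<lambda>x t. \<Sum>k\<in>A. f k x t)"
  and nice_prod: "(\<And>k. k \<in> A \<Longrightarrow> nice (f k)) \<Longrightarrow> nice (\<lambda>x t. \<Prod>k\<in>A. f k x t)"
  unfolding nice_def by (auto intro!: continuous_intros borel_measurable_sum borel_measurable_prod)

lemma nice_compose2:
  assumes "nice X" "nice Y" "\<And>x t. X x t > 0" "\<And>x t. Y x t > 0"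
    and "continuous_on ({0<..} \<times> {0<..}) (\<lambda>z. \<Psi> (fst z) (snd z))"
    and "(\<lambda>z. \<Psi> (fst z) (snd z)) \<in> borel_measurable (borel \<Otimes>\<^sub>M borel)"
  shows "nice (\<lambda>x t. \<Psi> (X x t) (Y x t) :: real)"
  unfolding nice_def
proof
  have "(\<lambda>z. (X (fst z) (snd z), Y (fst z) (snd z))) \<in> \<mu> \<Otimes>\<^sub>M lborel \<rightarrow>\<^sub>M borel \<Otimes>\<^sub>M borel"
    using assms(1,2) by (auto simp: nice_def)
  from measurable_compose[OF this assms(6)]
  show "(\<lambda>z. \<Psi> (X (fst z) (snd z)) (Y (fst z) (snd z))) \<in> borel_measurable (\<mu> \<Otimes>\<^sub>M lborel)" by simp
  have "continuous_on (XX \<times> (UNIV :: real set)) (\<lambda>z. (X (fst z) (snd z), Y (fst z) (snd z)))"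
    using assms(1,2) by (auto simp: nice_def intro!: continuous_intros)
  then have "continuous_on (XX \<times> (UNIV :: real set)) (\<lambda>z. \<Psi> (fst (X (fst z) (snd z), Y (fst z) (snd z))) (snd (X (fst z) (snd z), Y (fst z) (snd z))))"
    by (rule continuous_on_compose2[OF assms(5)]) (use assms(3,4) in auto)
  then show "continuous_on (XX \<times> (UNIV :: real set)) (\<lambda>z. \<Psi> (X (fst z) (snd z)) (Y (fst z) (snd z)))" by simp
qed

lemma nice_bounded:
  assumes f: "nice f" and ab: "a \<in> XX" "b \<in> XX"
  shows "\<exists>B. \<forall>x\<in>box a b. \<forall>t\<in>{0..T}. \<bar>f x t\<bar> \<le> B"
proof -
  have "compact (box a b \<times> {0..T})"
    unfolding box_def by (intro compact_Times compact_PiE_UNIV) auto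
  then have "bounded ((\<lambda>z. f (fst z) (snd z)) ` (box a b \<times> {0..T}))"
    using f box_subset[OF ab] unfolding nice_def
    by (intro compact_imp_bounded compact_continuous_image) (auto elim: continuous_on_subset)
  then show ?thesis by (fastforce simp: bounded_iff)
qed

lemma nice_integrable:
  assumes f: "nice f" and ab: "a \<in> XX" "b \<in> XX"
  shows "integrable (\<mu> \<Otimes>\<^sub>M lborel) (\<lambda>(x, t). indicator (box a b) x * indicator {0..T} t * f x t)"
proof -
  obtain B where B: "\<forall>x\<in>box a b. \<forall>t\<in>{0..T}. \<bar>f x t\<bar> \<le> B" using nice_bounded[OF assms] by blast
  have "integrable (\<mu> \<Otimes>\<^sub>M lborel) (\<lambda>z. indicator (box a b \<times> {0..T}) z *\<^sub>R f (fst z) (snd z))"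
  proof (rule integrableI_bounded_set_indicator[where B = B])
    show "box a b \<times> {0..T} \<in> sets (\<mu> \<Otimes>\<^sub>M lborel)" using box_sets[OF ab] by auto
    show "(\<lambda>z. f (fst z) (snd z)) \<in> borel_measurable (\<mu> \<Otimes>\<^sub>M lborel)" using f by (simp add: nice_def)
    have "emeasure (\<mu> \<Otimes>\<^sub>M lborel) (box a b \<times> {0..T}) = emeasure \<mu> (box a b) * emeasure lborel {0..T}"
      using box_sets[OF ab] by (intro lborel.emeasure_pair_measure_Times) auto
    then show "emeasure (\<mu> \<Otimes>\<^sub>M lborel) (box a b \<times> {0..T}) < \<infinity>"
      using emeasure_box_finite[OF ab] by (simp add: ennreal_mult_less_top emeasure_lborel_Icc_eq)
    show "AE z in \<mu> \<Otimes>\<^sub>M lborel. z \<in> box a b \<times> {0..T} \<longrightarrow> norm (f (fst z) (snd z)) \<le> B"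
      using B by auto
  qed
  then show ?thesis by (simp add: indicator_times split_beta')
qed

lemma nice_time_cont:
  assumes "nice f" "x \<in> XX" shows "isCont (f x) t"
proof -
  have "continuous_on UNIV (\<lambda>t. f (fst (x, t)) (snd (x, t)))"
    using assms unfolding nice_def
    by (intro continuous_on_compose2[of "XX \<times> UNIV" "\<lambda>z. f (fst z) (snd z)" UNIV "\<lambda>t. (x, t)"]) (auto intro!: continuous_intros)
  then show ?thesis by (simp add: continuous_on_eq_continuous_at)
qed

lemma upd_XX: "(\<And>l. l \<noteq> i \<Longrightarrow> x l \<in> I l) \<Longrightarrow> s \<in> I i \<Longrightarrow> x(i := s) \<in> XX"
  by (simp add: XX_def)

lemma nice_coord_cont:
  assumes "nice f" "\<And>l. l \<noteq> i \<Longrightarrow> x l \<in> I l"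
  shows "continuous_on (I i) (\<lambda>s. f (x(i := s)) t)"
proof -
  have "continuous_on (I i) (\<lambda>s. (x(i := s), t))"
  proof (intro continuous_intros continuous_on_coordinatewise_then_product)
    fix l show "continuous_on (I i) (\<lambda>s. (x(i := s)) l)"
      by (cases "l = i") (auto intro!: continuous_intros)
  qed
  then have "continuous_on (I i) (\<lambda>s. f (fst (x(i := s), t)) (snd (x(i := s), t)))"
    using assms unfolding nice_def
    by (intro continuous_on_compose2[of "XX \<times> UNIV" "\<lambda>z. f (fst z) (snd z)" "I i" "\<lambda>s. (x(i := s), t)"]) (auto intro!: upd_XX)
  then show ?thesis by simp
qed

lemma nice_fixed_measurable: "nice f \<Longrightarrow> (\<lambda>x. f x t) \<in> borel_measurable \<mu>"
  unfolding nice_def using measurable_compose[of "\<lambda>x. (x, t)" \<mu> "\<mu> \<Otimes>\<^sub>M lborel" "\<lambda>z. f (fst z) (snd z)" borel] by simp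

end

subsection \<open>The Bellman flow\<close>

text \<open>\<open>S\<close> is a finite set of multi-indices carrying all data, \<open>J1\<close>
  collects the components of \<open>F\<close> and \<open>J2\<close> those of \<open>G\<close>. The
  coefficients \<open>C\<close> are parameters, so that rescaled data form another instance.\<close>

locale bellman_flow = tensor_system I w pp r lam \<theta> d\<theta> V M + bellman \<Phi> \<Phi>x \<Phi>y \<Phi>xx \<Phi>xy \<Phi>yy \<tau> \<kappa>
  for I :: "'n::finite \<Rightarrow> real set" and w pp r lam
    and \<theta> d\<theta> :: "'c::finite \<Rightarrow> 'n \<Rightarrow> nat \<Rightarrow> real \<Rightarrow> real" and V M
    and \<Phi> \<Phi>x \<Phi>y \<Phi>xx \<Phi>xy \<Phi>yy \<tau> \<kappa> +
  fixes S :: "('n \<Rightarrow> nat) set" and C :: "'c \<Rightarrow> ('n \<Rightarrow> nat) \<Rightarrow> real" and J1 J2 :: "'c set"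
  assumes finite_S: "finite S"
begin

section \<open>Finite spectral sums and their equations\<close>

definition freq :: "('n \<Rightarrow> nat) \<Rightarrow> real" where
  "freq k = sqrt (\<Sum>i\<in>UNIV. lam i (k i))"

definition h :: "'c \<Rightarrow> ('n \<Rightarrow> real) \<Rightarrow> real \<Rightarrow> real" where
  "h j x t = (\<Sum>k\<in>S. C j k * exp (- t * freq k) * (\<Prod>l\<in>UNIV. \<theta> j l (k l) (x l)))"

definition ht :: "'c \<Rightarrow> ('n \<Rightarrow> real) \<Rightarrow> real \<Rightarrow> real" where
  "ht j x t = (\<Sum>k\<in>S. - freq k * (C j k * exp (- t * freq k) * (\<Prod>l\<in>UNIV. \<theta> j l (k l) (x l))))"

definition htt :: "'c \<Rightarrow> ('n \<Rightarrow> real) \<Rightarrow> real \<Rightarrow> real" where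
  "htt j x t = (\<Sum>k\<in>S. (freq k)\<^sup>2 * (C j k * exp (- t * freq k) * (\<Prod>l\<in>UNIV. \<theta> j l (k l) (x l))))"

definition hx :: "'n \<Rightarrow> 'c \<Rightarrow> ('n \<Rightarrow> real) \<Rightarrow> real \<Rightarrow> real" where
  "hx i j x t = (\<Sum>k\<in>S. C j k * exp (- t * freq k) * (d\<theta> j i (k i) (x i) * (\<Prod>l\<in>-{i}. \<theta> j l (k l) (x l))))"

text \<open>The one-variable generator in variable \<open>i\<close>, applied termwise through its
  eigenvalues.\<close>

definition hl :: "'n \<Rightarrow> 'c \<Rightarrow> ('n \<Rightarrow> real) \<Rightarrow> real \<Rightarrow> real" where
  "hl i j x t = (\<Sum>k\<in>S. lam i (k i) * (C j k * exp (- t * freq k) * (\<Prod>l\<in>UNIV. \<theta> j l (k l) (x l))))"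

lemma freq_nonneg: "freq k \<ge> 0" and freq_sq: "(freq k)\<^sup>2 = (\<Sum>i\<in>UNIV. lam i (k i))"
  unfolding freq_def using lam_nonneg by (auto intro!: sum_nonneg)

lemma h_deriv_t: "((\<lambda>t. h j x t) has_real_derivative ht j x t) (at t)"
  unfolding h_def ht_def by (auto intro!: derivative_eq_intros sum.cong)

lemma ht_deriv_t: "((\<lambda>t. ht j x t) has_real_derivative htt j x t) (at t)"
  unfolding ht_def htt_def by (auto intro!: derivative_eq_intros sum.cong simp: power2_eq_square)

lemma prod_UNIV_split: "(\<Prod>l\<in>UNIV. f l) = f i * (\<Prod>l\<in>-{i}. f l)" for f :: "'n \<Rightarrow> real"
  by (subst prod.remove[of _ i]) (auto simp: Compl_eq_Diff_UNIV)

lemma prod_upd: "(\<Prod>l\<in>-{i}. f l ((x(i := s)) l)) = (\<Prod>l\<in>-{i}. f l (x l))" for f :: "'n \<Rightarrow> real \<Rightarrow> real"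
  by (intro prod.cong) auto

lemma h_upd: "h j (x(i := s)) t = (\<Sum>k\<in>S. C j k * exp (- t * freq k) * (\<theta> j i (k i) s * (\<Prod>l\<in>-{i}. \<theta> j l (k l) (x l))))"
  unfolding h_def prod_UNIV_split[of _ i] prod_upd[where f = "\<lambda>l. \<theta> j l (_ l)"] by simp

lemma hx_upd: "hx i j (x(i := s)) t = (\<Sum>k\<in>S. C j k * exp (- t * freq k) * (d\<theta> j i (k i) s * (\<Prod>l\<in>-{i}. \<theta> j l (k l) (x l))))"
  unfolding hx_def prod_upd[where f = "\<lambda>l. \<theta> j l (_ l)"] by simp

lemma h_deriv_x:
  assumes "s \<in> I i"
  shows "((\<lambda>s. h j (x(i := s)) t) has_real_derivative hx i j (x(i := s)) t) (at s)"
  unfolding h_upd hx_upd using assms by (auto intro!: derivative_eq_intros deriv sum.cong)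

text \<open>The one-variable equations are linear, so they add up with the factors in the other
  variables frozen.\<close>

lemma hx_deriv_x:
  assumes s: "s \<in> I i"
  shows "((\<lambda>s. (pp i s)\<^sup>2 * w i s * hx i j (x(i := s)) t) has_real_derivative
      w i s * (V j i s * h j (x(i := s)) t - hl i j (x(i := s)) t)) (at s)"
proof -
  have "((\<lambda>s. \<Sum>k\<in>S. (C j k * exp (- t * freq k) * (\<Prod>l\<in>-{i}. \<theta> j l (k l) (x l))) * ((pp i s)\<^sup>2 * w i s * d\<theta> j i (k i) s))
      has_real_derivative (\<Sum>k\<in>S. (C j k * exp (- t * freq k) * (\<Prod>l\<in>-{i}. \<theta> j l (k l) (x l))) *
        (w i s * (V j i s - lam i (k i)) * \<theta> j i (k i) s))) (at s)"
    by (intro DERIV_sum DERIV_cmult flux s)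
  moreover have "(\<lambda>s. \<Sum>k\<in>S. (C j k * exp (- t * freq k) * (\<Prod>l\<in>-{i}. \<theta> j l (k l) (x l))) * ((pp i s)\<^sup>2 * w i s * d\<theta> j i (k i) s))
      = (\<lambda>s. (pp i s)\<^sup>2 * w i s * hx i j (x(i := s)) t)"
    unfolding hx_upd by (auto simp: sum_distrib_left mult_ac)
  moreover have "(\<Sum>k\<in>S. (C j k * exp (- t * freq k) * (\<Prod>l\<in>-{i}. \<theta> j l (k l) (x l))) *
        (w i s * (V j i s - lam i (k i)) * \<theta> j i (k i) s)) = w i s * (V j i s * h j (x(i := s)) t - hl i j (x(i := s)) t)"
    unfolding h_upd hl_def prod_UNIV_split[of _ i] prod_upd[where f = "\<lambda>l. \<theta> j l (_ l)"]
    by (simp add: sum_distrib_left sum_subtractf[symmetric] algebra_simps)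
  ultimately show ?thesis by simp
qed

text \<open>The equation in time: a squared frequency is the sum of the one-variable
  eigenvalues.\<close>

lemma htt_eq: "htt j x t = (\<Sum>i\<in>UNIV. hl i j x t)"
  unfolding htt_def hl_def freq_sq sum_distrib_right by (rule sum.swap)

lemma \<theta>_cont: "continuous_on (I i) (\<theta> j i k)"
  using deriv[of _ i j k] by (intro continuous_at_imp_continuous_on ballI DERIV_isCont) blast

lemma nice_h: "nice (h j)" and nice_ht: "nice (ht j)" and nice_htt: "nice (htt j)"
  and nice_hx: "nice (hx i j)" and nice_hl: "nice (hl i j)"
proof -
  have e: "nice (\<lambda>x t. exp (- t * c))" for c by (rule nice_time) (auto intro!: continuous_intros)
  note ns = nice_sum nice_mult nice_const nice_prod nice_coord[OF \<theta>_cont] nice_coord[OF d_cont] e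
  have "nice (\<lambda>x t. h j x t)" "nice (\<lambda>x t. ht j x t)" "nice (\<lambda>x t. htt j x t)" "nice (\<lambda>x t. hx i j x t)"
    "nice (\<lambda>x t. hl i j x t)"
    unfolding h_def ht_def htt_def hx_def hl_def by (intro ns)+
  then show "nice (h j)" "nice (ht j)" "nice (htt j)" "nice (hx i j)" "nice (hl i j)" by simp_all
qed

section \<open>The Bellman function along the flow\<close>

definition sq :: "'c set \<Rightarrow> real \<Rightarrow> ('n \<Rightarrow> real) \<Rightarrow> real \<Rightarrow> real" where
  "sq J c x t = c + (\<Sum>j\<in>J. (h j x t)\<^sup>2)"

definition b :: "real \<Rightarrow> ('n \<Rightarrow> real) \<Rightarrow> real \<Rightarrow> real" where
  "b c x t = \<Phi> (sq J1 c x t) (sq J2 c x t)"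

definition F1 :: "real \<Rightarrow> ('c \<Rightarrow> ('n \<Rightarrow> real) \<Rightarrow> real \<Rightarrow> real) \<Rightarrow> ('n \<Rightarrow> real) \<Rightarrow> real \<Rightarrow> real" where
  "F1 c \<omega> x t = form1 J1 J2 (sq J1 c x t) (sq J2 c x t) (\<lambda>j. h j x t) (\<lambda>j. \<omega> j x t)"

definition F2 :: "real \<Rightarrow> ('c \<Rightarrow> ('n \<Rightarrow> real) \<Rightarrow> real \<Rightarrow> real) \<Rightarrow> ('n \<Rightarrow> real) \<Rightarrow> real \<Rightarrow> real" where
  "F2 c \<omega> x t = form2 J1 J2 (sq J1 c x t) (sq J2 c x t) (\<lambda>j. h j x t) (\<lambda>j. \<omega> j x t)"

definition btt :: "real \<Rightarrow> ('n \<Rightarrow> real) \<Rightarrow> real \<Rightarrow> real" where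
  "btt c x t = F2 c ht x t + F1 c htt x t"

text \<open>The flux \<open>pp\<^sup>2 * w * \<partial>\<^sub>i b\<close> through a face orthogonal
  to the direction \<open>i\<close>.\<close>

definition fl :: "'n \<Rightarrow> real \<Rightarrow> ('n \<Rightarrow> real) \<Rightarrow> real \<Rightarrow> real" where
  "fl i c x t = F1 c (\<lambda>j x t. (pp i (x i))\<^sup>2 * w i (x i) * hx i j x t) x t"

text \<open>This is \<open>(1 / w) * \<partial>\<^sub>i fl\<close>, that is, minus the adjoint of
  \<open>\<dd>\<close> composed with \<open>\<dd>\<close>, in variable \<open>i\<close> and applied
  to \<open>b\<close>, with the equations for \<open>h\<close> already inserted.\<close>

definition Dx :: "'n \<Rightarrow> real \<Rightarrow> ('n \<Rightarrow> real) \<Rightarrow> real \<Rightarrow> real" where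
  "Dx i c x t = (pp i (x i))\<^sup>2 * F2 c (hx i) x t + F1 c (\<lambda>j x t. V j i (x i) * h j x t - hl i j x t) x t"

text \<open>The square of the star norm of the block \<open>J\<close>.\<close>

definition energy :: "'c set \<Rightarrow> ('n \<Rightarrow> real) \<Rightarrow> real \<Rightarrow> real" where
  "energy J x t = (\<Sum>i\<in>UNIV. r i (x i)) * (\<Sum>j\<in>J. (h j x t)\<^sup>2) + (\<Sum>j\<in>J. (ht j x t)\<^sup>2)
     + (\<Sum>i\<in>UNIV. \<Sum>j\<in>J. (pp i (x i) * hx i j x t)\<^sup>2)"

lemma sq_pos: "c > 0 \<Longrightarrow> sq J c x t > 0" and sq_ge: "c > 0 \<Longrightarrow> (\<Sum>j\<in>J. (h j x t)\<^sup>2) \<le> sq J c x t"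
  unfolding sq_def by (auto intro!: add_pos_nonneg sum_nonneg)

lemma b_deriv_t: "c > 0 \<Longrightarrow> ((\<lambda>t. b c x t) has_real_derivative F1 c ht x t) (at t)"
  unfolding b_def F1_def sq_def by (intro Phi_chain_squares h_deriv_t)

lemma bt_deriv_t: "c > 0 \<Longrightarrow> ((\<lambda>t. F1 c ht x t) has_real_derivative btt c x t) (at t)"
  using form1_chain[of "\<lambda>j t. h j x t" "\<lambda>j t. ht j x t" t UNIV "\<lambda>j t. ht j x t" "\<lambda>j t. htt j x t" c 1 J1 J2]
  unfolding btt_def F1_def F2_def sq_def by (simp add: h_deriv_t ht_deriv_t)

lemma fl_deriv_x:
  assumes c: "c > 0" and s: "s \<in> I i"
  shows "((\<lambda>s. fl i c (x(i := s)) t) has_real_derivative w i s * Dx i c (x(i := s)) t) (at s)"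
proof -
  have sc: "form1 J1 J2 X Y f (\<lambda>j. a * g j) = a * form1 J1 J2 X Y f g" for X Y f g and a :: real
    unfolding form1_def by (simp add: sum_distrib_left algebra_simps)
  have "((\<lambda>s. fl i c (x(i := s)) t) has_real_derivative
     ((pp i s)\<^sup>2 * w i s) * F2 c (hx i) (x(i := s)) t
      + form1 J1 J2 (sq J1 c (x(i := s)) t) (sq J2 c (x(i := s)) t) (\<lambda>j. h j (x(i := s)) t)
        (\<lambda>j. w i s * (V j i s * h j (x(i := s)) t - hl i j (x(i := s)) t))) (at s)"
    unfolding fl_def F1_def F2_def sq_def fun_upd_same
    using form1_chain[of "\<lambda>j s. h j (x(i := s)) t" "\<lambda>j s. hx i j (x(i := s)) t" s UNIV
        "\<lambda>j s. (pp i s)\<^sup>2 * w i s * hx i j (x(i := s)) t"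
        "\<lambda>j s. w i s * (V j i s * h j (x(i := s)) t - hl i j (x(i := s)) t)" c "(pp i s)\<^sup>2 * w i s" J1 J2,
        OF h_deriv_x[OF s] hx_deriv_x[OF s] c] by blast
  from this[unfolded sc] show ?thesis unfolding Dx_def F1_def by (simp add: distrib_left mult_ac)
qed

lemma form1_sum: "form1 J1 J2 X Y f (\<lambda>j. \<Sum>m\<in>A. g m j) = (\<Sum>m\<in>A. form1 J1 J2 X Y f (g m))"
  unfolding form1_def sum_distrib_left sum.distrib by (subst (1 2) sum.swap) simp

text \<open>Time and space directions are treated together by the index type
  \<open>'n option\<close>, with \<open>None\<close> for time. Since \<open>htt\<close> is the sum
  of the \<open>hl i\<close>, the eigenvalue terms cancel and leave the total potential, which is at
  least the total \<open>r\<close>.\<close>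

lemma dissipation_pointwise:
  assumes c: "c > 0" and x: "x \<in> XX"
  shows "2 * \<kappa> * (sqrt (energy J1 x t) * sqrt (energy J2 x t)) \<le> btt c x t + (\<Sum>i\<in>UNIV. Dx i c x t)"
proof -
  let ?X = "sq J1 c x t" and ?Y = "sq J2 c x t" and ?h = "\<lambda>j. h j x t"
  define \<omega> where "\<omega> m j = (case m of None \<Rightarrow> ht j x t | Some i \<Rightarrow> hx i j x t)" for m j
  define cf where "cf m = (case m of None \<Rightarrow> 1 | Some i \<Rightarrow> pp i (x i))" for m
  define u where "u j = (\<Sum>i\<in>UNIV. V j i (x i))" for j
  let ?r = "\<Sum>i\<in>UNIV. r i (x i)"
  have so: "(\<Sum>m\<in>UNIV. f m) = f None + (\<Sum>i\<in>UNIV. f (Some i))" for f :: "'n option \<Rightarrow> real"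
    unfolding UNIV_option_conv by (subst sum.insert) (auto simp: sum.reindex)
  have E: "energy J x t = ?r * (\<Sum>j\<in>J. (?h j)\<^sup>2) + (\<Sum>m\<in>UNIV. (cf m)\<^sup>2 * (\<Sum>j\<in>J. (\<omega> m j)\<^sup>2))" for J
    unfolding energy_def so cf_def \<omega>_def by (simp add: power_mult_distrib sum_distrib_left)
  have "2 * \<kappa> * (sqrt (energy J1 x t) * sqrt (energy J2 x t)) \<le>
     (\<Sum>m\<in>UNIV. (cf m)\<^sup>2 * form2 J1 J2 ?X ?Y ?h (\<omega> m)) + form1 J1 J2 ?X ?Y ?h (\<lambda>j. u j * ?h j)"
    unfolding E
  proof (rule dissipation)
    show "0 \<le> ?r" using x by (intro r_nonneg) (auto simp: XX_def)
    show "?r \<le> u j" for j unfolding u_def using x by (intro sum_mono V_ge) (auto simp: XX_def)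
  qed (use c sq_pos sq_ge in auto)
  also have "(\<lambda>j. u j * ?h j) = (\<lambda>j. htt j x t + (\<Sum>i\<in>UNIV. V j i (x i) * ?h j - hl i j x t))"
    unfolding htt_eq u_def by (auto simp: sum_subtractf sum_distrib_right)
  also have "form1 J1 J2 ?X ?Y ?h (\<lambda>j. htt j x t + (\<Sum>i\<in>UNIV. V j i (x i) * ?h j - hl i j x t))
     = F1 c htt x t + (\<Sum>i\<in>UNIV. F1 c (\<lambda>j x t. V j i (x i) * h j x t - hl i j x t) x t)"
    unfolding F1_def form1_sum[symmetric] by (simp add: form1_def distrib_left sum.distrib)
  also have "(\<Sum>m\<in>UNIV. (cf m)\<^sup>2 * form2 J1 J2 ?X ?Y ?h (\<omega> m)) = F2 c ht x t + (\<Sum>i\<in>UNIV. (pp i (x i))\<^sup>2 * F2 c (hx i) x t)"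
    unfolding so F2_def cf_def \<omega>_def by simp
  finally show ?thesis unfolding btt_def Dx_def sum.distrib by simp
qed

lemma nice_sq: "nice (sq J c)"
proof -
  have "nice (\<lambda>x t. sq J c x t)" unfolding sq_def by (intro nice_add nice_const nice_sum nice_power nice_h)
  then show ?thesis by simp
qed

lemma nice_Psi:
  assumes "c > 0" "\<Psi> \<in> {\<Phi>, \<Phi>x, \<Phi>y, \<Phi>xx, \<Phi>xy, \<Phi>yy}"
  shows "nice (\<lambda>x t. \<Psi> (sq J1 c x t) (sq J2 c x t))"
  by (rule nice_compose2[OF nice_sq nice_sq sq_pos[OF assms(1)] sq_pos[OF assms(1)] continuous[OF assms(2)] measurable[OF assms(2)]])

lemma nice_F1: "c > 0 \<Longrightarrow> (\<And>j. nice (\<omega> j)) \<Longrightarrow> nice (F1 c \<omega>)"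
  and nice_F2: "c > 0 \<Longrightarrow> (\<And>j. nice (\<omega> j)) \<Longrightarrow> nice (F2 c \<omega>)"
proof -
  assume c: "c > 0" and \<omega>: "\<And>j. nice (\<omega> j)"
  have \<Psi>: "nice (\<lambda>x t. \<Phi>x (sq J1 c x t) (sq J2 c x t))" "nice (\<lambda>x t. \<Phi>y (sq J1 c x t) (sq J2 c x t))"
    "nice (\<lambda>x t. \<Phi>xx (sq J1 c x t) (sq J2 c x t))" "nice (\<lambda>x t. \<Phi>xy (sq J1 c x t) (sq J2 c x t))"
    "nice (\<lambda>x t. \<Phi>yy (sq J1 c x t) (sq J2 c x t))"
    using nice_Psi[OF c] by auto
  have "nice (\<lambda>x t. F1 c \<omega> x t)" "nice (\<lambda>x t. F2 c \<omega> x t)"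
    unfolding F1_def F2_def form1_def form2_def
    by (intro nice_add nice_mult nice_const nice_sum nice_power nice_h \<Psi> \<omega>)+
  then show "nice (F1 c \<omega>)" "nice (F2 c \<omega>)" by simp_all
qed

lemma nice_b: "c > 0 \<Longrightarrow> nice (b c)"
  using nice_Psi[of c \<Phi>] unfolding b_def[abs_def] by simp

lemma nice_btt: "c > 0 \<Longrightarrow> nice (btt c)"
  unfolding btt_def[abs_def] by (intro nice_add nice_F1 nice_F2 nice_ht nice_htt)

lemma nice_Dx: "c > 0 \<Longrightarrow> nice (Dx i c)"
  unfolding Dx_def[abs_def]
  by (intro nice_add nice_mult nice_F1 nice_F2 nice_diff nice_coord nice_h nice_hx nice_hl continuous_intros pp_cont V_cont)

lemma nice_energy: "nice (energy J)"
  unfolding energy_def[abs_def]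
  by (intro nice_add nice_mult nice_sum nice_power nice_coord nice_h nice_ht nice_hx continuous_intros pp_cont r_cont)

end

section \<open>Integration over a box\<close>

context bellman_flow
begin

lemma nice_fixed_integrable:
  assumes f: "nice f" and ab: "\<alpha> \<in> XX" "\<beta> \<in> XX" and t: "0 \<le> t"
  shows "integrable \<mu> (\<lambda>x. indicator (box \<alpha> \<beta>) x * f x t)"
proof -
  obtain B where B: "\<forall>x\<in>box \<alpha> \<beta>. \<forall>s\<in>{0..t}. \<bar>f x s\<bar> \<le> B" using nice_bounded[OF f ab] by blast
  have "integrable \<mu> (\<lambda>x. indicator (box \<alpha> \<beta>) x *\<^sub>R f x t)"
    using B t by (intro integrableI_bounded_set_indicator[where B = B] box_sets ab nice_fixed_measurable f emeasure_box_finite) auto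
  then show ?thesis by simp
qed

text \<open>The integrand \<open>t * b''\<close> has the primitive
  \<open>t * b' - b\<close>.\<close>

lemma time_identity:
  assumes c: "c > 0" and ab: "\<alpha> \<in> XX" "\<beta> \<in> XX" and T: "0 \<le> T"
  shows "(\<integral>(x, t). indicator (box \<alpha> \<beta>) x * indicator {0..T} t * (t * btt c x t) \<partial>(\<mu> \<Otimes>\<^sub>M lborel))
    = (\<integral>x. indicator (box \<alpha> \<beta>) x * (T * F1 c ht x T - b c x T + b c x 0) \<partial>\<mu>)"
proof -
  have n: "nice (\<lambda>x t. t * btt c x t)" by (intro nice_mult nice_time nice_btt c continuous_intros)
  have "(\<integral>x. (\<integral>t. indicator (box \<alpha> \<beta>) x * indicator {0..T} t * (t * btt c x t) \<partial>lborel) \<partial>\<mu>)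
    = (\<integral>x. indicator (box \<alpha> \<beta>) x * (T * F1 c ht x T - b c x T + b c x 0) \<partial>\<mu>)"
  proof (rule Bochner_Integration.integral_cong)
    fix x assume "x \<in> space \<mu>"
    then have x: "x \<in> XX" by (simp add: space_mu)
    have "(\<integral>t. (t * btt c x t) * indicator {0..T} t \<partial>lborel) = (T * F1 c ht x T - b c x T) - (0 * F1 c ht x 0 - b c x 0)"
    proof (rule integral_FTC_Icc_real[OF T])
      fix t
      show "((\<lambda>t. t * F1 c ht x t - b c x t) has_real_derivative t * btt c x t) (at t)"
        by (rule DERIV_cong[OF DERIV_diff[OF DERIV_mult[OF DERIV_ident bt_deriv_t[OF c]] b_deriv_t[OF c]]]) simp
      show "isCont (\<lambda>t. t * btt c x t) t" using nice_time_cont[OF n x] by simp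
    qed
    then show "(\<integral>t. indicator (box \<alpha> \<beta>) x * indicator {0..T} t * (t * btt c x t) \<partial>lborel)
        = indicator (box \<alpha> \<beta>) x * (T * F1 c ht x T - b c x T + b c x 0)"
      by (simp add: mult.commute[of "indicator {0..T} _"] mult.assoc)
  qed simp
  then show ?thesis using integral_fst[OF nice_integrable[OF n ab, of T]] by simp
qed

text \<open>Fubini separates the variable \<open>i\<close>. The density \<open>w i\<close> turns
  \<open>Dx\<close> into the exact derivative of the flux, so only the two faces remain.\<close>

lemma space_slice:
  assumes c: "c > 0" and ab: "\<alpha> \<in> XX" "\<beta> \<in> XX" "\<And>i. \<alpha> i \<le> \<beta> i" and t: "0 \<le> t"
  shows "(\<integral>x. indicator (box \<alpha> \<beta>) x * Dx i c x t \<partial>\<mu>)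
    = (\<integral>x. indicator {x. \<forall>l. l \<noteq> i \<longrightarrow> x l \<in> {\<alpha> l..\<beta> l}} x * (fl i c (x(i := \<beta> i)) t - fl i c (x(i := \<alpha> i)) t)
        \<partial>PiM (UNIV - {i}) M)"
proof -
  have U: "insert i (UNIV - {i}) = UNIV" by auto
  have int: "integrable (PiM (insert i (UNIV - {i})) M) (\<lambda>x. indicator (box \<alpha> \<beta>) x * Dx i c x t)"
    unfolding U by (rule nice_fixed_integrable[OF nice_Dx[OF c] ab(1,2) t])
  have "(\<integral>x. indicator (box \<alpha> \<beta>) x * Dx i c x t \<partial>\<mu>) = (\<integral>x. (\<integral>s. indicator (box \<alpha> \<beta>) (x(i := s)) * Dx i c (x(i := s)) t \<partial>M i) \<partial>PiM (UNIV - {i}) M)"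
    using product_integral_insert[OF _ _ int] unfolding U by simp
  also have "\<dots> = (\<integral>x. indicator {x. \<forall>l. l \<noteq> i \<longrightarrow> x l \<in> {\<alpha> l..\<beta> l}} x * (fl i c (x(i := \<beta> i)) t - fl i c (x(i := \<alpha> i)) t)
        \<partial>PiM (UNIV - {i}) M)"
  proof (rule Bochner_Integration.integral_cong)
    fix x assume "x \<in> space (PiM (UNIV - {i}) M)"
    then have x: "\<And>l. l \<noteq> i \<Longrightarrow> x l \<in> I l" by (auto simp: space_PiM)
    have sub: "{\<alpha> i..\<beta> i} \<subseteq> I i" using ab by (intro is_interval_Icc_subset[OF I(2)]) (auto simp: XX_def)
    have cont: "continuous_on (I i) (\<lambda>s. Dx i c (x(i := s)) t)" by (rule nice_coord_cont[OF nice_Dx[OF c] x])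
    have ind: "indicator (box \<alpha> \<beta>) (x(i := s)) = (indicator {x. \<forall>l. l \<noteq> i \<longrightarrow> x l \<in> {\<alpha> l..\<beta> l}} x * indicator {\<alpha> i..\<beta> i} s :: real)" for s
      by (auto simp: mem_box split: split_indicator)
    have "(\<integral>s. indicator (box \<alpha> \<beta>) (x(i := s)) * Dx i c (x(i := s)) t \<partial>M i)
       = indicator {x. \<forall>l. l \<noteq> i \<longrightarrow> x l \<in> {\<alpha> l..\<beta> l}} x * (\<integral>s. indicator {\<alpha> i..\<beta> i} s * Dx i c (x(i := s)) t \<partial>M i)"
      unfolding ind by (simp add: mult.assoc)
    also have "(\<integral>s. indicator {\<alpha> i..\<beta> i} s * Dx i c (x(i := s)) t \<partial>M i)
       = (\<integral>s. (w i s * Dx i c (x(i := s)) t) * indicator {\<alpha> i..\<beta> i} s \<partial>lborel)"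
      by (rule integral_M[OF cont_measurable[OF cont] sub])
    also have "\<dots> = fl i c (x(i := \<beta> i)) t - fl i c (x(i := \<alpha> i)) t"
    proof (rule integral_FTC_Icc_real[OF ab(3)])
      fix s assume "\<alpha> i \<le> s" "s \<le> \<beta> i"
      then have s: "s \<in> I i" using sub by auto
      show "((\<lambda>s. fl i c (x(i := s)) t) has_real_derivative w i s * Dx i c (x(i := s)) t) (at s)"
        by (rule fl_deriv_x[OF c s])
      have "continuous_on (I i) (\<lambda>s. w i s * Dx i c (x(i := s)) t)" by (intro continuous_intros w_cont cont)
      then show "isCont (\<lambda>s. w i s * Dx i c (x(i := s)) t) s"
        using s I(1) by (simp add: continuous_on_eq_continuous_at)
    qed
    finally show "(\<integral>s. indicator (box \<alpha> \<beta>) (x(i := s)) * Dx i c (x(i := s)) t \<partial>M i)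
      = indicator {x. \<forall>l. l \<noteq> i \<longrightarrow> x l \<in> {\<alpha> l..\<beta> l}} x * (fl i c (x(i := \<beta> i)) t - fl i c (x(i := \<alpha> i)) t)" .
  qed simp
  finally show ?thesis .
qed

section \<open>Majorants that factor over the variables\<close>

text \<open>Summing over all components and all multi-indices of \<open>S\<close> gives a single
  function of one variable that majorises every factor; \<open>dZ\<close> does the same for the
  derivatives.\<close>

definition Z :: "'n \<Rightarrow> real \<Rightarrow> real" where
  "Z i s = (\<Sum>m\<in>UNIV \<times> S. \<bar>\<theta> (fst m) i (snd m i) s\<bar>)"

definition dZ :: "'n \<Rightarrow> real \<Rightarrow> real" where
  "dZ i s = (\<Sum>m\<in>UNIV \<times> S. \<bar>d\<theta> (fst m) i (snd m i) s\<bar>)"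

definition c0 :: real where "c0 = (\<Sum>m\<in>UNIV \<times> S. \<bar>C (fst m) (snd m)\<bar>)"

text \<open>Controls \<open>t\<close> times a time derivative. The factor \<open>freq k\<close>
  annihilates zero frequencies, so this tends to 0 even if the lowest eigenvalue is 0.\<close>

definition decay :: "real \<Rightarrow> real" where
  "decay t = (\<Sum>k\<in>S. t * freq k * exp (- t * freq k))"

lemma Z_nonneg: "Z i s \<ge> 0" and dZ_nonneg: "dZ i s \<ge> 0" and c0_nonneg: "c0 \<ge> 0"
  unfolding Z_def dZ_def c0_def by (auto intro!: sum_nonneg)

lemma \<theta>_le_Z: "k \<in> S \<Longrightarrow> \<bar>\<theta> j i (k i) s\<bar> \<le> Z i s"
  unfolding Z_def using member_le_sum[of "(j, k)" "UNIV \<times> S" "\<lambda>m. \<bar>\<theta> (fst m) i (snd m i) s\<bar>"] finite_S by simp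

lemma d\<theta>_le_dZ: "k \<in> S \<Longrightarrow> \<bar>d\<theta> j i (k i) s\<bar> \<le> dZ i s"
  unfolding dZ_def using member_le_sum[of "(j, k)" "UNIV \<times> S" "\<lambda>m. \<bar>d\<theta> (fst m) i (snd m i) s\<bar>"] finite_S by simp

lemma C_le_c0: "(\<Sum>k\<in>S. \<bar>C j k\<bar>) \<le> c0"
proof -
  have "c0 = (\<Sum>j\<in>UNIV. \<Sum>k\<in>S. \<bar>C j k\<bar>)" unfolding c0_def by (simp add: sum.cartesian_product split_beta')
  then show ?thesis using member_le_sum[of j UNIV "\<lambda>j. \<Sum>k\<in>S. \<bar>C j k\<bar>"] by (simp add: sum_nonneg)
qed

lemma coeff_sum_bound:
  assumes "\<And>k. k \<in> S \<Longrightarrow> \<bar>f k\<bar> \<le> B" "0 \<le> B" "\<And>k. k \<in> S \<Longrightarrow> \<bar>e k\<bar> \<le> \<bar>C j k\<bar>"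
  shows "\<bar>\<Sum>k\<in>S. e k * f k\<bar> \<le> c0 * B"
proof -
  have "\<bar>\<Sum>k\<in>S. e k * f k\<bar> \<le> (\<Sum>k\<in>S. \<bar>e k\<bar> * \<bar>f k\<bar>)" by (rule order.trans[OF sum_abs]) (simp add: abs_mult)
  also have "\<dots> \<le> (\<Sum>k\<in>S. \<bar>C j k\<bar> * B)" using assms by (intro sum_mono mult_mono) auto
  also have "\<dots> \<le> c0 * B" unfolding sum_distrib_right[symmetric] by (intro mult_right_mono C_le_c0 assms)
  finally show ?thesis .
qed

lemma C_exp: "0 \<le> t \<Longrightarrow> \<bar>C j k * exp (- t * freq k)\<bar> \<le> \<bar>C j k\<bar>"
  using freq_nonneg[of k] by (simp add: abs_mult mult_left_le)

lemma prod_le: "k \<in> S \<Longrightarrow> \<bar>\<Prod>l\<in>A. \<theta> j l (k l) (x l)\<bar> \<le> (\<Prod>l\<in>A. Z l (x l))"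
  unfolding abs_prod by (intro prod_mono) (auto simp: \<theta>_le_Z)

lemma prod_Z_nonneg: "0 \<le> (\<Prod>l\<in>A. Z l (x l))"
  by (intro prod_nonneg) (auto simp: Z_nonneg)

lemma h_bound: "0 \<le> t \<Longrightarrow> \<bar>h j x t\<bar> \<le> c0 * (\<Prod>l\<in>UNIV. Z l (x l))"
  unfolding h_def by (intro coeff_sum_bound[where j = j] prod_le prod_Z_nonneg C_exp)

lemma hx_bound: "0 \<le> t \<Longrightarrow> \<bar>hx i j x t\<bar> \<le> c0 * (dZ i (x i) * (\<Prod>l\<in>-{i}. Z l (x l)))"
  unfolding hx_def
proof (intro coeff_sum_bound[where j = j] C_exp)
  fix k assume "k \<in> S"
  then show "\<bar>d\<theta> j i (k i) (x i) * (\<Prod>l\<in>-{i}. \<theta> j l (k l) (x l))\<bar> \<le> dZ i (x i) * (\<Prod>l\<in>-{i}. Z l (x l))"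
    unfolding abs_mult by (intro mult_mono d\<theta>_le_dZ prod_le dZ_nonneg) auto
qed (auto intro!: mult_nonneg_nonneg prod_Z_nonneg dZ_nonneg)

lemma ht_bound:
  assumes t: "0 \<le> t"
  shows "t * \<bar>ht j x t\<bar> \<le> c0 * (decay t * (\<Prod>l\<in>UNIV. Z l (x l)))"
proof -
  have "t * \<bar>ht j x t\<bar> = \<bar>t * ht j x t\<bar>" using t by (simp add: abs_mult)
  also have "t * ht j x t = (\<Sum>k\<in>S. - C j k * ((t * freq k * exp (- t * freq k)) * (\<Prod>l\<in>UNIV. \<theta> j l (k l) (x l))))"
    unfolding ht_def by (simp add: sum_distrib_left mult_ac sum_negf)
  also have "\<bar>\<dots>\<bar> \<le> c0 * (decay t * (\<Prod>l\<in>UNIV. Z l (x l)))"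
  proof (intro coeff_sum_bound)
    fix k assume k: "k \<in> S"
    have nn: "0 \<le> t * freq k * exp (- t * freq k)" for k using t freq_nonneg[of k] by simp
    have "t * freq k * exp (- t * freq k) \<le> decay t"
      unfolding decay_def using k nn finite_S by (intro member_le_sum) auto
    then show "\<bar>t * freq k * exp (- t * freq k) * (\<Prod>l\<in>UNIV. \<theta> j l (k l) (x l))\<bar> \<le> decay t * (\<Prod>l\<in>UNIV. Z l (x l))"
      unfolding abs_mult[of _ "\<Prod>l\<in>UNIV. \<theta> j l (k l) (x l)"] using nn[of k] prod_le[OF k] by (intro mult_mono) auto
  next
    show "0 \<le> decay t * (\<Prod>l\<in>UNIV. Z l (x l))"
      unfolding decay_def using t freq_nonneg by (intro mult_nonneg_nonneg prod_Z_nonneg sum_nonneg) auto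
  qed auto
  finally show ?thesis .
qed

lemma decay_tendsto: "(decay \<longlongrightarrow> 0) at_top"
proof -
  have "((\<lambda>t. t * f * exp (- t * f)) \<longlongrightarrow> 0) at_top" if "f \<ge> 0" for f :: real
  proof (cases "f = 0")
    case False
    then have f: "f > 0" using that by simp
    have "filterlim (\<lambda>t. f * t) at_top at_top" using f by (intro filterlim_tendsto_pos_mult_at_top[OF tendsto_const]) (auto intro: filterlim_ident)
    from filterlim_compose[OF tendsto_power_div_exp_0[of 1] this]
    show ?thesis by (simp add: exp_minus divide_inverse mult_ac)
  qed simp
  then have "((\<lambda>t. \<Sum>k\<in>S. t * freq k * exp (- t * freq k)) \<longlongrightarrow> (\<Sum>k\<in>S. 0)) at_top"
    by (intro tendsto_sum) (auto simp: freq_nonneg)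
  then show ?thesis by (simp add: decay_def[abs_def])
qed

text \<open>The polynomial bound in \<open>X\<close> and \<open>Y\<close> becomes one in the product
  of all \<open>1 + Z l\<close>, hence a product of functions of one variable each. It is uniform
  for \<open>0 < c \<le> 1\<close>, which allows the regularisation to be removed before the boxes
  grow.\<close>

lemma F1_bound:
  "\<exists>A N. 0 \<le> A \<and> (\<forall>c \<omega> x t. 0 < c \<longrightarrow> c \<le> 1 \<longrightarrow> 0 \<le> t \<longrightarrow>
     \<bar>F1 c \<omega> x t\<bar> \<le> A * (\<Prod>l\<in>UNIV. (1 + Z l (x l)) ^ N) * (\<Sum>j\<in>UNIV. \<bar>\<omega> j x t\<bar>))"
proof -
  obtain G n where G: "\<forall>X>0. \<forall>Y>0. \<Phi>x X Y * sqrt X \<le> G * (1 + X + Y) ^ n \<and> \<Phi>y X Y * sqrt Y \<le> G * (1 + X + Y) ^ n"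
    using growth by blast
  define D where "D = 3 + 2 * (real (card (UNIV :: 'c set)) * c0\<^sup>2)"
  define A where "A = 4 * \<bar>G\<bar> * D ^ n"
  have D: "D \<ge> 0" by (simp add: D_def)
  have "\<bar>F1 c \<omega> x t\<bar> \<le> A * (\<Prod>l\<in>UNIV. (1 + Z l (x l)) ^ (2 * n)) * (\<Sum>j\<in>UNIV. \<bar>\<omega> j x t\<bar>)"
    if c: "0 < c" "c \<le> 1" and t: "0 \<le> t" for c \<omega> x t
  proof -
    define P where "P = (\<Prod>l\<in>UNIV. 1 + Z l (x l))"
    have P1: "1 \<le> P" unfolding P_def by (intro prod_ge_1) (auto simp: Z_nonneg)
    have ZP: "(\<Prod>l\<in>UNIV. Z l (x l)) \<le> P" unfolding P_def by (intro prod_mono) (auto simp: Z_nonneg)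
    have sqP: "sq J c x t \<le> 1 + real (card (UNIV :: 'c set)) * c0\<^sup>2 * P\<^sup>2" for J
    proof -
      have "(h j x t)\<^sup>2 \<le> c0\<^sup>2 * P\<^sup>2" for j
      proof -
        have "\<bar>h j x t\<bar> \<le> c0 * P" using h_bound[OF t, of j x] mult_left_mono[OF ZP c0_nonneg] by linarith
        then have "\<bar>h j x t\<bar>\<^sup>2 \<le> (c0 * P)\<^sup>2" by (intro power_mono) auto
        then show ?thesis by (simp add: power_mult_distrib)
      qed
      then have "(\<Sum>j\<in>J. (h j x t)\<^sup>2) \<le> (\<Sum>j\<in>J. c0\<^sup>2 * P\<^sup>2)" by (intro sum_mono)
      also have "\<dots> \<le> (\<Sum>j\<in>(UNIV :: 'c set). c0\<^sup>2 * P\<^sup>2)" by (rule sum_mono2) auto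
      finally show ?thesis unfolding sq_def using c by (simp add: mult.assoc)
    qed
    have "1 + sq J1 c x t + sq J2 c x t \<le> 3 * 1 + 2 * (real (card (UNIV :: 'c set)) * c0\<^sup>2) * P\<^sup>2"
      using sqP[of J1] sqP[of J2] by simp
    also have "\<dots> \<le> 3 * P\<^sup>2 + 2 * (real (card (UNIV :: 'c set)) * c0\<^sup>2) * P\<^sup>2" using P1 by simp
    also have "\<dots> = D * P\<^sup>2" by (simp add: D_def algebra_simps)
    finally have R: "1 + sq J1 c x t + sq J2 c x t \<le> D * P\<^sup>2" .
    have "\<bar>F1 c \<omega> x t\<bar> \<le> 4 * \<bar>G\<bar> * (1 + sq J1 c x t + sq J2 c x t) ^ n * (\<Sum>j\<in>UNIV. \<bar>\<omega> j x t\<bar>)"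
      unfolding F1_def
    proof (rule form1_bound)
      have "G * (1 + X + Y) ^ n \<le> \<bar>G\<bar> * (1 + X + Y) ^ n" if "X > 0" "Y > 0" for X Y :: real
        using that by (intro mult_right_mono) auto
      then show "\<forall>X>0. \<forall>Y>0. \<Phi>x X Y * sqrt X \<le> \<bar>G\<bar> * (1 + X + Y) ^ n \<and> \<Phi>y X Y * sqrt Y \<le> \<bar>G\<bar> * (1 + X + Y) ^ n"
        using G by (meson order.trans)
    qed (use c sq_pos sq_ge in auto)
    also have "\<dots> \<le> 4 * \<bar>G\<bar> * (D * P\<^sup>2) ^ n * (\<Sum>j\<in>UNIV. \<bar>\<omega> j x t\<bar>)"
      using R sq_pos[OF c(1), of J1 x t] sq_pos[OF c(1), of J2 x t]
      by (intro mult_right_mono mult_left_mono power_mono sum_nonneg) auto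
    also have "4 * \<bar>G\<bar> * (D * P\<^sup>2) ^ n = A * P ^ (2 * n)" by (simp add: A_def power_mult_distrib power_mult)
    also have "P ^ (2 * n) = (\<Prod>l\<in>UNIV. (1 + Z l (x l)) ^ (2 * n))" unfolding P_def by (simp add: prod_power_distrib)
    finally show ?thesis .
  qed
  moreover have "0 \<le> A" using D by (simp add: A_def)
  ultimately show ?thesis by blast
qed

lemma Z_cont: "continuous_on (I i) (Z i)"
  unfolding Z_def[abs_def] by (intro continuous_intros \<theta>_cont)

text \<open>The measure may be infinite, so only moments of order at least 1 are at hand; the
  leading factor \<open>Z\<close> ensures that no constant has to be integrated. Mixed products are
  split by \<open>a * b ^ N \<le> b ^ (N + 1) + a ^ (N + 1)\<close>.\<close>

lemma H_integrable: "integrable (M i) (\<lambda>s. Z i s * (1 + Z i s) ^ N)"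
proof -
  define n where "n = real (card ((UNIV :: 'c set) \<times> S))"
  define f where "f m s = \<bar>\<theta> (fst m) i (snd m i) s\<bar>" for m s
  define B where "B s = (1 + n) ^ N * (Z i s + (\<Sum>m\<in>UNIV \<times> S. \<Sum>m'\<in>UNIV \<times> S. f m' s ^ (N + 1) + f m s ^ (N + 1)))" for s
  have fin: "finite ((UNIV :: 'c set) \<times> S)" using finite_S by simp
  have "integrable (M i) B"
    unfolding B_def Z_def f_def using moments[of 1] moments[of "N + 1"]
    by (intro integrable_mult_right Bochner_Integration.integrable_add Bochner_Integration.integrable_sum) auto
  then show ?thesis
  proof (rule Bochner_Integration.integrable_bound)
    show "(\<lambda>s. Z i s * (1 + Z i s) ^ N) \<in> borel_measurable (M i)"
      by (intro cont_measurable continuous_intros Z_cont)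
    have "norm (Z i s * (1 + Z i s) ^ N) \<le> norm (B s)" for s
    proof -
      have f0: "0 \<le> f m s" for m by (simp add: f_def)
      have ab: "a * b ^ N \<le> b ^ (N + 1) + a ^ (N + 1)" if "0 \<le> a" "0 \<le> b" for a b :: real
      proof (cases "a \<le> b")
        case True
        then have "a * b ^ N \<le> b * b ^ N" using that by (intro mult_right_mono) auto
        then show ?thesis using that by (simp add: add_increasing2)
      next
        case False
        then have "a * b ^ N \<le> a * a ^ N" using that by (intro mult_left_mono power_mono) auto
        then show ?thesis using that by (simp add: add_increasing)
      qed
      have Zf: "Z i s = (\<Sum>m\<in>UNIV \<times> S. f m s)" by (simp add: Z_def f_def)
      have "Z i s * (1 + Z i s) ^ N \<le> Z i s * ((1 + n) ^ N * (1 + (\<Sum>m\<in>UNIV \<times> S. f m s ^ N)))"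
        unfolding Zf n_def using f0 by (intro mult_left_mono power_one_plus_sum_le fin sum_nonneg) auto
      also have "\<dots> = (1 + n) ^ N * (Z i s + (\<Sum>m\<in>UNIV \<times> S. \<Sum>m'\<in>UNIV \<times> S. f m s * f m' s ^ N))"
        unfolding sum_product[symmetric] Zf[symmetric] by (simp add: algebra_simps)
      also have "\<dots> \<le> B s"
        unfolding B_def n_def using f0 by (intro mult_left_mono add_left_mono sum_mono ab) auto
      finally show ?thesis using Z_nonneg[of i s] by simp
    qed
    then show "AE s in M i. norm (Z i s * (1 + Z i s) ^ N) \<le> norm (B s)" by simp
  qed
qed


lemma energy_nonneg:
  assumes "x \<in> XX"
  shows "0 \<le> energy J x t"
proof -
  have r: "0 \<le> (\<Sum>i\<in>UNIV. r i (x i))" using assms by (intro r_nonneg) (auto simp: XX_def)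
  show ?thesis unfolding energy_def
    by (intro add_nonneg_nonneg mult_nonneg_nonneg[OF r] sum_nonneg zero_le_power2)
qed

text \<open>Separates the quantity at the face, which has to become small, from a function of the
  other variables. Each of these variables retains a factor \<open>Z l\<close> coming from
  \<open>hx\<close>, as \<open>H_integrable\<close> requires.\<close>

lemma flux_bound:
  assumes AN: "\<forall>c \<omega> x t. 0 < c \<longrightarrow> c \<le> 1 \<longrightarrow> 0 \<le> t \<longrightarrow>
     \<bar>F1 c \<omega> x t\<bar> \<le> A * (\<Prod>l\<in>UNIV. (1 + Z l (x l)) ^ N) * (\<Sum>j\<in>UNIV. \<bar>\<omega> j x t\<bar>)" and A: "0 \<le> A"
    and c: "0 < c" "c \<le> 1" and t: "0 \<le> t" and xi: "x i \<in> I i"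
  shows "\<bar>fl i c x t\<bar> \<le> A * real (card (UNIV :: 'c set)) * c0 *
     ((pp i (x i))\<^sup>2 * w i (x i) * dZ i (x i) * (1 + Z i (x i)) ^ N) * (\<Prod>l\<in>-{i}. Z l (x l) * (1 + Z l (x l)) ^ N)"
proof -
  define P where "P = (pp i (x i))\<^sup>2 * w i (x i)"
  have P: "0 \<le> P" unfolding P_def using w_pos[OF xi] by simp
  have pr: "0 \<le> (\<Prod>l\<in>UNIV. (1 + Z l (x l)) ^ N)" by (intro prod_nonneg) (auto simp: Z_nonneg)
  have "\<bar>fl i c x t\<bar> \<le> A * (\<Prod>l\<in>UNIV. (1 + Z l (x l)) ^ N) * (\<Sum>j\<in>UNIV. \<bar>P * hx i j x t\<bar>)"
    using AN c t unfolding fl_def P_def by blast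
  also have "\<dots> \<le> A * (\<Prod>l\<in>UNIV. (1 + Z l (x l)) ^ N) * (\<Sum>j\<in>(UNIV :: 'c set). P * (c0 * (dZ i (x i) * (\<Prod>l\<in>-{i}. Z l (x l)))))"
    using hx_bound[OF t] P A pr
    by (intro mult_left_mono sum_mono) (auto simp: abs_mult intro!: mult_left_mono)
  also have "\<dots> = A * real (card (UNIV :: 'c set)) * c0 *
     (P * dZ i (x i) * (1 + Z i (x i)) ^ N) * (\<Prod>l\<in>-{i}. Z l (x l) * (1 + Z l (x l)) ^ N)"
    unfolding prod_UNIV_split[of _ i] prod.distrib by (simp add: mult_ac)
  finally show ?thesis unfolding P_def .
qed

text \<open>Integrating out the other variables leaves constants independent of the box, of the time
  and of the regularisation; only the values of \<open>\<eta>\<close> at the two faces vary.\<close>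

lemma slice_bound:
  assumes AN: "\<forall>c \<omega> x t. 0 < c \<longrightarrow> c \<le> 1 \<longrightarrow> 0 \<le> t \<longrightarrow>
     \<bar>F1 c \<omega> x t\<bar> \<le> A * (\<Prod>l\<in>UNIV. (1 + Z l (x l)) ^ N) * (\<Sum>j\<in>UNIV. \<bar>\<omega> j x t\<bar>)" and A: "0 \<le> A"
    and c: "0 < c" "c \<le> 1" and t: "0 \<le> t" and ab: "\<alpha> \<in> XX" "\<beta> \<in> XX" "\<And>i. \<alpha> i \<le> \<beta> i"
  defines "\<eta> \<equiv> \<lambda>i s. (pp i s)\<^sup>2 * w i s * dZ i s * (1 + Z i s) ^ N"
  shows "\<bar>\<integral>x. indicator (box \<alpha> \<beta>) x * Dx i c x t \<partial>\<mu>\<bar> \<le> A * real (card (UNIV :: 'c set)) * c0 *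
     (\<Prod>l\<in>-{i}. \<integral>s. Z l s * (1 + Z l s) ^ N \<partial>M l) * (\<eta> i (\<alpha> i) + \<eta> i (\<beta> i))"
proof -
  let ?H = "\<lambda>x. \<Prod>l\<in>UNIV - {i}. Z l (x l) * (1 + Z l (x l)) ^ N"
  define K where "K = A * real (card (UNIV :: 'c set)) * c0 * (\<eta> i (\<alpha> i) + \<eta> i (\<beta> i))"
  have abi: "\<alpha> i \<in> I i" "\<beta> i \<in> I i" using ab by (auto simp: XX_def)
  have \<eta>0: "0 \<le> \<eta> i s" if "s \<in> I i" for s
    unfolding \<eta>_def using w_pos[OF that] dZ_nonneg Z_nonneg by (intro mult_nonneg_nonneg) auto
  have H0: "0 \<le> ?H x" for x by (intro prod_nonneg mult_nonneg_nonneg) (auto simp: Z_nonneg)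
  have int: "integrable (PiM (UNIV - {i}) M) ?H" by (intro product_integrable_prod H_integrable) auto
  have "\<bar>\<integral>x. indicator (box \<alpha> \<beta>) x * Dx i c x t \<partial>\<mu>\<bar> \<le> (\<integral>x. K * ?H x \<partial>PiM (UNIV - {i}) M)"
    unfolding space_slice[OF c(1) ab t]
  proof (rule abs_integral_le)
    show "integrable (PiM (UNIV - {i}) M) (\<lambda>x. K * ?H x)" using int by simp
    fix x assume "x \<in> space (PiM (UNIV - {i}) M)"
    have fb: "\<bar>fl i c (x(i := s)) t\<bar> \<le> A * real (card (UNIV :: 'c set)) * c0 * \<eta> i s * ?H x" if "s \<in> I i" for s
      using flux_bound[OF AN A c t, of "x(i := s)" i] that
      unfolding \<eta>_def fun_upd_same Compl_eq_Diff_UNIV[symmetric] prod_upd[where f = "\<lambda>l y. Z l y * (1 + Z l y) ^ N"] by simp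
    have "\<bar>indicator {x. \<forall>l. l \<noteq> i \<longrightarrow> x l \<in> {\<alpha> l..\<beta> l}} x * (fl i c (x(i := \<beta> i)) t - fl i c (x(i := \<alpha> i)) t)\<bar>
       \<le> \<bar>fl i c (x(i := \<beta> i)) t\<bar> + \<bar>fl i c (x(i := \<alpha> i)) t\<bar>"
      by (auto split: split_indicator)
    also have "\<dots> \<le> K * ?H x" using fb[OF abi(1)] fb[OF abi(2)] by (simp add: K_def algebra_simps)
    finally show "\<bar>indicator {x. \<forall>l. l \<noteq> i \<longrightarrow> x l \<in> {\<alpha> l..\<beta> l}} x * (fl i c (x(i := \<beta> i)) t - fl i c (x(i := \<alpha> i)) t)\<bar> \<le> K * ?H x" .
  qed
  also have "\<dots> = K * (\<Prod>l\<in>UNIV - {i}. \<integral>s. Z l s * (1 + Z l s) ^ N \<partial>M l)"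
    by (subst product_integral_prod[symmetric]) (auto intro: H_integrable)
  finally show ?thesis unfolding K_def Compl_eq_Diff_UNIV by (simp add: mult_ac)
qed

text \<open>Integrate the dissipation against \<open>t\<close>. The time part contributes
  \<open>b\<close> at 0 and \<open>T\<close> times the time derivative of \<open>b\<close> at
  \<open>T\<close>, bounded through \<open>decay T\<close>, while \<open>- b\<close> at
  \<open>T\<close> is non-positive and is dropped. Each space part contributes face terms, and
  \<open>T\<^sup>2\<close> bounds the integral of \<open>t\<close> over the time interval.\<close>

lemma box_inequality:
  assumes AN: "\<forall>c \<omega> x t. 0 < c \<longrightarrow> c \<le> 1 \<longrightarrow> 0 \<le> t \<longrightarrow>
     \<bar>F1 c \<omega> x t\<bar> \<le> A * (\<Prod>l\<in>UNIV. (1 + Z l (x l)) ^ N) * (\<Sum>j\<in>UNIV. \<bar>\<omega> j x t\<bar>)" and A: "0 \<le> A"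
    and c: "0 < c" "c \<le> 1" and T: "0 \<le> T" and ab: "\<alpha> \<in> XX" "\<beta> \<in> XX" "\<And>i. \<alpha> i \<le> \<beta> i"
  defines "\<eta> \<equiv> \<lambda>i s. (pp i s)\<^sup>2 * w i s * dZ i s * (1 + Z i s) ^ N"
  defines "Q \<equiv> A * real (card (UNIV :: 'c set)) * c0"
  shows "(\<integral>\<^sup>+ z. ennreal (indicator (box \<alpha> \<beta>) (fst z) * indicator {0..T} (snd z) *
       (snd z * (2 * \<kappa> * (sqrt (energy J1 (fst z) (snd z)) * sqrt (energy J2 (fst z) (snd z)))))) \<partial>(\<mu> \<Otimes>\<^sub>M lborel))
    \<le> ennreal ((\<integral>x. indicator (box \<alpha> \<beta>) x * b c x 0 \<partial>\<mu>)
        + Q * decay T * (\<Prod>l\<in>UNIV. \<integral>s. Z l s * (1 + Z l s) ^ N \<partial>M l)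
        + T\<^sup>2 * (\<Sum>i\<in>UNIV. Q * (\<Prod>l\<in>-{i}. \<integral>s. Z l s * (1 + Z l s) ^ N \<partial>M l) * (\<eta> i (\<alpha> i) + \<eta> i (\<beta> i))))"
proof -
  let ?ind = "\<lambda>z. indicator (box \<alpha> \<beta>) (fst z) * indicator {0..T} (snd z) :: real"
  have nt: "nice (\<lambda>x t. t)" by (rule nice_time) simp
  have n1: "nice (\<lambda>x t. t * btt c x t)" by (intro nice_mult nt nice_btt c)
  have n2: "nice (\<lambda>x t. t * Dx i c x t)" for i by (intro nice_mult nt nice_Dx c)
  note i1 = nice_integrable[OF n1 ab(1,2), of T] and i2 = nice_integrable[OF n2 ab(1,2), of T]
  have int: "integrable (\<mu> \<Otimes>\<^sub>M lborel) (\<lambda>z. ?ind z * (snd z * btt c (fst z) (snd z)) + (\<Sum>i\<in>UNIV. ?ind z * (snd z * Dx i c (fst z) (snd z))))"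
    using i1 i2 by (auto simp: split_beta')
  have pt: "?ind z * (snd z * (2 * \<kappa> * (sqrt (energy J1 (fst z) (snd z)) * sqrt (energy J2 (fst z) (snd z)))))
      \<le> ?ind z * (snd z * btt c (fst z) (snd z)) + (\<Sum>i\<in>UNIV. ?ind z * (snd z * Dx i c (fst z) (snd z)))" for z
  proof (cases "fst z \<in> box \<alpha> \<beta> \<and> snd z \<in> {0..T}")
    case True
    then have "snd z * (2 * \<kappa> * (sqrt (energy J1 (fst z) (snd z)) * sqrt (energy J2 (fst z) (snd z))))
       \<le> snd z * (btt c (fst z) (snd z) + (\<Sum>i\<in>UNIV. Dx i c (fst z) (snd z)))"
      using box_subset[OF ab(1,2)] by (intro mult_left_mono dissipation_pointwise c) auto
    with True show ?thesis by (simp add: distrib_left sum_distrib_left)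
  qed auto
  have pos: "0 \<le> ?ind z * (snd z * (2 * \<kappa> * (sqrt (energy J1 (fst z) (snd z)) * sqrt (energy J2 (fst z) (snd z)))))" for z
    using box_subset[OF ab(1,2)] kappa_nonneg energy_nonneg by (auto split: split_indicator intro!: mult_nonneg_nonneg)
  have "(\<integral>\<^sup>+ z. ennreal (?ind z * (snd z * (2 * \<kappa> * (sqrt (energy J1 (fst z) (snd z)) * sqrt (energy J2 (fst z) (snd z)))))) \<partial>(\<mu> \<Otimes>\<^sub>M lborel))
    \<le> (\<integral>\<^sup>+ z. ennreal (?ind z * (snd z * btt c (fst z) (snd z)) + (\<Sum>i\<in>UNIV. ?ind z * (snd z * Dx i c (fst z) (snd z)))) \<partial>(\<mu> \<Otimes>\<^sub>M lborel))"
    using pt by (intro nn_integral_mono ennreal_leI)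
  also have "\<dots> = ennreal (\<integral>z. ?ind z * (snd z * btt c (fst z) (snd z)) + (\<Sum>i\<in>UNIV. ?ind z * (snd z * Dx i c (fst z) (snd z))) \<partial>(\<mu> \<Otimes>\<^sub>M lborel))"
    using order.trans[OF pos pt] by (intro nn_integral_eq_integral int) auto
  also have "(\<integral>z. ?ind z * (snd z * btt c (fst z) (snd z)) + (\<Sum>i\<in>UNIV. ?ind z * (snd z * Dx i c (fst z) (snd z))) \<partial>(\<mu> \<Otimes>\<^sub>M lborel))
     = (\<integral>(x, t). indicator (box \<alpha> \<beta>) x * indicator {0..T} t * (t * btt c x t) \<partial>(\<mu> \<Otimes>\<^sub>M lborel))
       + (\<Sum>i\<in>UNIV. \<integral>(x, t). indicator (box \<alpha> \<beta>) x * indicator {0..T} t * (t * Dx i c x t) \<partial>(\<mu> \<Otimes>\<^sub>M lborel))"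
    using i1 i2 by (simp add: split_beta')
  also have "\<dots> \<le> ((\<integral>x. indicator (box \<alpha> \<beta>) x * b c x 0 \<partial>\<mu>)
        + Q * decay T * (\<Prod>l\<in>UNIV. \<integral>s. Z l s * (1 + Z l s) ^ N \<partial>M l))
      + (\<Sum>i\<in>UNIV. T\<^sup>2 * (Q * (\<Prod>l\<in>-{i}. \<integral>s. Z l s * (1 + Z l s) ^ N \<partial>M l) * (\<eta> i (\<alpha> i) + \<eta> i (\<beta> i))))"
  proof (intro add_mono sum_mono)
    have ib: "integrable \<mu> (\<lambda>x. indicator (box \<alpha> \<beta>) x * b c x 0)"
      by (intro nice_fixed_integrable nice_b c ab) auto
    have iH: "integrable \<mu> (\<lambda>x. Q * decay T * (\<Prod>l\<in>UNIV. Z l (x l) * (1 + Z l (x l)) ^ N))"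
      by (intro integrable_mult_right product_integrable_prod H_integrable) auto
    have iT: "integrable \<mu> (\<lambda>x. indicator (box \<alpha> \<beta>) x * (T * F1 c ht x T - b c x T + b c x 0))"
    proof -
      have "integrable \<mu> (\<lambda>x. T * (indicator (box \<alpha> \<beta>) x * F1 c ht x T) - indicator (box \<alpha> \<beta>) x * b c x T + indicator (box \<alpha> \<beta>) x * b c x 0)"
        by (intro Bochner_Integration.integrable_add Bochner_Integration.integrable_diff integrable_mult_right nice_fixed_integrable nice_b nice_F1 nice_ht c ab T) auto
      then show ?thesis by (simp add: algebra_simps)
    qed
    have "(\<integral>x. indicator (box \<alpha> \<beta>) x * (T * F1 c ht x T - b c x T + b c x 0) \<partial>\<mu>)
       \<le> (\<integral>x. indicator (box \<alpha> \<beta>) x * b c x 0 + Q * decay T * (\<Prod>l\<in>UNIV. Z l (x l) * (1 + Z l (x l)) ^ N) \<partial>\<mu>)"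
    proof (intro integral_mono iT Bochner_Integration.integrable_add ib iH)
      fix x
      have pr: "0 \<le> A * (\<Prod>l\<in>UNIV. (1 + Z l (x l)) ^ N)" using A by (intro mult_nonneg_nonneg prod_nonneg) (auto simp: Z_nonneg)
      have "T * \<bar>F1 c ht x T\<bar> \<le> T * (A * (\<Prod>l\<in>UNIV. (1 + Z l (x l)) ^ N) * (\<Sum>j\<in>UNIV. \<bar>ht j x T\<bar>))"
        using AN c T by (intro mult_left_mono) blast+
      also have "\<dots> = A * (\<Prod>l\<in>UNIV. (1 + Z l (x l)) ^ N) * (\<Sum>j\<in>UNIV. T * \<bar>ht j x T\<bar>)"
        by (simp add: sum_distrib_left[symmetric] mult_ac)
      also have "\<dots> \<le> A * (\<Prod>l\<in>UNIV. (1 + Z l (x l)) ^ N) * (\<Sum>j\<in>(UNIV :: 'c set). c0 * (decay T * (\<Prod>l\<in>UNIV. Z l (x l))))"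
        using pr by (intro mult_left_mono sum_mono ht_bound T)
      also have "\<dots> = Q * decay T * (\<Prod>l\<in>UNIV. Z l (x l) * (1 + Z l (x l)) ^ N)"
        unfolding Q_def prod.distrib by (simp add: mult_ac)
      finally have 1: "T * \<bar>F1 c ht x T\<bar> \<le> Q * decay T * (\<Prod>l\<in>UNIV. Z l (x l) * (1 + Z l (x l)) ^ N)" .
      have 2: "0 \<le> T * \<bar>F1 c ht x T\<bar>" using T by simp
      have 3: "T * F1 c ht x T \<le> T * \<bar>F1 c ht x T\<bar>" using T by (intro mult_left_mono) auto
      have 4: "0 \<le> b c x T" unfolding b_def by (intro nonneg sq_pos c)
      show "indicator (box \<alpha> \<beta>) x * (T * F1 c ht x T - b c x T + b c x 0)
        \<le> indicator (box \<alpha> \<beta>) x * b c x 0 + Q * decay T * (\<Prod>l\<in>UNIV. Z l (x l) * (1 + Z l (x l)) ^ N)"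
        using 1 2 3 4 by (cases "x \<in> box \<alpha> \<beta>") auto
    qed
    also have "\<dots> = (\<integral>x. indicator (box \<alpha> \<beta>) x * b c x 0 \<partial>\<mu>) + Q * decay T * (\<integral>x. (\<Prod>l\<in>UNIV. Z l (x l) * (1 + Z l (x l)) ^ N) \<partial>\<mu>)"
      using ib iH by simp
    also have "(\<integral>x. (\<Prod>l\<in>UNIV. Z l (x l) * (1 + Z l (x l)) ^ N) \<partial>\<mu>) = (\<Prod>l\<in>UNIV. \<integral>s. Z l s * (1 + Z l s) ^ N \<partial>M l)"
      by (intro product_integral_prod H_integrable) auto
    finally show "(\<integral>(x, t). indicator (box \<alpha> \<beta>) x * indicator {0..T} t * (t * btt c x t) \<partial>(\<mu> \<Otimes>\<^sub>M lborel))
      \<le> (\<integral>x. indicator (box \<alpha> \<beta>) x * b c x 0 \<partial>\<mu>) + Q * decay T * (\<Prod>l\<in>UNIV. \<integral>s. Z l s * (1 + Z l s) ^ N \<partial>M l)"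
      unfolding time_identity[OF c(1) ab(1,2) T] .
  next
    fix i
    define B where "B = Q * (\<Prod>l\<in>-{i}. \<integral>s. Z l s * (1 + Z l s) ^ N \<partial>M l) * (\<eta> i (\<alpha> i) + \<eta> i (\<beta> i))"
    have sb: "\<bar>\<integral>x. indicator (box \<alpha> \<beta>) x * Dx i c x t \<partial>\<mu>\<bar> \<le> B" if "0 \<le> t" for t
      unfolding B_def Q_def \<eta>_def by (rule slice_bound[OF AN A c that ab])
    have B0: "0 \<le> B" using sb[of 0] by linarith
    have "(\<integral>(x, t). indicator (box \<alpha> \<beta>) x * indicator {0..T} t * (t * Dx i c x t) \<partial>(\<mu> \<Otimes>\<^sub>M lborel))
       = (\<integral>t. (\<integral>x. indicator (box \<alpha> \<beta>) x * indicator {0..T} t * (t * Dx i c x t) \<partial>\<mu>) \<partial>lborel)"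
      using integral_snd[OF i2] by simp
    also have "\<dots> = (\<integral>t. indicator {0..T} t * t * (\<integral>x. indicator (box \<alpha> \<beta>) x * Dx i c x t \<partial>\<mu>) \<partial>lborel)"
      by (intro Bochner_Integration.integral_cong refl) (simp flip: integral_mult_right_zero add: mult_ac)
    also have "\<dots> \<le> \<bar>\<dots>\<bar>" by simp
    also have "\<dots> \<le> (\<integral>t. indicator {0..T} t * (T * B) \<partial>lborel)"
    proof (rule abs_integral_le)
      fix t :: real
      show "\<bar>indicator {0..T} t * t * (\<integral>x. indicator (box \<alpha> \<beta>) x * Dx i c x t \<partial>\<mu>)\<bar> \<le> indicator {0..T} t * (T * B)"
        using sb[of t] T by (auto simp: abs_mult split: split_indicator intro!: mult_mono)
      show "integrable lborel (\<lambda>t :: real. indicator {0..T} t * (T * B))"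
        by (intro integrable_mult_left integrable_real_indicator) (auto simp: emeasure_lborel_Icc_eq)
    qed
    also have "\<dots> = T\<^sup>2 * B" using T by (simp add: power2_eq_square)
    finally show "(\<integral>(x, t). indicator (box \<alpha> \<beta>) x * indicator {0..T} t * (t * Dx i c x t) \<partial>(\<mu> \<Otimes>\<^sub>M lborel))
      \<le> T\<^sup>2 * (Q * (\<Prod>l\<in>-{i}. \<integral>s. Z l s * (1 + Z l s) ^ N \<partial>M l) * (\<eta> i (\<alpha> i) + \<eta> i (\<beta> i)))"
      unfolding B_def .
  qed
  finally show ?thesis by (simp add: sum_distrib_left ennreal_leI)
qed

end

section \<open>Removal of the regularisation and of the cut-offs\<close>

lemma interval_exhaustion:
  fixes I :: "real set"
  assumes I: "open I" "I \<noteq> {}"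
  obtains a b :: "nat \<Rightarrow> real"
  where "\<And>n. a n \<in> I" "\<And>n. b n \<in> I" "\<And>n. a n \<le> b n" "decseq a" "incseq b"
    "\<And>x. x \<in> I \<Longrightarrow> \<exists>n. a n \<le> x \<and> x \<le> b n"
proof -
  obtain x0 where x0: "x0 \<in> I" using I by blast
  obtain C where C: "\<And>n. compact (C n)" "\<And>n. C n \<subseteq> I" "\<And>n. C n \<subseteq> interior (C (Suc n))" "\<Union>(range C) = I"
    using open_Union_compact_subsets[OF I(1)] by metis
  \<comment> \<open>\<open>x0\<close> makes every set of the exhaustion non-empty, so that its
    infimum and supremum are attained in \<open>I\<close>.\<close>
  define D where "D n = insert x0 (C n)" for n :: nat
  have D: "compact (D n)" "D n \<subseteq> I" "D n \<noteq> {}" for n using C x0 by (auto simp: D_def)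
  have b: "bdd_below (D n)" "bdd_above (D n)" for n
    using bounded_imp_bdd_below bounded_imp_bdd_above compact_imp_bounded[OF D(1)] by auto
  have DS: "D n \<subseteq> D (Suc n)" for n using C(3)[of n] interior_subset[of "C (Suc n)"] by (auto simp: D_def)
  show ?thesis
  proof (rule that[of "\<lambda>n. Inf (D n)" "\<lambda>n. Sup (D n)"])
    show "Inf (D n) \<in> I" "Sup (D n) \<in> I" for n
      using closed_contains_Inf[OF D(3) b(1) compact_imp_closed[OF D(1)]]
        closed_contains_Sup[OF D(3) b(2) compact_imp_closed[OF D(1)]] D(2) by blast+
    show "Inf (D n) \<le> Sup (D n)" for n by (rule cInf_le_cSup[OF D(3) b(2,1)])
    show "decseq (\<lambda>n. Inf (D n))" by (intro decseq_SucI cInf_superset_mono D b DS)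
    show "incseq (\<lambda>n. Sup (D n))" by (intro incseq_SucI cSup_subset_mono D b DS)
    fix x assume "x \<in> I"
    then obtain n where "x \<in> D n" using C(4) by (auto simp: D_def)
    then show "\<exists>n. Inf (D n) \<le> x \<and> x \<le> Sup (D n)" using b cInf_lower cSup_upper by blast
  qed
qed

context tensor_system
begin

text \<open>A single \<open>r i\<close> may be negative; it is the sum over all variables that is
  not. Freezing the other variables at one point bounds \<open>r i\<close> below by a
  constant.\<close>

lemma V_lower: "\<exists>c. \<forall>s\<in>I i. - c \<le> V j i s"
proof -
  have "\<forall>l. \<exists>y. y \<in> I l" using I(3) by blast
  from choice[OF this] obtain x where x: "\<And>l. x l \<in> I l" by blast
  have "- (\<Sum>l\<in>-{i}. r l (x l)) \<le> V j i s" if s: "s \<in> I i" for s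
  proof -
    have "0 \<le> (\<Sum>l\<in>UNIV. r l ((x(i := s)) l))" using x s by (intro r_nonneg) auto
    also have "\<dots> = r i s + (\<Sum>l\<in>-{i}. r l ((x(i := s)) l))"
      by (subst sum.remove[of _ i]) (auto simp: Compl_eq_Diff_UNIV)
    also have "(\<Sum>l\<in>-{i}. r l ((x(i := s)) l)) = (\<Sum>l\<in>-{i}. r l (x l))" by (intro sum.cong) auto
    finally show ?thesis using V_ge[OF s, of j] by linarith
  qed
  then show ?thesis by blast
qed

lemma energy_finite:
  "\<exists>C. \<forall>x\<in>I i. \<forall>y\<in>I i. x \<le> y \<longrightarrow> integral {x..y} (\<lambda>s. (pp i s)\<^sup>2 * w i s * (d\<theta> j i k s)\<^sup>2) \<le> C"
proof -
  obtain c where c: "\<forall>s\<in>I i. - c \<le> V j i s" using V_lower by blast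
  have c\<theta>: "continuous_on (I i) (\<theta> j i k)"
    using deriv[of _ i j k] by (intro continuous_at_imp_continuous_on ballI DERIV_isCont) blast
  have m2: "integrable (M i) (\<lambda>s. (\<theta> j i k s)\<^sup>2)" using moments[of 2 i j k] by simp
  \<comment> \<open>The boundary term of the energy identity is dominated by the decaying quantity
    with exponent 1.\<close>
  have van: "\<bar>(pp i s)\<^sup>2 * w i s * d\<theta> j i k s * \<theta> j i k s\<bar> \<le> \<bar>(pp i s)\<^sup>2 * w i s * (1 + \<bar>\<theta> j i k s\<bar> ^ 1) * d\<theta> j i k s\<bar>" for s
  proof -
    have "\<bar>(pp i s)\<^sup>2 * w i s * d\<theta> j i k s\<bar> * \<bar>\<theta> j i k s\<bar> \<le> \<bar>(pp i s)\<^sup>2 * w i s * d\<theta> j i k s\<bar> * (1 + \<bar>\<theta> j i k s\<bar>)"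
      by (intro mult_left_mono) auto
    then show ?thesis by (simp add: abs_mult mult_ac)
  qed
  show ?thesis
  proof (rule energy_bound[OF I(2) deriv flux _ w_cont V_cont d_cont])
    show "continuous_on (I i) (\<lambda>s. (pp i s)\<^sup>2 * w i s)" by (intro continuous_intros pp_cont w_cont)
    show "- c \<le> V j i s" if "s \<in> I i" for s using c that by blast
    show "0 \<le> w i s" if "s \<in> I i" for s using w_pos[OF that] by simp
    show "integral {x..y} (\<lambda>s. w i s * (\<theta> j i k s)\<^sup>2) \<le> (\<integral>s. (\<theta> j i k s)\<^sup>2 \<partial>M i)" if xy: "x \<in> I i" "y \<in> I i" "x \<le> y" for x y
    proof -
      have sub: "{x..y} \<subseteq> I i" by (rule is_interval_Icc_subset[OF I(2) xy(1,2)])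
      have cm: "(\<lambda>s. (\<theta> j i k s)\<^sup>2) \<in> borel_measurable (M i)" by (intro cont_measurable continuous_intros c\<theta>)
      have cont: "continuous_on {x..y} (\<lambda>s. w i s * (\<theta> j i k s)\<^sup>2)"
        by (rule continuous_on_subset[OF _ sub]) (intro continuous_intros w_cont c\<theta>)
      have "integral {x..y} (\<lambda>s. w i s * (\<theta> j i k s)\<^sup>2) = (LINT s:{x..y}|lborel. w i s * (\<theta> j i k s)\<^sup>2)"
        using borel_integrable_atLeastAtMost'[OF cont] by (intro set_borel_integral_eq_integral(2)[symmetric])
      also have "\<dots> = (\<integral>s. (w i s * (\<theta> j i k s)\<^sup>2) * indicator {x..y} s \<partial>lborel)"
        by (simp add: set_lebesgue_integral_def mult.commute)
      also have "\<dots> = (\<integral>s. indicator {x..y} s * (\<theta> j i k s)\<^sup>2 \<partial>M i)"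
        by (rule integral_M[OF cm sub, symmetric])
      also have "\<dots> \<le> \<bar>\<dots>\<bar>" by simp
      also have "\<dots> \<le> (\<integral>s. (\<theta> j i k s)\<^sup>2 \<partial>M i)"
        by (rule abs_integral_le[OF m2]) (auto split: split_indicator)
      finally show ?thesis .
    qed
    show "vanishes_left (I i) (\<lambda>s. (pp i s)\<^sup>2 * w i s * d\<theta> j i k s * \<theta> j i k s)"
      using decay_left[of i j k 1] van unfolding vanishes_left_def by (meson order.strict_trans1)
    show "vanishes_right (I i) (\<lambda>s. (pp i s)\<^sup>2 * w i s * d\<theta> j i k s * \<theta> j i k s)"
      using decay_right[of i j k 1] van unfolding vanishes_right_def by (meson order.strict_trans1)
  qed
qed

end

context bellman_flow
begin

text \<open>The end-point lemmas are used with pairs of a component and a multi-index of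
  \<open>S\<close> as index, so that one position of the face serves all terms of \<open>Z\<close>
  and \<open>dZ\<close> at once.\<close>

lemma small_flux_ends:
  assumes e: "e > 0" and c: "c \<in> I i"
  shows "\<exists>s\<in>I i. c < s \<and> (pp i s)\<^sup>2 * w i s * dZ i s * (1 + Z i s) ^ N < e"
    "\<exists>s\<in>I i. s < c \<and> (pp i s)\<^sup>2 * w i s * dZ i s * (1 + Z i s) ^ N < e"
proof -
  have P: "0 < (pp i s)\<^sup>2 * w i s" if "s \<in> I i" for s using w_pos[OF that] pp_nz[OF that] by simp
  have Pc: "continuous_on (I i) (\<lambda>s. (pp i s)\<^sup>2 * w i s)" by (intro continuous_intros pp_cont w_cont)
  have fin: "finite ((UNIV :: 'c set) \<times> S)" using finite_S by simp
  show "\<exists>s\<in>I i. c < s \<and> (pp i s)\<^sup>2 * w i s * dZ i s * (1 + Z i s) ^ N < e"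
    "\<exists>s\<in>I i. s < c \<and> (pp i s)\<^sup>2 * w i s * dZ i s * (1 + Z i s) ^ N < e"
    unfolding Z_def dZ_def
    by (rule flux_liminf_right[where \<theta> = "\<lambda>m. \<theta> (fst m) i (snd m i)" and d\<theta> = "\<lambda>m. d\<theta> (fst m) i (snd m i)",
          OF I(1) I(2) I(3) fin P Pc deriv d_cont energy_finite decay_right e c]; assumption)
       (rule flux_liminf_left[where \<theta> = "\<lambda>m. \<theta> (fst m) i (snd m i)" and d\<theta> = "\<lambda>m. d\<theta> (fst m) i (snd m i)",
          OF I(1) I(2) I(3) fin P Pc deriv d_cont energy_finite decay_left e c]; assumption)
qed

text \<open>Dominated convergence with the case \<open>c = 1\<close> as majorant. The box stays
  fixed because a positive \<open>c\<close> contributes a constant, which may fail to be integrable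
  over all of \<open>XX\<close>; \<open>L\<close> and \<open>R\<close> do not involve
  \<open>c\<close>.\<close>

lemma box_limit:
  assumes le: "\<And>c. 0 < c \<Longrightarrow> c \<le> 1 \<Longrightarrow> L \<le> ennreal ((\<integral>x. indicator (box \<alpha> \<beta>) x * b c x 0 \<partial>\<mu>) + R)"
    and R: "0 \<le> R" and ab: "\<alpha> \<in> XX" "\<beta> \<in> XX"
    and upper: "\<And>X Y. X > 0 \<Longrightarrow> Y > 0 \<Longrightarrow> \<Phi> X Y \<le> G * (X powr p1 + Y powr p2)" and G: "0 \<le> G"
    and p: "0 < p1" "0 < p2"
  shows "L \<le> (\<integral>\<^sup>+x. ennreal (G * ((\<Sum>j\<in>J1. (h j x 0)\<^sup>2) powr p1 + (\<Sum>j\<in>J2. (h j x 0)\<^sup>2) powr p2)) \<partial>\<mu>) + ennreal R"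
proof -
  define g where "g c x = indicator (box \<alpha> \<beta>) x * (G * (sq J1 c x 0 powr p1 + sq J2 c x 0 powr p2))" for c x
  have gm: "(\<lambda>x. g c x) \<in> borel_measurable \<mu>" for c
  proof -
    have "(\<lambda>x. sq J c x 0) \<in> borel_measurable \<mu>" for J by (rule nice_fixed_measurable[OF nice_sq])
    then show ?thesis unfolding g_def using box_sets[OF ab] by simp
  qed
  have int1: "integrable \<mu> (g 1)"
  proof -
    have "nice (\<lambda>x t. G * (sq J1 1 x t powr p1 + sq J2 1 x t powr p2))"
    proof (rule nice_compose2[OF nice_sq nice_sq, where \<Psi> = "\<lambda>X Y. G * (X powr p1 + Y powr p2)"])
      show "continuous_on ({0<..} \<times> {0<..}) (\<lambda>z :: real \<times> real. G * (fst z powr p1 + snd z powr p2))"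
        by (intro continuous_intros) auto
    qed (use sq_pos[of 1] in auto)
    from nice_fixed_integrable[OF this ab, of 0] show ?thesis by (simp add: g_def[abs_def])
  qed
  define cn where "cn n = inverse (real (Suc n))" for n
  have cn: "0 < cn n" "cn n \<le> 1" for n by (auto simp: cn_def field_simps)
  have cn0: "cn \<longlonglongrightarrow> 0" unfolding cn_def by (rule LIMSEQ_inverse_real_of_nat)
  have S0: "0 \<le> (\<Sum>j\<in>J. (h j x 0)\<^sup>2)" for J x by (intro sum_nonneg) auto
  have mono: "0 \<le> g (cn n) x \<and> g (cn n) x \<le> g 1 x" for n x
    unfolding g_def sq_def using cn[of n] G p S0
    by (auto split: split_indicator intro!: mult_nonneg_nonneg add_nonneg_nonneg mult_left_mono add_mono powr_mono2)
  have lim: "(\<lambda>n. \<integral>x. g (cn n) x \<partial>\<mu>) \<longlonglongrightarrow> (\<integral>x. g 0 x \<partial>\<mu>)"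
    and int0: "integrable \<mu> (g 0)" and intn: "integrable \<mu> (g (cn n))" for n
  proof -
    have ae: "AE x in \<mu>. (\<lambda>n. g (cn n) x) \<longlonglongrightarrow> g 0 x"
    proof (rule AE_I2)
      fix x
      have pw: "(\<lambda>n. (cn n + (\<Sum>j\<in>J. (h j x 0)\<^sup>2)) powr a) \<longlonglongrightarrow> (0 + (\<Sum>j\<in>J. (h j x 0)\<^sup>2)) powr a" if "0 < a" for J a
        using that cn S0 by (intro tendsto_powr' tendsto_add cn0 tendsto_const) (auto intro!: always_eventually add_nonneg_nonneg less_imp_le)
      show "(\<lambda>n. g (cn n) x) \<longlonglongrightarrow> g 0 x" unfolding g_def sq_def by (intro tendsto_mult tendsto_add tendsto_const pw p)
    qed
    note dc = integral_dominated_convergence[where s = "\<lambda>n. g (cn n)" and f = "g 0" and w = "g 1" and M = \<mu>,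
        OF gm gm int1 ae] integrable_dominated_convergence[where s = "\<lambda>n. g (cn n)" and f = "g 0" and w = "g 1" and M = \<mu>,
        OF gm gm int1 ae] integrable_dominated_convergence2[where s = "\<lambda>n. g (cn n)" and f = "g 0" and w = "g 1" and M = \<mu>,
        OF gm gm int1 ae]
    show "(\<lambda>n. \<integral>x. g (cn n) x \<partial>\<mu>) \<longlonglongrightarrow> (\<integral>x. g 0 x \<partial>\<mu>)" "integrable \<mu> (g 0)" "integrable \<mu> (g (cn n))"
      using mono by (intro dc AE_I2; simp)+
  qed
  have "L \<le> ennreal ((\<integral>x. g (cn n) x \<partial>\<mu>) + R)" for n
  proof -
    have "(\<integral>x. indicator (box \<alpha> \<beta>) x * b (cn n) x 0 \<partial>\<mu>) \<le> (\<integral>x. g (cn n) x \<partial>\<mu>)"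
    proof (rule integral_mono[OF nice_fixed_integrable[OF nice_b[OF cn(1)] ab order_refl] intn])
      fix x show "indicator (box \<alpha> \<beta>) x * b (cn n) x 0 \<le> g (cn n) x"
        unfolding g_def b_def by (intro mult_left_mono upper sq_pos cn) auto
    qed
    then show ?thesis by (intro order.trans[OF le[OF cn]] ennreal_leI) simp
  qed
  moreover have "(\<lambda>n. ennreal ((\<integral>x. g (cn n) x \<partial>\<mu>) + R)) \<longlonglongrightarrow> ennreal ((\<integral>x. g 0 x \<partial>\<mu>) + R)"
    by (intro tendsto_ennrealI tendsto_add lim tendsto_const)
  ultimately have "L \<le> ennreal ((\<integral>x. g 0 x \<partial>\<mu>) + R)" by (intro LIMSEQ_le_const) auto
  also have g0: "0 \<le> g 0 x" for x
    unfolding g_def sq_def using G by (auto split: split_indicator intro!: mult_nonneg_nonneg add_nonneg_nonneg)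
  then have "ennreal ((\<integral>x. g 0 x \<partial>\<mu>) + R) = (\<integral>\<^sup>+x. ennreal (g 0 x) \<partial>\<mu>) + ennreal R"
    using R int0 by (simp add: ennreal_plus nn_integral_eq_integral)
  also have "(\<integral>\<^sup>+x. ennreal (g 0 x) \<partial>\<mu>) \<le> (\<integral>\<^sup>+x. ennreal (G * ((\<Sum>j\<in>J1. (h j x 0)\<^sup>2) powr p1 + (\<Sum>j\<in>J2. (h j x 0)\<^sup>2) powr p2)) \<partial>\<mu>)"
    using G by (intro nn_integral_mono ennreal_leI) (auto simp: g_def sq_def split: split_indicator intro!: mult_nonneg_nonneg add_nonneg_nonneg)
  finally show ?thesis by (simp add: add_right_mono)
qed

theorem bilinear_bound:
  assumes upper: "\<And>X Y. X > 0 \<Longrightarrow> Y > 0 \<Longrightarrow> \<Phi> X Y \<le> G * (X powr p1 + Y powr p2)" and G: "0 \<le> G"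
    and p: "0 < p1" "0 < p2"
  shows "(\<integral>\<^sup>+ z. ennreal (indicator {0<..} (snd z) *
       (snd z * (2 * \<kappa> * (sqrt (energy J1 (fst z) (snd z)) * sqrt (energy J2 (fst z) (snd z)))))) \<partial>(\<mu> \<Otimes>\<^sub>M lborel))
    \<le> (\<integral>\<^sup>+x. ennreal (G * ((\<Sum>j\<in>J1. (h j x 0)\<^sup>2) powr p1 + (\<Sum>j\<in>J2. (h j x 0)\<^sup>2) powr p2)) \<partial>\<mu>)"
    (is "?L \<le> ?R")
proof -
  obtain A N where A: "0 \<le> A" and AN: "\<forall>c \<omega> x t. 0 < c \<longrightarrow> c \<le> 1 \<longrightarrow> 0 \<le> t \<longrightarrow>
     \<bar>F1 c \<omega> x t\<bar> \<le> A * (\<Prod>l\<in>UNIV. (1 + Z l (x l)) ^ N) * (\<Sum>j\<in>UNIV. \<bar>\<omega> j x t\<bar>)"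
    using F1_bound by blast
  define Q where "Q = A * real (card (UNIV :: 'c set)) * c0"
  define \<eta> where "\<eta> i s = (pp i s)\<^sup>2 * w i s * dZ i s * (1 + Z i s) ^ N" for i s
  define HH where "HH = (\<Prod>l\<in>UNIV. \<integral>s. Z l s * (1 + Z l s) ^ N \<partial>M l)"
  define Hi where "Hi i = Q * (\<Prod>l\<in>-{i}. \<integral>s. Z l s * (1 + Z l s) ^ N \<partial>M l)" for i
  have H0: "0 \<le> (\<integral>s. Z l s * (1 + Z l s) ^ N \<partial>M l)" for l
    by (intro Bochner_Integration.integral_nonneg mult_nonneg_nonneg) (auto simp: Z_nonneg)
  have Q0: "0 \<le> Q" using A c0_nonneg by (simp add: Q_def)
  have HH0: "0 \<le> HH" unfolding HH_def by (intro prod_nonneg H0)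
  have Hi0: "0 \<le> Hi i" for i unfolding Hi_def by (intro mult_nonneg_nonneg prod_nonneg Q0 H0)
  define f where "f z = snd z * (2 * \<kappa> * (sqrt (energy J1 (fst z) (snd z)) * sqrt (energy J2 (fst z) (snd z))))" for z
  note E0 = energy_nonneg
  have decay0: "0 \<le> decay T" if "0 \<le> T" for T
    unfolding decay_def using that freq_nonneg by (intro sum_nonneg) auto
  \<comment> \<open>Fluxes are known to be small only at some faces beyond any given ones. As the
    integrand is non-negative, the given box may be enlarged to such faces.\<close>
  have base: "(\<integral>\<^sup>+ z. ennreal (indicator (box a' b') (fst z) * indicator {0..T} (snd z) * f z) \<partial>(\<mu> \<Otimes>\<^sub>M lborel)) \<le> ?R + ennreal (Q * decay T * HH)"
    if ab': "a' \<in> XX" "b' \<in> XX" "\<And>i. a' i \<le> b' i" and T: "0 \<le> T" for a' b' T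
  proof (rule ennreal_le_epsilon)
    fix e :: real assume e: "0 < e"
    \<comment> \<open>2 accounts for the two faces in each direction; the added ones keep the
      denominator positive while it still dominates the coefficients of the face terms.\<close>
    define e' where "e' = e / (2 * (T\<^sup>2 + 1) * ((\<Sum>i\<in>UNIV. Hi i) + 1))"
    have sH: "0 \<le> (\<Sum>i\<in>UNIV. Hi i)" by (intro sum_nonneg Hi0)
    have e': "0 < e'" using e sH by (auto simp: e'_def intro!: divide_pos_pos mult_pos_pos add_nonneg_pos)
    have "\<exists>\<alpha>. \<forall>i. \<alpha> i \<in> I i \<and> \<alpha> i < a' i \<and> \<eta> i (\<alpha> i) < e'"
      using small_flux_ends(2)[OF e'] ab' unfolding \<eta>_def XX_def by (intro choice) blast
    then obtain \<alpha> where \<alpha>: "\<And>i. \<alpha> i \<in> I i" "\<And>i. \<alpha> i < a' i" "\<And>i. \<eta> i (\<alpha> i) < e'" by blast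
    have "\<exists>\<beta>. \<forall>i. \<beta> i \<in> I i \<and> b' i < \<beta> i \<and> \<eta> i (\<beta> i) < e'"
      using small_flux_ends(1)[OF e'] ab' unfolding \<eta>_def XX_def by (intro choice) blast
    then obtain \<beta> where \<beta>: "\<And>i. \<beta> i \<in> I i" "\<And>i. b' i < \<beta> i" "\<And>i. \<eta> i (\<beta> i) < e'" by blast
    have "\<alpha> i \<le> \<beta> i" for i using \<alpha>(2)[of i] \<beta>(2)[of i] ab'(3)[of i] by linarith
    then have ab: "\<alpha> \<in> XX" "\<beta> \<in> XX" "\<And>i. \<alpha> i \<le> \<beta> i"
      using \<alpha>(1) \<beta>(1) by (auto simp: XX_def)
    have "\<alpha> i \<le> x i \<and> x i \<le> \<beta> i" if "x \<in> box a' b'" for x i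
      using \<alpha>(2)[of i] \<beta>(2)[of i] that[unfolded mem_box, rule_format, of i] by linarith
    then have sub: "box a' b' \<subseteq> box \<alpha> \<beta>" by (intro subsetI) (simp add: mem_box)
    define R where "R = Q * decay T * HH + T\<^sup>2 * (\<Sum>i\<in>UNIV. Hi i * (\<eta> i (\<alpha> i) + \<eta> i (\<beta> i)))"
    have \<eta>0: "0 \<le> \<eta> i s" if "s \<in> I i" for i s
      unfolding \<eta>_def using w_pos[OF that] dZ_nonneg Z_nonneg by (intro mult_nonneg_nonneg) auto
    have R0: "0 \<le> R" unfolding R_def
      by (intro add_nonneg_nonneg mult_nonneg_nonneg sum_nonneg Q0 HH0 Hi0 decay0 T \<eta>0 \<alpha> \<beta>) auto
    have "R \<le> Q * decay T * HH + T\<^sup>2 * (\<Sum>i\<in>UNIV. Hi i * (2 * e'))"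
    proof -
      have "\<eta> i (\<alpha> i) + \<eta> i (\<beta> i) \<le> 2 * e'" for i using \<alpha>(3)[of i] \<beta>(3)[of i] by linarith
      then show ?thesis unfolding R_def by (intro add_left_mono mult_left_mono sum_mono Hi0) auto
    qed
    also have "T\<^sup>2 * (\<Sum>i\<in>UNIV. Hi i * (2 * e')) = (T\<^sup>2 * (\<Sum>i\<in>UNIV. Hi i)) * (2 * e')"
      by (simp add: sum_distrib_right[symmetric])
    also have "\<dots> \<le> ((T\<^sup>2 + 1) * ((\<Sum>i\<in>UNIV. Hi i) + 1)) * (2 * e')"
      using sH e' by (intro mult_right_mono mult_mono) auto
    also have "\<dots> = e"
    proof -
      have "x * y * (2 * (e / (2 * x * y))) = e" if "x > 0" "y > 0" for x y using that by simp
      moreover have "T\<^sup>2 + 1 > 0" "(\<Sum>i\<in>UNIV. Hi i) + 1 > 0" using sH by (auto intro: add_nonneg_pos)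
      ultimately show ?thesis unfolding e'_def by blast
    qed
    finally have Re: "R \<le> Q * decay T * HH + e" by simp
    have "(\<integral>\<^sup>+ z. ennreal (indicator (box a' b') (fst z) * indicator {0..T} (snd z) * f z) \<partial>(\<mu> \<Otimes>\<^sub>M lborel))
       \<le> (\<integral>\<^sup>+ z. ennreal (indicator (box \<alpha> \<beta>) (fst z) * indicator {0..T} (snd z) * f z) \<partial>(\<mu> \<Otimes>\<^sub>M lborel))"
      using sub box_subset[OF ab(1,2)] E0 kappa_nonneg unfolding f_def
      by (intro nn_integral_mono ennreal_leI) (auto split: split_indicator intro!: mult_nonneg_nonneg)
    also have "\<dots> \<le> ?R + ennreal R"
    proof (rule box_limit[OF _ R0 ab(1,2) upper G p])
      fix c :: real assume c: "0 < c" "c \<le> 1"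
      show "(\<integral>\<^sup>+ z. ennreal (indicator (box \<alpha> \<beta>) (fst z) * indicator {0..T} (snd z) * f z) \<partial>(\<mu> \<Otimes>\<^sub>M lborel))
        \<le> ennreal ((\<integral>x. indicator (box \<alpha> \<beta>) x * b c x 0 \<partial>\<mu>) + R)"
        using box_inequality[OF AN A c T ab]
        unfolding f_def R_def Q_def[symmetric] HH_def Hi_def \<eta>_def by (simp add: add.assoc)
    qed
    also have "\<dots> \<le> ?R + ennreal (Q * decay T * HH + e)" by (intro add_left_mono ennreal_leI Re)
    also have "\<dots> = ?R + ennreal (Q * decay T * HH) + ennreal e"
      using e Q0 HH0 decay0[OF T] by (subst ennreal_plus) (auto simp: add.assoc)
    finally show "(\<integral>\<^sup>+ z. ennreal (indicator (box a' b') (fst z) * indicator {0..T} (snd z) * f z) \<partial>(\<mu> \<Otimes>\<^sub>M lborel))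
      \<le> ?R + ennreal (Q * decay T * HH) + ennreal e" .
  qed
  have "\<forall>i. \<exists>u :: (nat \<Rightarrow> real) \<times> (nat \<Rightarrow> real). (\<forall>n. fst u n \<in> I i) \<and> (\<forall>n. snd u n \<in> I i) \<and> (\<forall>n. fst u n \<le> snd u n)
     \<and> decseq (fst u) \<and> incseq (snd u) \<and> (\<forall>x\<in>I i. \<exists>n. fst u n \<le> x \<and> x \<le> snd u n)"
  proof
    fix i
    obtain a b :: "nat \<Rightarrow> real" where "\<And>n. a n \<in> I i" "\<And>n. b n \<in> I i" "\<And>n. a n \<le> b n" "decseq a" "incseq b"
      "\<And>x. x \<in> I i \<Longrightarrow> \<exists>n. a n \<le> x \<and> x \<le> b n"
      using interval_exhaustion[OF I(1) I(3)] by blast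
    then show "\<exists>u :: (nat \<Rightarrow> real) \<times> (nat \<Rightarrow> real). (\<forall>n. fst u n \<in> I i) \<and> (\<forall>n. snd u n \<in> I i) \<and> (\<forall>n. fst u n \<le> snd u n)
     \<and> decseq (fst u) \<and> incseq (snd u) \<and> (\<forall>x\<in>I i. \<exists>n. fst u n \<le> x \<and> x \<le> snd u n)"
      by (intro exI[of _ "(a, b)"]) simp
  qed
  from choice[OF this] obtain u where u: "\<forall>i. (\<forall>n. fst (u i) n \<in> I i) \<and> (\<forall>n. snd (u i) n \<in> I i) \<and> (\<forall>n. fst (u i) n \<le> snd (u i) n)
     \<and> decseq (fst (u i)) \<and> incseq (snd (u i)) \<and> (\<forall>x\<in>I i. \<exists>n. fst (u i) n \<le> x \<and> x \<le> snd (u i) n)" ..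
  define a' where "a' i = fst (u i)" for i
  define b' where "b' i = snd (u i)" for i
  have ab': "\<And>i n. a' i n \<in> I i" "\<And>i n. b' i n \<in> I i" "\<And>i n. a' i n \<le> b' i n"
    "\<And>i. decseq (a' i)" "\<And>i. incseq (b' i)" "\<And>i x. x \<in> I i \<Longrightarrow> \<exists>n. a' i n \<le> x \<and> x \<le> b' i n"
    using u unfolding a'_def b'_def by blast+
  define bx where "bx n = box (\<lambda>i. a' i n) (\<lambda>i. b' i n)" for n
  have bx_mono: "bx m \<subseteq> bx n" if "m \<le> n" for m n
  proof
    fix x assume x: "x \<in> bx m"
    have "a' i n \<le> x i \<and> x i \<le> b' i n" for i
      using decseqD[OF ab'(4)[of i] that] incseqD[OF ab'(5)[of i] that] x[unfolded bx_def mem_box, rule_format, of i] by linarith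
    then show "x \<in> bx n" unfolding bx_def mem_box by blast
  qed
  have bx_XX: "bx n \<subseteq> XX" for n unfolding bx_def by (intro box_subset) (auto simp: XX_def ab')
  have bx_cover: "\<exists>n. x \<in> bx n" if "x \<in> XX" for x
  proof -
    have "\<forall>i. \<exists>n. a' i n \<le> x i \<and> x i \<le> b' i n" using ab'(6) that unfolding XX_def by blast
    from choice[OF this] obtain m where m: "\<And>i. a' i (m i) \<le> x i \<and> x i \<le> b' i (m i)" by blast
    define n where "n = Max (range m)"
    have mn: "m i \<le> n" for i unfolding n_def by (intro Max_ge) auto
    have "a' i n \<le> x i \<and> x i \<le> b' i n" for i
      using m[of i] decseqD[OF ab'(4)[of i] mn[of i]] incseqD[OF ab'(5)[of i] mn[of i]] by linarith
    then show ?thesis unfolding bx_def mem_box by blast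
  qed
  \<comment> \<open>The \<open>n\<close>-th box is paired with the time cut-off \<open>n\<close>, so
    one monotone convergence removes both.\<close>
  define v where "v n z = ennreal (indicator (bx n) (fst z) * indicator {0..real n} (snd z) * f z)" for n z
  have f0: "0 \<le> indicator (bx n) (fst z) * indicator {0..real n} (snd z) * f z" for n z
    using bx_XX[of n] E0 kappa_nonneg unfolding f_def by (auto split: split_indicator intro!: mult_nonneg_nonneg)
  have fm: "f \<in> borel_measurable (\<mu> \<Otimes>\<^sub>M lborel)"
  proof -
    have "nice (\<lambda>x t. f (x, t))" unfolding f_def fst_conv snd_conv
      by (intro nice_mult nice_const nice_sqrt nice_energy nice_time continuous_intros)
    then show ?thesis by (simp add: nice_def)
  qed
  have um: "v n \<in> borel_measurable (\<mu> \<Otimes>\<^sub>M lborel)" for n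
  proof -
    have [measurable]: "bx n \<in> sets \<mu>" unfolding bx_def by (intro box_sets) (auto simp: XX_def ab')
    note fm[measurable]
    show ?thesis unfolding v_def by measurable
  qed
  have inc: "incseq v"
  proof (intro incseq_SucI le_funI)
    fix n and z :: "('n \<Rightarrow> real) \<times> real"
    have "fst z \<in> bx (Suc n)" if "fst z \<in> bx n" using bx_mono[of n "Suc n"] that by auto
    then show "v n z \<le> v (Suc n) z"
      unfolding v_def using f0[of "Suc n" z] by (intro ennreal_leI) (auto split: split_indicator)
  qed
  have "?L \<le> (\<integral>\<^sup>+z. (SUP n. v n z) \<partial>(\<mu> \<Otimes>\<^sub>M lborel))"
  proof (intro nn_integral_mono)
    fix z :: "('n \<Rightarrow> real) \<times> real" assume "z \<in> space (\<mu> \<Otimes>\<^sub>M lborel)"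
    then have x: "fst z \<in> XX" by (auto simp: space_pair_measure space_mu)
    show "ennreal (indicator {0<..} (snd z) * (snd z * (2 * \<kappa> * (sqrt (energy J1 (fst z) (snd z)) * sqrt (energy J2 (fst z) (snd z))))))
       \<le> (SUP n. v n z)"
    proof (cases "0 < snd z")
      case True
      obtain m where m: "fst z \<in> bx m" using bx_cover[OF x] by blast
      obtain m' where m': "snd z \<le> real m'" using real_arch_simple by blast
      define n where "n = max m m'"
      have "fst z \<in> bx n" using m bx_mono[of m n] by (auto simp: n_def)
      moreover have "snd z \<in> {0..real n}" using True m' by (auto simp: n_def)
      ultimately have "ennreal (f z) \<le> v n z" by (simp add: v_def)
      also have "\<dots> \<le> (SUP n. v n z)" by (rule SUP_upper) simp
      finally show ?thesis using True by (simp add: f_def)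
    qed auto
  qed
  also have "\<dots> = (SUP n. \<integral>\<^sup>+z. v n z \<partial>(\<mu> \<Otimes>\<^sub>M lborel))"
    by (rule nn_integral_monotone_convergence_SUP[OF inc um])
  also have "\<dots> \<le> ?R"
  proof -
    have iinc: "incseq (\<lambda>n. \<integral>\<^sup>+z. v n z \<partial>(\<mu> \<Otimes>\<^sub>M lborel))"
      using inc by (intro incseq_SucI nn_integral_mono) (auto dest: incseq_SucD le_funD)
    have le: "(\<integral>\<^sup>+z. v n z \<partial>(\<mu> \<Otimes>\<^sub>M lborel)) \<le> ?R + ennreal (Q * decay (real n) * HH)" for n
      unfolding v_def bx_def by (rule base) (auto simp: XX_def ab')
    have "(\<lambda>n. decay (real n)) \<longlonglongrightarrow> 0"
      using filterlim_compose[OF decay_tendsto filterlim_real_sequentially] .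
    then have "(\<lambda>n. Q * decay (real n) * HH) \<longlonglongrightarrow> Q * 0 * HH" by (intro tendsto_intros)
    then have "(\<lambda>n. ennreal (Q * decay (real n) * HH)) \<longlonglongrightarrow> ennreal 0" by (intro tendsto_ennrealI) simp
    then have "(\<lambda>n. ?R + ennreal (Q * decay (real n) * HH)) \<longlonglongrightarrow> ?R + 0" by (intro tendsto_add tendsto_const) simp
    then show ?thesis using LIMSEQ_le[OF LIMSEQ_SUP[OF iinc]] le by auto
  qed
  finally show ?thesis .
qed

end

section \<open>Scaling and the product of norms\<close>

lemma power2_powr_half: "(y\<^sup>2) powr (s / 2) = y powr s" if "0 \<le> y" for y s :: real
  using that by (cases "y = 0") (auto simp: powr_powr simp flip: powr_numeral)

context bellman_flow
begin

text \<open>As in \<open>H_integrable\<close>, a factor \<open>Z l\<close> is kept in every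
  variable: \<open>z powr s \<le> z * (1 + z) ^ N\<close> holds because
  \<open>s \<ge> 1\<close>.\<close>

lemma integrable_norm_powr:
  assumes s: "1 \<le> s"
  shows "integrable \<mu> (\<lambda>x. (\<Sum>j\<in>J. (h j x 0)\<^sup>2) powr (s / 2))"
proof -
  define N where "N = nat \<lceil>s\<rceil>"
  have N: "s \<le> real N + 1" unfolding N_def by linarith
  define K where "K = (real (card (UNIV :: 'c set)) * c0\<^sup>2) powr (s / 2)"
  have "integrable \<mu> (\<lambda>x. K * (\<Prod>l\<in>UNIV. Z l (x l) * (1 + Z l (x l)) ^ N))"
    by (intro integrable_mult_right product_integrable_prod H_integrable) auto
  then show ?thesis
  proof (rule Bochner_Integration.integrable_bound)
    have [measurable]: "(\<lambda>x. h j x 0) \<in> borel_measurable \<mu>" for j by (rule nice_fixed_measurable[OF nice_h])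
    show "(\<lambda>x. (\<Sum>j\<in>J. (h j x 0)\<^sup>2) powr (s / 2)) \<in> borel_measurable \<mu>"
      by measurable
    have "norm ((\<Sum>j\<in>J. (h j x 0)\<^sup>2) powr (s / 2)) \<le> norm (K * (\<Prod>l\<in>UNIV. Z l (x l) * (1 + Z l (x l)) ^ N))" for x
    proof -
      let ?P = "\<Prod>l\<in>UNIV. Z l (x l)"
      have P0: "0 \<le> ?P" by (rule prod_Z_nonneg)
      have "(h j x 0)\<^sup>2 \<le> c0\<^sup>2 * ?P\<^sup>2" for j
      proof -
        have "\<bar>h j x 0\<bar>\<^sup>2 \<le> (c0 * ?P)\<^sup>2" using h_bound[of 0 j x] by (intro power_mono) auto
        then show ?thesis by (simp add: power_mult_distrib)
      qed
      then have "(\<Sum>j\<in>J. (h j x 0)\<^sup>2) \<le> (\<Sum>j\<in>J. c0\<^sup>2 * ?P\<^sup>2)" by (intro sum_mono)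
      also have "\<dots> \<le> (\<Sum>j\<in>(UNIV :: 'c set). c0\<^sup>2 * ?P\<^sup>2)" by (rule sum_mono2) auto
      finally have "(\<Sum>j\<in>J. (h j x 0)\<^sup>2) \<le> (real (card (UNIV :: 'c set)) * c0\<^sup>2) * ?P\<^sup>2" by (simp add: mult.assoc)
      then have "(\<Sum>j\<in>J. (h j x 0)\<^sup>2) powr (s / 2) \<le> ((real (card (UNIV :: 'c set)) * c0\<^sup>2) * ?P\<^sup>2) powr (s / 2)"
        using s by (intro powr_mono2 sum_nonneg) auto
      also have "\<dots> = K * (?P\<^sup>2) powr (s / 2)" unfolding K_def by (rule powr_mult) 
      also have "(?P\<^sup>2) powr (s / 2) = ?P powr s" by (rule power2_powr_half[OF P0])
      also have "?P powr s = (\<Prod>l\<in>UNIV. Z l (x l) powr s)"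
        by (rule prod_powr_distrib)
      also have "\<dots> \<le> (\<Prod>l\<in>UNIV. Z l (x l) * (1 + Z l (x l)) ^ N)"
      proof (intro prod_mono conjI)
        fix l
        let ?z = "Z l (x l)"
        have z: "0 \<le> ?z" by (rule Z_nonneg)
        show "?z powr s \<le> ?z * (1 + ?z) ^ N"
        proof (cases "?z = 0")
          case False
          then have zp: "?z > 0" using z by simp
          have "?z powr s = ?z * ?z powr (s - 1)" using zp powr_add[of ?z 1 "s - 1"] by simp
          also have "?z powr (s - 1) \<le> (1 + ?z) powr (s - 1)" using zp s by (intro powr_mono2) auto
          also have "\<dots> \<le> (1 + ?z) powr real N" using zp N by (intro powr_mono) auto
          also have "\<dots> = (1 + ?z) ^ N" using zp by (simp add: powr_realpow)
          finally show ?thesis using zp by simp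
        qed (use s in auto)
      qed auto
      finally have "(\<Sum>j\<in>J. (h j x 0)\<^sup>2) powr (s / 2) \<le> K * (\<Prod>l\<in>UNIV. Z l (x l) * (1 + Z l (x l)) ^ N)"
        by (simp add: K_def mult_left_mono)
      then show ?thesis by simp
    qed
    then show "AE x in \<mu>. norm ((\<Sum>j\<in>J. (h j x 0)\<^sup>2) powr (s / 2)) \<le> norm (K * (\<Prod>l\<in>UNIV. Z l (x l) * (1 + Z l (x l)) ^ N))"
      by simp
  qed
qed

text \<open>Scaling the coefficients of the blocks by \<open>l\<close> and \<open>1 / l\<close>
  gives another instance of the flow. The product of the two energies is unchanged, while the
  initial norms scale in opposite directions.\<close>

lemma bilinear_bound_scaled:
  assumes upper: "\<And>X Y. X > 0 \<Longrightarrow> Y > 0 \<Longrightarrow> \<Phi> X Y \<le> G * (X powr p1 + Y powr p2)" and G: "0 \<le> G"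
    and p: "0 < p1" "0 < p2" and disj: "J1 \<inter> J2 = {}" and l: "0 < l"
  shows "(\<integral>\<^sup>+ z. ennreal (indicator {0<..} (snd z) *
       (snd z * (2 * \<kappa> * (sqrt (energy J1 (fst z) (snd z)) * sqrt (energy J2 (fst z) (snd z)))))) \<partial>(\<mu> \<Otimes>\<^sub>M lborel))
    \<le> (\<integral>\<^sup>+x. ennreal (G * ((l\<^sup>2 * (\<Sum>j\<in>J1. (h j x 0)\<^sup>2)) powr p1 + ((\<Sum>j\<in>J2. (h j x 0)\<^sup>2) / l\<^sup>2) powr p2)) \<partial>\<mu>)"
proof -
  define a where "a j = (if j \<in> J1 then l else 1 / l)" for j
  interpret S: bellman_flow I w pp r lam \<theta> d\<theta> V M \<Phi> \<Phi>x \<Phi>y \<Phi>xx \<Phi>xy \<Phi>yy \<tau> \<kappa> S "\<lambda>j k. a j * C j k" J1 J2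
    by unfold_locales (rule finite_S)
  have sh: "S.h j x t = a j * h j x t" "S.ht j x t = a j * ht j x t" "S.hx i j x t = a j * hx i j x t" for i j x t
    unfolding S.h_def h_def S.ht_def ht_def S.hx_def hx_def by (simp_all add: sum_distrib_left mult_ac)
  have sE: "S.energy J x t = c * energy J x t" if "\<And>j. j \<in> J \<Longrightarrow> (a j)\<^sup>2 = c" for J x t c
  proof -
    have 1: "(\<Sum>j\<in>J. (a j * u j)\<^sup>2) = c * (\<Sum>j\<in>J. (u j)\<^sup>2)" for u
      using that by (simp add: power_mult_distrib sum_distrib_left)
    have 2: "(pp i (x i) * (a j * y))\<^sup>2 = (a j * (pp i (x i) * y))\<^sup>2" for i j y by (simp add: mult_ac)
    show ?thesis unfolding S.energy_def energy_def sh 2 1 by (simp add: sum_distrib_left[symmetric] algebra_simps)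
  qed
  have a1: "(a j)\<^sup>2 = l\<^sup>2" if "j \<in> J1" for j using that by (simp add: a_def)
  have a2: "(a j)\<^sup>2 = 1 / l\<^sup>2" if "j \<in> J2" for j using that disj by (auto simp: a_def power_divide)
  have s1: "(\<Sum>j\<in>J1. (S.h j x 0)\<^sup>2) = l\<^sup>2 * (\<Sum>j\<in>J1. (h j x 0)\<^sup>2)"
    and s2: "(\<Sum>j\<in>J2. (S.h j x 0)\<^sup>2) = (\<Sum>j\<in>J2. (h j x 0)\<^sup>2) / l\<^sup>2" for x
    unfolding sh power_mult_distrib using a1 a2 by (simp_all add: sum_distrib_left sum_divide_distrib)
  have sq: "sqrt (S.energy J1 x t) * sqrt (S.energy J2 x t) = sqrt (energy J1 x t) * sqrt (energy J2 x t)" for x t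
  proof -
    have "S.energy J1 x t = l\<^sup>2 * energy J1 x t" "S.energy J2 x t = 1 / l\<^sup>2 * energy J2 x t"
      by (rule sE, erule a1) (rule sE, erule a2)
    then show ?thesis using l by (simp add: real_sqrt_mult real_sqrt_divide)
  qed
  show ?thesis using S.bilinear_bound[OF upper G p] unfolding sq s1 s2 .
qed

text \<open>The bound \<open>G * (l powr p * A + l powr (- q) * B)\<close> holds for every
  \<open>l > 0\<close>, and \<open>l\<close> is chosen to balance the two terms. If \<open>A\<close>
  or \<open>B\<close> vanishes, the limit \<open>l \<rightarrow> \<infinity>\<close> or
  \<open>l \<rightarrow> 0\<close> gives 0 instead.\<close>

theorem bilinear_embedding:
  assumes upper: "\<And>X Y. X > 0 \<Longrightarrow> Y > 0 \<Longrightarrow> \<Phi> X Y \<le> G * (X powr (p / 2) + Y powr (q / 2))" and G: "0 \<le> G"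
    and p: "1 < p" "1 < q" "1 / p + 1 / q = 1" and disj: "J1 \<inter> J2 = {}"
  shows "(\<integral>\<^sup>+ z. ennreal (indicator {0<..} (snd z) *
       (snd z * (2 * \<kappa> * (sqrt (energy J1 (fst z) (snd z)) * sqrt (energy J2 (fst z) (snd z)))))) \<partial>(\<mu> \<Otimes>\<^sub>M lborel))
    \<le> ennreal (2 * G * (\<integral>x. (\<Sum>j\<in>J1. (h j x 0)\<^sup>2) powr (p / 2) \<partial>\<mu>) powr (1 / p)
        * (\<integral>x. (\<Sum>j\<in>J2. (h j x 0)\<^sup>2) powr (q / 2) \<partial>\<mu>) powr (1 / q))"
    (is "?L \<le> _")
proof -
  define A where "A = (\<integral>x. (\<Sum>j\<in>J1. (h j x 0)\<^sup>2) powr (p / 2) \<partial>\<mu>)"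
  define B where "B = (\<integral>x. (\<Sum>j\<in>J2. (h j x 0)\<^sup>2) powr (q / 2) \<partial>\<mu>)"
  have A0: "0 \<le> A" and B0: "0 \<le> B" unfolding A_def B_def by (auto intro!: Bochner_Integration.integral_nonneg)
  have iA: "integrable \<mu> (\<lambda>x. (\<Sum>j\<in>J1. (h j x 0)\<^sup>2) powr (p / 2))" and iB: "integrable \<mu> (\<lambda>x. (\<Sum>j\<in>J2. (h j x 0)\<^sup>2) powr (q / 2))"
    using p by (auto intro: integrable_norm_powr)
  have S0: "0 \<le> (\<Sum>j\<in>J. (h j x 0)\<^sup>2)" for J x by (intro sum_nonneg) auto
  have bound: "?L \<le> ennreal (G * (l powr p * A + l powr (- q) * B))" if l: "0 < l" for l
  proof -
    have lp: "(l\<^sup>2 * X) powr (p / 2) = l powr p * X powr (p / 2)" "(X / l\<^sup>2) powr (q / 2) = l powr (- q) * X powr (q / 2)"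
      if "0 \<le> X" for X
    proof -
      have l2: "(l\<^sup>2) powr a = l powr (2 * a)" for a
        using l powr_powr[of l 2 a] by (simp add: powr_numeral)
      show "(l\<^sup>2 * X) powr (p / 2) = l powr p * X powr (p / 2)" using that by (simp add: powr_mult l2)
      show "(X / l\<^sup>2) powr (q / 2) = l powr (- q) * X powr (q / 2)"
        using that by (simp add: powr_divide l2 powr_minus_divide)
    qed
    have "?L \<le> (\<integral>\<^sup>+x. ennreal (G * ((l\<^sup>2 * (\<Sum>j\<in>J1. (h j x 0)\<^sup>2)) powr (p / 2) + ((\<Sum>j\<in>J2. (h j x 0)\<^sup>2) / l\<^sup>2) powr (q / 2))) \<partial>\<mu>)"
      using p by (intro bilinear_bound_scaled upper G disj l) auto
    also have "\<dots> = ennreal (\<integral>x. G * (l powr p * (\<Sum>j\<in>J1. (h j x 0)\<^sup>2) powr (p / 2) + l powr (- q) * (\<Sum>j\<in>J2. (h j x 0)\<^sup>2) powr (q / 2)) \<partial>\<mu>)"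
      unfolding lp[OF S0] using iA iB G by (intro nn_integral_eq_integral) auto
    also have "(\<integral>x. G * (l powr p * (\<Sum>j\<in>J1. (h j x 0)\<^sup>2) powr (p / 2) + l powr (- q) * (\<Sum>j\<in>J2. (h j x 0)\<^sup>2) powr (q / 2)) \<partial>\<mu>)
       = G * (l powr p * A + l powr (- q) * B)" unfolding A_def B_def using iA iB by simp
    finally show ?thesis .
  qed
  have exp_lim: "((\<lambda>l. l powr (- c)) \<longlongrightarrow> 0) at_top" if "0 < c" for c :: real
    using that by (intro tendsto_neg_powr filterlim_ident) auto
  consider "A = 0" | "B = 0" | "A > 0" "B > 0" using A0 B0 by linarith
  then have "?L \<le> ennreal (2 * G * A powr (1 / p) * B powr (1 / q))"
  proof cases
    case 1
    have "((\<lambda>l. ennreal (G * (l powr (- q) * B))) \<longlongrightarrow> ennreal (G * (0 * B))) at_top"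
      using p by (intro tendsto_ennrealI tendsto_intros exp_lim) auto
    moreover have "\<forall>\<^sub>F l in at_top. ?L \<le> ennreal (G * (l powr (- q) * B))"
      using eventually_gt_at_top[of "0 :: real"] by eventually_elim (use bound 1 in auto)
    ultimately have "?L \<le> ennreal (G * (0 * B))" by (rule tendsto_lowerbound) simp
    then show ?thesis using 1 by simp
  next
    case 2
    have "((\<lambda>l. ennreal (G * (l powr (- p) * A))) \<longlongrightarrow> ennreal (G * (0 * A))) at_top"
      using p by (intro tendsto_ennrealI tendsto_intros exp_lim) auto
    moreover have "\<forall>\<^sub>F l in at_top. ?L \<le> ennreal (G * (l powr (- p) * A))"
      using eventually_gt_at_top[of "0 :: real"]
    proof eventually_elim
      case (elim l)
      have "(1 / l) powr p = l powr (- p)" using elim by (simp add: powr_divide powr_minus_divide)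
      then show ?case using bound[of "1 / l"] elim 2 by simp
    qed
    ultimately have "?L \<le> ennreal (G * (0 * A))" by (rule tendsto_lowerbound) simp
    then show ?thesis using 2 by simp
  next
    case 3
    define V where "V = A powr (1 / p) * B powr (1 / q)"
    \<comment> \<open>The solution of \<open>l powr p * A = V\<close>; by conjugacy of the exponents
      \<open>l powr (- q) * B\<close> equals \<open>V\<close> as well, whence the factor 2.\<close>
    define l where "l = A powr (- 1 / p) * V powr (1 / p)"
    have V: "V > 0" and l: "l > 0" using 3 by (auto simp: V_def l_def)
    have e1: "l powr p * A = V"
    proof -
      have "l powr p = A powr (- 1) * V powr 1"
        unfolding l_def using 3 V p by (simp add: powr_mult powr_powr)
      then show ?thesis using 3 V by (simp add: powr_minus field_simps)
    qed
    have e2: "l powr (- q) * B = V"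
    proof -
      have "l powr (- q) = A powr (q / p) * V powr (- q / p)"
        unfolding l_def using 3 V p by (simp add: powr_mult powr_powr)
      moreover have "q / p = q - 1" using p by (simp add: field_simps)
      moreover have "V powr q = A powr (q / p) * B" unfolding V_def using 3 p by (simp add: powr_mult powr_powr)
      ultimately have "l powr (- q) * B = V powr q * V powr (1 - q)" by (simp add: mult_ac)
      also have "\<dots> = V" unfolding powr_add[symmetric] using V by simp
      finally show ?thesis .
    qed
    show ?thesis using bound[OF l] unfolding e1 e2 by (simp add: V_def mult_ac)
  qed
  then show ?thesis unfolding A_def B_def .
qed

end

subsection \<open>Eigenfunctions of the operators \<open>L\<close>\<close>

lemma smooth_on_deriv:
  assumes "smooth_on S f" "open S" "x \<in> S"
  shows "((deriv ^^ n) f has_real_derivative (deriv ^^ Suc n) f x) (at x)"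
proof -
  have "(deriv ^^ n) f differentiable (at x within S)"
    using assms unfolding smooth_on_def differentiable_on_def by blast
  then have "(deriv ^^ n) f differentiable (at x)" unfolding at_within_open[OF assms(3,2)] .
  then have "((deriv ^^ n) f has_real_derivative deriv ((deriv ^^ n) f) x) (at x)"
    unfolding DERIV_deriv_iff_real_differentiable .
  then show ?thesis by simp
qed

lemma smooth_on_derivs:
  assumes "smooth_on S f" "open S" "x \<in> S"
  shows "(f has_real_derivative deriv f x) (at x)"
    "(deriv f has_real_derivative deriv (deriv f) x) (at x)"
    "(deriv (deriv f) has_real_derivative deriv (deriv (deriv f)) x) (at x)"
  using smooth_on_deriv[OF assms, of 0] smooth_on_deriv[OF assms, of 1] smooth_on_deriv[OF assms, of 2]
  by (simp_all add: numeral_2_eq_2)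

lemma deriv_cont:
  assumes "open S" "\<And>x. x \<in> S \<Longrightarrow> (f has_real_derivative g x) (at x)"
  shows "continuous_on S f"
  using assms by (intro continuous_at_imp_continuous_on ballI DERIV_isCont) blast

context
  fixes S :: "real set" and w p q \<phi> :: "real \<Rightarrow> real" and a l :: real
  assumes S: "open S" and w: "smooth_on S w" and wp: "\<And>x. x \<in> S \<Longrightarrow> w x > 0"
    and p: "smooth_on S p" and q: "smooth_on S q" and \<phi>: "smooth_on S \<phi>"
    and ev: "\<And>x. x \<in> S \<Longrightarrow> L_op w p q a \<phi> x = l * \<phi> x"
begin

lemma smooth_continuous:
  "continuous_on S w" "continuous_on S (deriv w)" "continuous_on S (deriv (deriv w))" "continuous_on S p" "continuous_on S (deriv p)"
  "continuous_on S (deriv (deriv p))" "continuous_on S q" "continuous_on S (deriv q)" "continuous_on S \<phi>" "continuous_on S (deriv \<phi>)"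
  by (rule deriv_cont[OF S smooth_on_derivs(1)[OF w S]] deriv_cont[OF S smooth_on_derivs(2)[OF w S]]
        deriv_cont[OF S smooth_on_derivs(3)[OF w S]] deriv_cont[OF S smooth_on_derivs(1)[OF p S]]
        deriv_cont[OF S smooth_on_derivs(2)[OF p S]] deriv_cont[OF S smooth_on_derivs(3)[OF p S]]
        deriv_cont[OF S smooth_on_derivs(1)[OF q S]] deriv_cont[OF S smooth_on_derivs(2)[OF q S]]
        deriv_cont[OF S smooth_on_derivs(1)[OF \<phi> S]] deriv_cont[OF S smooth_on_derivs(2)[OF \<phi> S]]; assumption)+

lemma \<delta>_deriv:
  assumes x: "x \<in> S"
  shows "(\<delta> p q \<phi> has_real_derivative deriv p x * deriv \<phi> x + p x * deriv (deriv \<phi>) x + deriv q x * \<phi> x + q x * deriv \<phi> x) (at x)"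
  unfolding \<delta>_def[abs_def]
  by (rule DERIV_cong, (rule DERIV_add DERIV_mult smooth_on_derivs[OF p S x] smooth_on_derivs[OF q S x] smooth_on_derivs[OF \<phi> S x])+)
     (simp add: algebra_simps)

text \<open>Only existence of the second derivative matters here; its value is extracted later from
  the differentiated eigenvalue equation.\<close>

lemma \<delta>_deriv2:
  assumes x: "x \<in> S"
  shows "(deriv (\<delta> p q \<phi>) has_real_derivative deriv (deriv (\<delta> p q \<phi>)) x) (at x)"
proof -
  let ?d = "\<lambda>x. deriv p x * deriv \<phi> x + p x * deriv (deriv \<phi>) x + deriv q x * \<phi> x + q x * deriv \<phi> x"
  have d: "\<exists>D. (?d has_real_derivative D) (at x)"
    by (rule exI, (rule DERIV_add DERIV_mult smooth_on_derivs[OF p S x] smooth_on_derivs[OF q S x] smooth_on_derivs[OF \<phi> S x])+)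
  then obtain D where "(?d has_real_derivative D) (at x)" by blast
  then have "(deriv (\<delta> p q \<phi>) has_real_derivative D) (at x)"
    by (rule has_field_derivative_transform_within_open[OF _ S x]) (simp add: DERIV_imp_deriv[OF \<delta>_deriv])
  from DERIV_imp_deriv[OF this] this show ?thesis by simp
qed

lemma \<delta>_smooth_enough:
  "x \<in> S \<Longrightarrow> (\<delta> p q \<phi> has_real_derivative deriv (\<delta> p q \<phi>) x) (at x)"
  "continuous_on S (deriv (\<delta> p q \<phi>))"
proof -
  show "(\<delta> p q \<phi> has_real_derivative deriv (\<delta> p q \<phi>) x) (at x)" if "x \<in> S"
    using \<delta>_deriv[OF that] by (simp add: DERIV_imp_deriv[OF \<delta>_deriv[OF that]])
  show "continuous_on S (deriv (\<delta> p q \<phi>))" by (rule deriv_cont[OF S \<delta>_deriv2])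
qed

text \<open>The eigenvalue equation in divergence form. When \<open>\<delta>_adj\<close> is applied
  to \<open>\<delta> p q \<phi>\<close>, the first-order terms containing \<open>q\<close> cancel
  and leave multiplication by \<open>potential1\<close>.\<close>

lemma eigenfunction_ode:
  assumes x: "x \<in> S"
  shows "((\<lambda>s. (p s)\<^sup>2 * w s * deriv \<phi> s) has_real_derivative w x * (potential1 w p q a x - l) * \<phi> x) (at x)"
proof -
  note dp = smooth_on_derivs[OF p S x] and dq = smooth_on_derivs[OF q S x] and dw = smooth_on_derivs[OF w S x]
    and d\<phi> = smooth_on_derivs[OF \<phi> S x]
  have wx: "w x \<noteq> 0" using wp[OF x] by simp
  have \<psi>: "((\<lambda>y. p y * w y * \<delta> p q \<phi> y) has_real_derivative
      (deriv p x * w x + p x * deriv w x) * \<delta> p q \<phi> x + p x * w x * (deriv p x * deriv \<phi> x + p x * deriv (deriv \<phi>) x + deriv q x * \<phi> x + q x * deriv \<phi> x)) (at x)"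
    by (rule DERIV_cong, (rule DERIV_mult dp dw \<delta>_deriv[OF x])+) (simp add: algebra_simps)
  have main: "((\<lambda>s. (p s)\<^sup>2 * w s * deriv \<phi> s) has_real_derivative
      (2 * p x * deriv p x * w x + (p x)\<^sup>2 * deriv w x) * deriv \<phi> x + (p x)\<^sup>2 * w x * deriv (deriv \<phi>) x) (at x)"
    unfolding power2_eq_square
    by (rule DERIV_cong, (rule DERIV_mult dp dw d\<phi>)+) (simp add: algebra_simps)
  have "w x * L_op w p q a \<phi> x = w x * (l * \<phi> x)" using ev[OF x] by simp
  then have "- ((deriv p x * w x + p x * deriv w x) * \<delta> p q \<phi> x + p x * w x * (deriv p x * deriv \<phi> x + p x * deriv (deriv \<phi>) x + deriv q x * \<phi> x + q x * deriv \<phi> x))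
      + w x * (q x * \<delta> p q \<phi> x) + w x * (a * \<phi> x) = w x * (l * \<phi> x)"
    unfolding L_op_def \<delta>_adj_def DERIV_imp_deriv[OF \<psi>] using wx by (simp add: algebra_simps)
  then have "(2 * p x * deriv p x * w x + (p x)\<^sup>2 * deriv w x) * deriv \<phi> x + (p x)\<^sup>2 * w x * deriv (deriv \<phi>) x
     = (w x * a + w x * (q x)\<^sup>2 - w x * (p x * deriv q x) - w x * (deriv p x * q x) - p x * q x * deriv w x - w x * l) * \<phi> x"
    unfolding \<delta>_def by (simp add: power2_eq_square algebra_simps)
  also have "\<dots> = w x * (potential1 w p q a x - l) * \<phi> x"
    unfolding potential1_def using wx by (simp add: field_simps)
  finally show ?thesis using main by simp
qed

text \<open>Apply \<open>\<delta>\<close> to the equation stating that the adjoint sends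
  \<open>\<psi>\<close> to \<open>(l - a) * \<phi>\<close>. Exchanging the order of the two
  operators costs their commutator, so \<open>\<psi>\<close> keeps the eigenvalue while the
  potential is raised by \<open>commutator_fun\<close>.\<close>

lemma \<delta>_eigenfunction_ode:
  assumes x: "x \<in> S"
  shows "((\<lambda>s. (p s)\<^sup>2 * w s * deriv (\<delta> p q \<phi>) s) has_real_derivative
     w x * (potential1 w p q a x + commutator_fun w p q x - l) * \<delta> p q \<phi> x) (at x)"
proof -
  define \<psi> where "\<psi> = \<delta> p q \<phi>"
  define B where "B y = p y * (deriv w y / w y)" for y
  have d\<psi>: "y \<in> S \<Longrightarrow> (\<psi> has_real_derivative deriv \<psi> y) (at y)" and d\<psi>2: "(deriv \<psi> has_real_derivative deriv (deriv \<psi>) x) (at x)" for y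
    unfolding \<psi>_def by (rule \<delta>_smooth_enough, assumption) (rule \<delta>_deriv2[OF x])
  note dp = smooth_on_derivs[OF p S x] and dq = smooth_on_derivs[OF q S x] and dw = smooth_on_derivs[OF w S x]
    and d\<phi> = smooth_on_derivs[OF \<phi> S x]
  have wx: "w x \<noteq> 0" using wp[OF x] by simp
  have dB: "(B has_real_derivative deriv B x) (at x)"
  proof -
    have "\<exists>D. (B has_real_derivative D) (at x)"
      unfolding B_def[abs_def] by (rule exI, (rule DERIV_mult DERIV_divide dp dw wx)+)
    then obtain D where D: "(B has_real_derivative D) (at x)" by blast
    then show ?thesis by (simp add: DERIV_imp_deriv[OF D])
  qed
  \<comment> \<open>The adjoint applied to \<open>\<psi>\<close>, with the derivative of the product
    carried out. The equation holds on all of \<open>S\<close> and can therefore be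
    differentiated.\<close>
  have E: "- deriv p y * \<psi> y - B y * \<psi> y - p y * deriv \<psi> y + q y * \<psi> y = (l - a) * \<phi> y" if y: "y \<in> S" for y
  proof -
    have wy: "w y \<noteq> 0" using wp[OF y] by simp
    have "((\<lambda>y. p y * w y * \<psi> y) has_real_derivative (deriv p y * w y + p y * deriv w y) * \<psi> y + p y * w y * deriv \<psi> y) (at y)"
      by (rule DERIV_cong, (rule DERIV_mult smooth_on_derivs[OF p S y] smooth_on_derivs[OF w S y] d\<psi>[OF y])+) (simp add: algebra_simps)
    from DERIV_imp_deriv[OF this] have "\<delta>_adj w p q \<psi> y = - deriv p y * \<psi> y - B y * \<psi> y - p y * deriv \<psi> y + q y * \<psi> y"
      unfolding \<delta>_adj_def B_def using wy by (simp add: field_simps)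
    then show ?thesis using ev[OF y] unfolding L_op_def \<psi>_def by (simp add: algebra_simps)
  qed
  have "((\<lambda>y. - deriv p y * \<psi> y - B y * \<psi> y - p y * deriv \<psi> y + q y * \<psi> y) has_real_derivative
     - deriv (deriv p) x * \<psi> x - deriv p x * deriv \<psi> x - (deriv B x * \<psi> x + B x * deriv \<psi> x)
      - (deriv p x * deriv \<psi> x + p x * deriv (deriv \<psi>) x) + (deriv q x * \<psi> x + q x * deriv \<psi> x)) (at x)"
    by (rule DERIV_cong, (rule DERIV_add DERIV_diff DERIV_mult DERIV_minus dp dq dB d\<psi>[OF x] d\<psi>2)+) (simp add: algebra_simps)
  moreover have "((\<lambda>y. - deriv p y * \<psi> y - B y * \<psi> y - p y * deriv \<psi> y + q y * \<psi> y) has_real_derivative (l - a) * deriv \<phi> x) (at x)"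
    by (rule has_field_derivative_transform_within_open[OF DERIV_cmult[OF d\<phi>(1)] S x]) (rule E[symmetric])
  ultimately have E': "- deriv (deriv p) x * \<psi> x - deriv p x * deriv \<psi> x - (deriv B x * \<psi> x + B x * deriv \<psi> x)
      - (deriv p x * deriv \<psi> x + p x * deriv (deriv \<psi>) x) + (deriv q x * \<psi> x + q x * deriv \<psi> x) = (l - a) * deriv \<phi> x"
    by (rule DERIV_unique)
  define R where "R = 2 * p x * deriv p x * deriv \<psi> x + p x * B x * deriv \<psi> x + (p x)\<^sup>2 * deriv (deriv \<psi>) x"
  \<comment> \<open>\<open>\<delta>\<close> applied to both sides: \<open>p\<close> times the
    differentiated equation plus \<open>q\<close> times the equation itself.\<close>
  have "(l - a) * \<psi> x = p x * ((l - a) * deriv \<phi> x) + q x * ((l - a) * \<phi> x)"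
    unfolding \<psi>_def \<delta>_def by (simp add: algebra_simps)
  also have "\<dots> = - R + (- p x * deriv (deriv p) x - p x * deriv B x + p x * deriv q x - q x * deriv p x - q x * B x + (q x)\<^sup>2) * \<psi> x"
    unfolding E'[symmetric] E[OF x, symmetric] R_def by (simp add: power2_eq_square algebra_simps)
  finally have R: "R = (a - l - p x * deriv (deriv p) x - p x * deriv B x + p x * deriv q x - q x * deriv p x - q x * B x + (q x)\<^sup>2) * \<psi> x"
    by (simp add: algebra_simps)
  have main: "((\<lambda>s. (p s)\<^sup>2 * w s * deriv \<psi> s) has_real_derivative
      (2 * p x * deriv p x * w x + (p x)\<^sup>2 * deriv w x) * deriv \<psi> x + (p x)\<^sup>2 * w x * deriv (deriv \<psi>) x) (at x)"
    unfolding power2_eq_square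
    by (rule DERIV_cong, (rule DERIV_mult dp dw d\<psi>2)+) (simp add: algebra_simps)
  have "(2 * p x * deriv p x * w x + (p x)\<^sup>2 * deriv w x) * deriv \<psi> x + (p x)\<^sup>2 * w x * deriv (deriv \<psi>) x = w x * R"
    unfolding R_def B_def using wx by (simp add: power2_eq_square field_simps)
  also have "\<dots> = w x * (potential1 w p q a x + commutator_fun w p q x - l) * \<psi> x"
    unfolding R potential1_def commutator_fun_def B_def[symmetric] B_def[abs_def, symmetric]
    using B_def[of x] by (simp add: algebra_simps)
  finally show ?thesis using main unfolding \<psi>_def by simp
qed

lemma potential_continuous: "continuous_on S (potential1 w p q a)" "continuous_on S (commutator_fun w p q)"
proof -
  have nz: "\<forall>x\<in>S. w x \<noteq> 0" using wp by force
  show "continuous_on S (potential1 w p q a)"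
    unfolding potential1_def[abs_def] by (intro continuous_intros smooth_continuous nz)
  let ?B = "\<lambda>y. p y * (deriv w y / w y)"
  let ?D = "\<lambda>x. deriv p x * (deriv w x / w x) + p x * ((deriv (deriv w) x * w x - deriv w x * deriv w x) / (w x * w x))"
  have "(?B has_real_derivative ?D x) (at x)" if x: "x \<in> S" for x
    by (rule DERIV_cong, (rule DERIV_mult DERIV_divide smooth_on_derivs[OF p S x] smooth_on_derivs[OF w S x] bspec[OF nz x])+)
       (simp add: algebra_simps)
  then have dB: "deriv ?B x = ?D x" if "x \<in> S" for x using DERIV_imp_deriv[of ?B "?D x" x] that by blast
  have ww: "\<forall>x\<in>S. w x * w x \<noteq> 0" using nz by simp
  have "continuous_on S ?D"
    by (intro continuous_on_mult continuous_on_diff continuous_on_add continuous_on_divide smooth_continuous nz ww)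
  moreover have "continuous_on S (deriv ?B) \<longleftrightarrow> continuous_on S ?D"
    by (rule continuous_on_cong[OF refl dB])
  ultimately have cB: "continuous_on S (deriv ?B)" by blast
  show "continuous_on S (commutator_fun w p q)"
    unfolding commutator_fun_def[abs_def]
    by (rule continuous_on_mult[OF smooth_continuous(4) continuous_on_diff[OF continuous_on_diff[OF
          continuous_on_mult[OF continuous_on_const smooth_continuous(8)] cB] smooth_continuous(6)]])
qed

end

section \<open>End-point decay and single tensor factors\<close>

lemma vanishes_at_endpoints_imp:
  assumes ab: "a < b" and h: "vanishes_at_endpoints a b h"
  shows "vanishes_left (einterval a b) h" "vanishes_right (einterval a b) h"
proof -
  show "vanishes_left (einterval a b) h"
    unfolding vanishes_left_def
  proof (intro allI impI)
    fix e :: real assume e: "e > 0"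
    have "\<forall>\<^sub>F y in at_right a. dist ((h \<circ> real_of_ereal) y) 0 < e"
      using h e unfolding vanishes_at_endpoints_def by (blast intro: tendstoD)
    then obtain d where d: "a < d" "\<And>y. a < y \<Longrightarrow> y < d \<Longrightarrow> \<bar>h (real_of_ereal y)\<bar> < e"
      unfolding eventually_at_right[OF ab] by auto
    obtain c where c: "a < ereal c" "ereal c < min b d" using ereal_dense2[of a "min b d"] ab d(1) by auto
    show "\<exists>c\<in>einterval a b. \<forall>s\<in>einterval a b. s < c \<longrightarrow> \<bar>h s\<bar> < e"
    proof (intro bexI[of _ c] ballI impI)
      fix s assume "s \<in> einterval a b" "s < c"
      then have "a < ereal s" "ereal s < d" using c by (auto simp: einterval_def intro: less_trans[of _ "ereal c"])
      from d(2)[OF this] show "\<bar>h s\<bar> < e" by simp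
    qed (use c in \<open>auto simp: einterval_def\<close>)
  qed
  show "vanishes_right (einterval a b) h"
    unfolding vanishes_right_def
  proof (intro allI impI)
    fix e :: real assume e: "e > 0"
    have "\<forall>\<^sub>F y in at_left b. dist ((h \<circ> real_of_ereal) y) 0 < e"
      using h e unfolding vanishes_at_endpoints_def by (blast intro: tendstoD)
    then obtain d where d: "d < b" "\<And>y. d < y \<Longrightarrow> y < b \<Longrightarrow> \<bar>h (real_of_ereal y)\<bar> < e"
      unfolding eventually_at_left[OF ab] by auto
    obtain c where c: "max a d < ereal c" "ereal c < b" using ereal_dense2[of "max a d" b] ab d(1) by auto
    show "\<exists>c\<in>einterval a b. \<forall>s\<in>einterval a b. c < s \<longrightarrow> \<bar>h s\<bar> < e"
    proof (intro bexI[of _ c] ballI impI)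
      fix s assume "s \<in> einterval a b" "c < s"
      then have "d < ereal s" "ereal s < b" using c by (auto simp: einterval_def intro: less_trans[of _ "ereal c"])
      from d(2)[OF this] show "\<bar>h s\<bar> < e" by simp
    qed (use c in \<open>auto simp: einterval_def\<close>)
  qed
qed

lemma vanishes_dominated:
  assumes "\<And>s. s \<in> I \<Longrightarrow> \<bar>g s\<bar> \<le> K * \<bar>h s\<bar>" "K > 0"
  shows "vanishes_left I h \<Longrightarrow> vanishes_left I g" "vanishes_right I h \<Longrightarrow> vanishes_right I g"
proof -
  have *: "\<bar>g s\<bar> < e" if "\<bar>h s\<bar> < e / K" "s \<in> I" for s e
  proof -
    have "K * \<bar>h s\<bar> < e" using that assms(2) by (simp add: pos_less_divide_eq mult.commute)
    then show ?thesis using assms(1)[OF that(2)] by linarith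
  qed
  have ek: "e / K > 0" if "e > 0" for e using that assms(2) by simp
  show "vanishes_left I g" if "vanishes_left I h"
    unfolding vanishes_left_def
  proof (intro allI impI)
    fix e :: real assume "e > 0"
    from that[unfolded vanishes_left_def, rule_format, OF ek[OF this]]
    show "\<exists>c\<in>I. \<forall>s\<in>I. s < c \<longrightarrow> \<bar>g s\<bar> < e" using * by blast
  qed
  show "vanishes_right I g" if "vanishes_right I h"
    unfolding vanishes_right_def
  proof (intro allI impI)
    fix e :: real assume "e > 0"
    from that[unfolded vanishes_right_def, rule_format, OF ek[OF this]]
    show "\<exists>c\<in>I. \<forall>s\<in>I. c < s \<longrightarrow> \<bar>g s\<bar> < e" using * by blast
  qed
qed

text \<open>For extended non-negative integrals, the integral of the product is the product of the
  integrals. As \<open>0 * \<infinity> = 0\<close> there, finiteness passes to one factor only if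
  the others are nonzero.\<close>

lemma integrable_factor:
  fixes f :: "'i::finite \<Rightarrow> 'a \<Rightarrow> real"
  assumes M: "product_sigma_finite M"
    and f: "\<And>l. f l \<in> borel_measurable (M l)" "\<And>l x. 0 \<le> f l x"
    and int: "integrable (PiM UNIV M) (\<lambda>x. \<Prod>l\<in>UNIV. f l (x l))"
    and nz: "\<And>l. l \<noteq> i \<Longrightarrow> (\<integral>\<^sup>+ s. ennreal (f l s) \<partial>M l) \<noteq> 0"
  shows "integrable (M i) (f i)"
proof -
  interpret product_sigma_finite M by (rule M)
  have "(\<integral>\<^sup>+ x. (\<Prod>l\<in>UNIV. ennreal (f l (x l))) \<partial>PiM UNIV M) = (\<Prod>l\<in>UNIV. \<integral>\<^sup>+ s. ennreal (f l s) \<partial>M l)"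
    by (rule product_nn_integral_prod) (use f(1) in auto)
  moreover have "(\<integral>\<^sup>+ x. (\<Prod>l\<in>UNIV. ennreal (f l (x l))) \<partial>PiM UNIV M) < \<infinity>"
    using int f(2) unfolding integrable_iff_bounded by (simp add: prod_ennreal prod_nonneg)
  ultimately have fin: "(\<Prod>l\<in>UNIV. \<integral>\<^sup>+ s. ennreal (f l s) \<partial>M l) \<noteq> top" by simp
  have "(\<integral>\<^sup>+ s. ennreal (f i s) \<partial>M i) \<noteq> top"
  proof
    assume top: "(\<integral>\<^sup>+ s. ennreal (f i s) \<partial>M i) = top"
    then have "(\<integral>\<^sup>+ s. ennreal (f l s) \<partial>M l) \<noteq> 0" for l using nz[of l] by (cases "l = i") auto
    with top fin show False by (auto simp: ennreal_prod_eq_top)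
  qed
  then have "(\<integral>\<^sup>+ s. ennreal (f i s) \<partial>M i) < \<infinity>" by (simp add: less_top)
  then show ?thesis using f by (intro integrableI_nonneg) auto
qed

lemma powr_eq_power: "\<bar>y\<bar> powr real m = \<bar>y\<bar> ^ m" if "1 \<le> m" for y :: real
  using that by (cases "y = 0") (auto simp: powr_realpow)

text \<open>\<open>H\<close> is known only on \<open>XX\<close>; since each \<open>I i\<close> is
  open, this determines the derivatives as well. \<open>e\<close> translates vector components into
  members of the block.\<close>

lemma (in bellman_flow) star_norm_eq:
  fixes H :: "('n \<Rightarrow> real) \<Rightarrow> real \<Rightarrow> real ^ 'm::finite"
  assumes H: "\<And>x t j. x \<in> XX \<Longrightarrow> H x t $ j = h (e j) x t" and e: "bij_betw e UNIV J" and x: "x \<in> XX"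
  shows "star_norm (\<lambda>x. \<Sum>i\<in>UNIV. r i (x i)) pp H x t = sqrt (energy J x t)"
proof -
  have nv: "(norm (v :: real ^ 'm))\<^sup>2 = (\<Sum>j\<in>UNIV. (v $ j)\<^sup>2)" for v
    by (simp add: norm_vec_def L2_set_def sum_nonneg)
  have re: "(\<Sum>j\<in>UNIV. u (e j)) = sum u J" for u :: "'c \<Rightarrow> real"
    using sum.reindex_bij_betw[OF e, of u] .
  have dt: "deriv (\<lambda>s. H x s $ j) t = ht (e j) x t" for j
    unfolding H[OF x] by (rule DERIV_imp_deriv[OF h_deriv_t])
  have dx: "in_var i (\<dd> (pp i)) (\<lambda>y. H y t $ j) x = pp i (x i) * hx i (e j) x t" for i j
  proof -
    have xi: "x i \<in> I i" using x by (simp add: XX_def)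
    have d: "((\<lambda>s. h (e j) (x(i := s)) t) has_real_derivative hx i (e j) x t) (at (x i))"
      using h_deriv_x[OF xi, of "e j" x t] by simp
    have "((\<lambda>s. H (x(i := s)) t $ j) has_real_derivative hx i (e j) x t) (at (x i))"
    proof (rule has_field_derivative_transform_within_open[OF d I(1) xi])
      fix s assume "s \<in> I i"
      then have "x(i := s) \<in> XX" using x by (simp add: XX_def)
      then show "h (e j) (x(i := s)) t = H (x(i := s)) t $ j" using H by simp
    qed
    then show ?thesis unfolding in_var_def \<dd>_def by (simp add: DERIV_imp_deriv)
  qed
  show ?thesis
    unfolding star_norm_def nv vec_lambda_beta dt dx unfolding H[OF x] energy_def
    using re[of "\<lambda>j. (h j x t)\<^sup>2"] re[of "\<lambda>j. (ht j x t)\<^sup>2"] re[of "\<lambda>j. (pp _ (x _) * hx _ j x t)\<^sup>2"] by simp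
qed

section \<open>The setting as a tensor system\<close>

locale riesz_setting =
  fixes \<sigma> \<Sigma> :: "'n::finite \<Rightarrow> ereal"
    and w pp qq :: "'n \<Rightarrow> real \<Rightarrow> real"
    and a :: "'n \<Rightarrow> real"
    and \<phi> :: "'n \<Rightarrow> nat \<Rightarrow> real \<Rightarrow> real"
    and lam :: "'n \<Rightarrow> nat \<Rightarrow> real"
    and K :: real
  assumes interval: "\<And>i. \<sigma> i < \<Sigma> i"
    and smooth_w: "\<And>i. smooth_on (einterval (\<sigma> i) (\<Sigma> i)) (w i)"
    and w_pos: "\<And>i x. x \<in> einterval (\<sigma> i) (\<Sigma> i) \<Longrightarrow> w i x > 0"
    and smooth_pp: "\<And>i. smooth_on (einterval (\<sigma> i) (\<Sigma> i)) (pp i)"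
    and smooth_qq: "\<And>i. smooth_on (einterval (\<sigma> i) (\<Sigma> i)) (qq i)"
    and pp_nonzero: "\<And>i x. x \<in> einterval (\<sigma> i) (\<Sigma> i) \<Longrightarrow> pp i x \<noteq> 0"
    and a_nonneg: "\<And>i. a i \<ge> 0"
    and smooth_\<phi>: "\<And>i k. smooth_on (einterval (\<sigma> i) (\<Sigma> i)) (\<phi> i k)"
    and basis: "\<And>i. orthonormal_basis_L2 (weighted_measure (\<sigma> i) (\<Sigma> i) (w i)) (\<phi> i)"
    and eigen: "\<And>i k x. x \<in> einterval (\<sigma> i) (\<Sigma> i) \<Longrightarrow>
      L_op (w i) (pp i) (qq i) (a i) (\<phi> i k) x = lam i k * \<phi> i k x"
    and lam_nonneg: "\<And>i k. lam i k \<ge> 0"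
    and A1: "\<And>i x. x \<in> einterval (\<sigma> i) (\<Sigma> i) \<Longrightarrow> commutator_fun (w i) (pp i) (qq i) x \<ge> 0"
    and K_nonneg: "K \<ge> 0"
    and A2: "\<And>x. x \<in> space (product_weighted_measure \<sigma> \<Sigma> w) \<Longrightarrow>
      (\<Sum>i\<in>UNIV. (qq i (x i))\<^sup>2) \<le> K * potential w pp qq a x"
    and T1: "\<And>i k m. L2_inner (weighted_measure (\<sigma> i) (\<Sigma> i) (w i)) (\<delta> (pp i) (qq i) (\<phi> i k)) (\<delta> (pp i) (qq i) (\<phi> i m))
      = L2_inner (weighted_measure (\<sigma> i) (\<Sigma> i) (w i)) (\<delta>_adj (w i) (pp i) (qq i) (\<delta> (pp i) (qq i) (\<phi> i k))) (\<phi> i m)"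
    and T2a: "\<And>i k s1 s2. s1 > 0 \<Longrightarrow> s2 > 0 \<Longrightarrow> vanishes_at_endpoints (\<sigma> i) (\<Sigma> i)
      (\<lambda>x. (1 + \<bar>\<phi> i k x\<bar> powr s1 + \<bar>\<delta> (pp i) (qq i) (\<phi> i k) x\<bar> powr s2)
         * (pp i x)\<^sup>2 * w i x * deriv (\<phi> i k) x)"
    and T2b: "\<And>i k s1 s2. s1 > 0 \<Longrightarrow> s2 > 0 \<Longrightarrow> vanishes_at_endpoints (\<sigma> i) (\<Sigma> i)
      (\<lambda>x. (1 + \<bar>\<phi> i k x\<bar> powr s1 + \<bar>\<delta> (pp i) (qq i) (\<phi> i k) x\<bar> powr s2)
         * (pp i x)\<^sup>2 * w i x * deriv (\<delta> (pp i) (qq i) (\<phi> i k)) x)"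
    and T3: "\<And>s. s \<ge> 1 \<Longrightarrow> dense_in_Lp (product_weighted_measure \<sigma> \<Sigma> w) s
        (lin (product_weighted_measure \<sigma> \<Sigma> w) (tensor \<phi>))"
      "\<And>s i. s \<ge> 1 \<Longrightarrow> dense_in_Lp (product_weighted_measure \<sigma> \<Sigma> w) s
        (lin (product_weighted_measure \<sigma> \<Sigma> w) (\<lambda>k. in_var i (\<delta> (pp i) (qq i)) (tensor \<phi> k)))"
begin

definition "I i = einterval (\<sigma> i) (\<Sigma> i)"
definition "M i = weighted_measure (\<sigma> i) (\<Sigma> i) (w i)"
definition "r i = potential1 (w i) (pp i) (qq i) (a i)"
definition "\<psi> i k = \<delta> (pp i) (qq i) (\<phi> i k)"
text \<open>\<open>None\<close> stands for the tensor eigenfunctions and \<open>Some i\<close> for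
  their images under \<open>\<delta>\<close> in variable \<open>i\<close>, which differ in the
  \<open>i\<close>-th factor alone.\<close>

definition "\<theta> j i k = (if j = Some i then \<psi> i k else \<phi> i k)" for j :: "'n option"
text \<open>The commutator is added only in the variable on which \<open>\<delta>\<close> has
  acted.\<close>

definition "V j i s = r i s + (if j = Some i then commutator_fun (w i) (pp i) (qq i) s else 0)" for j :: "'n option"
definition "bb j k x = (\<Prod>l\<in>UNIV. \<theta> j l (k l) (x l))" for j k x

lemma M_eq: "M = (\<lambda>i. density (restrict_space lborel (I i)) (\<lambda>s. ennreal (w i s)))"
  by (simp add: fun_eq_iff M_def weighted_measure_def I_def)

lemma mu_eq: "product_weighted_measure \<sigma> \<Sigma> w = PiM UNIV M"
  by (simp add: product_weighted_measure_def M_def[abs_def])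

lemma I_props: "open (I i)" "is_interval (I i)" "I i \<noteq> {}"
proof -
  show "open (I i)" by (simp add: I_def)
  show "is_interval (I i)"
    unfolding is_interval_1 I_def einterval_def
  proof (intro ballI allI impI CollectI conjI)
    fix x y s assume "x \<in> {x. \<sigma> i < ereal x \<and> ereal x < \<Sigma> i}" "y \<in> {x. \<sigma> i < ereal x \<and> ereal x < \<Sigma> i}" "x \<le> s \<and> s \<le> y"
    then show "\<sigma> i < ereal s" "ereal s < \<Sigma> i"
      using less_le_trans[of "\<sigma> i" "ereal x" "ereal s"] le_less_trans[of "ereal s" "ereal y" "\<Sigma> i"] by auto
  qed
  obtain c where "\<sigma> i < ereal c" "ereal c < \<Sigma> i" using ereal_dense2[OF interval] by blast
  then show "I i \<noteq> {}" by (auto simp: I_def einterval_def)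
qed

lemma I_rules: "smooth_on (I i) (w i)" "s \<in> I i \<Longrightarrow> w i s > 0"
  "smooth_on (I i) (pp i)" "smooth_on (I i) (qq i)" "smooth_on (I i) (\<phi> i k)"
  "s \<in> I i \<Longrightarrow> L_op (w i) (pp i) (qq i) (a i) (\<phi> i k) s = lam i k * \<phi> i k s"
  using smooth_w smooth_pp smooth_qq smooth_\<phi> w_pos eigen by (auto simp: I_def)

lemma cont: "continuous_on (I i) (w i)" "continuous_on (I i) (pp i)" "continuous_on (I i) (qq i)"
    "continuous_on (I i) (\<theta> j i k)" "continuous_on (I i) (deriv (\<theta> j i k))"
    "continuous_on (I i) (r i)" "continuous_on (I i) (V j i)"
proof -
  note sc = smooth_continuous[OF I_props(1) I_rules(1-6)] and pc = potential_continuous[OF I_props(1) I_rules(1-6)]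
    and ds = \<delta>_smooth_enough[OF I_props(1) I_rules(1-6)]
  show "continuous_on (I i) (w i)" by (rule sc(1))
  show "continuous_on (I i) (pp i)" by (rule sc(4))
  show "continuous_on (I i) (qq i)" by (rule sc(7))
  have "continuous_on (I i) (\<psi> i k)" unfolding \<psi>_def by (rule deriv_cont[OF I_props(1) ds(1)])
  then show "continuous_on (I i) (\<theta> j i k)" using sc(9)[of i k] by (simp add: \<theta>_def)
  show "continuous_on (I i) (deriv (\<theta> j i k))" using sc(10)[of i k] ds(2)[of i k] by (simp add: \<theta>_def \<psi>_def)
  show r: "continuous_on (I i) (r i)" unfolding r_def by (rule pc)
  have "continuous_on (I i) (\<lambda>s. r i s + (if j = Some i then commutator_fun (w i) (pp i) (qq i) s else 0))"
    using r pc(2)[of i] by (cases "j = Some i") (auto intro!: continuous_intros)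
  then show "continuous_on (I i) (V j i)" by (simp add: V_def[abs_def])
qed

lemma \<theta>_deriv: "s \<in> I i \<Longrightarrow> (\<theta> j i k has_real_derivative deriv (\<theta> j i k) s) (at s)"
  using smooth_on_derivs(1)[OF I_rules(5) I_props(1)] \<delta>_smooth_enough(1)[OF I_props(1) I_rules(1-6)]
  by (simp add: \<theta>_def \<psi>_def)

lemma \<theta>_measurable: "\<theta> j i k \<in> borel_measurable (M i)"
  unfolding M_eq by (rule continuous_measurable_weighted[OF cont(4)])

sublocale product_sigma_finite M
  unfolding M_eq by (intro product_sigma_finite.intro sigma_finite_weighted I_props cont)

lemma space_M: "space (M i) = I i"
  by (simp add: M_eq space_restrict_space)

lemma space_mu: "space (PiM UNIV M) = {x. \<forall>i. x i \<in> I i}"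
  by (auto simp: space_PiM space_M)

lemma tensor_eq: "tensor \<phi> k x = bb None k x"
  by (simp add: tensor_def bb_def \<theta>_def)

lemma \<delta>_tensor_eq:
  assumes x: "\<And>i. x i \<in> I i"
  shows "in_var i (\<delta> (pp i) (qq i)) (tensor \<phi> k) x = bb (Some i) k x"
proof -
  define c where "c = (\<Prod>l\<in>-{i}. \<phi> l (k l) (x l))"
  have sp: "(\<Prod>l\<in>UNIV. f l) = f i * (\<Prod>l\<in>-{i}. f l)" for f :: "'n \<Rightarrow> real"
    by (subst prod.remove[of _ i]) (auto simp: Compl_eq_Diff_UNIV)
  have t: "tensor \<phi> k (x(i := s)) = \<phi> i (k i) s * c" for s
  proof -
    have "(\<Prod>l\<in>-{i}. \<phi> l (k l) ((x(i := s)) l)) = c" unfolding c_def by (intro prod.cong) auto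
    then show ?thesis unfolding tensor_def sp by simp
  qed
  have "((\<lambda>s. \<phi> i (k i) s * c) has_real_derivative deriv (\<phi> i (k i)) (x i) * c) (at (x i))"
    by (intro DERIV_cmult_right smooth_on_derivs(1)[OF I_rules(5) I_props(1) x])
  then have "in_var i (\<delta> (pp i) (qq i)) (tensor \<phi> k) x = \<psi> i (k i) (x i) * c"
    unfolding in_var_def t \<delta>_def \<psi>_def by (simp add: DERIV_imp_deriv algebra_simps)
  also have "c = (\<Prod>l\<in>-{i}. \<theta> (Some i) l (k l) (x l))" unfolding c_def by (intro prod.cong) (auto simp: \<theta>_def)
  finally show ?thesis unfolding bb_def sp by (simp add: \<theta>_def)
qed

text \<open>\<open>dense_in_Lp\<close> includes membership, so \<open>T3\<close> puts every tensor
  product and its images under \<open>\<delta>\<close> into all Lebesgue spaces with exponent at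
  least 1. The images agree with \<open>bb\<close> only on the space of the measure.\<close>

lemma bb_Lp:
  assumes m: "1 \<le> m"
  shows "integrable (PiM UNIV M) (\<lambda>x. \<Prod>l\<in>UNIV. \<bar>\<theta> j l (k l) (x l)\<bar> ^ m)"
proof -
  have single: "b k \<in> lin \<nu> b" for b :: "('n \<Rightarrow> nat) \<Rightarrow> ('n \<Rightarrow> real) \<Rightarrow> real" and \<nu>
    unfolding lin_def by (intro CollectI exI[of _ "{k}"] exI[of _ "\<lambda>_. 1"]) simp
  have "\<exists>b. (\<forall>x\<in>space (PiM UNIV M). b x = bb j k x) \<and> b \<in> Lp_space (PiM UNIV M) (real m)"
  proof (cases j)
    case None
    have "tensor \<phi> k \<in> Lp_space (PiM UNIV M) (real m)"
      using T3(1)[of "real m"] m single[of "tensor \<phi>"] unfolding dense_in_Lp_def mu_eq by auto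
    then show ?thesis using None tensor_eq by blast
  next
    case (Some i)
    have "in_var i (\<delta> (pp i) (qq i)) (tensor \<phi> k) \<in> Lp_space (PiM UNIV M) (real m)"
      using T3(2)[of "real m" i] m single[of "\<lambda>k. in_var i (\<delta> (pp i) (qq i)) (tensor \<phi> k)"] unfolding dense_in_Lp_def mu_eq by auto
    then show ?thesis using Some \<delta>_tensor_eq by (intro exI[of _ "in_var i (\<delta> (pp i) (qq i)) (tensor \<phi> k)"]) (auto simp: space_mu)
  qed
  then obtain b where b: "\<And>x. x \<in> space (PiM UNIV M) \<Longrightarrow> b x = bb j k x" "integrable (PiM UNIV M) (\<lambda>x. norm (b x) powr real m)"
    unfolding Lp_space_def by blast
  have "integrable (PiM UNIV M) (\<lambda>x. norm (bb j k x) powr real m)"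
    using b(2) by (rule Bochner_Integration.integrable_cong[THEN iffD1, rotated -1]) (auto simp: b(1))
  moreover have "norm (bb j k x) powr real m = (\<Prod>l\<in>UNIV. \<bar>\<theta> j l (k l) (x l)\<bar> ^ m)" for x
    unfolding real_norm_def powr_eq_power[OF m] unfolding bb_def abs_prod prod_power_distrib ..
  ultimately show ?thesis by simp
qed

lemma orthonormal: "L2_inner (M i) (\<phi> i k) (\<phi> i m) = (if k = m then 1 else 0)"
  using basis[of i] unfolding orthonormal_basis_L2_def M_def by blast

lemma \<phi>_nonzero: "1 \<le> m \<Longrightarrow> (\<integral>\<^sup>+ s. ennreal (\<bar>\<phi> i k s\<bar> ^ m) \<partial>M i) \<noteq> 0"
proof
  assume m: "1 \<le> m"
  have meas: "\<phi> i k \<in> borel_measurable (M i)" using \<theta>_measurable[of None i k] by (simp add: \<theta>_def)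
  assume "(\<integral>\<^sup>+ s. ennreal (\<bar>\<phi> i k s\<bar> ^ m) \<partial>M i) = 0"
  then have "AE s in M i. ennreal (\<bar>\<phi> i k s\<bar> ^ m) = 0" using meas by (subst (asm) nn_integral_0_iff_AE) auto
  then have "AE s in M i. \<phi> i k s * \<phi> i k s = 0"
  proof eventually_elim
    case (elim s)
    then have "\<bar>\<phi> i k s\<bar> ^ m = 0" using zero_le_power[of "\<bar>\<phi> i k s\<bar>" m] by (simp only: ennreal_eq_0_iff) linarith
    then show ?case using m by simp
  qed
  then have "L2_inner (M i) (\<phi> i k) (\<phi> i k) = 0" unfolding L2_inner_def by (rule integral_eq_zero_AE)
  then show False using orthonormal[of i k k] by simp
qed

lemma moments:
  assumes m: "1 \<le> m"
  shows "integrable (M i) (\<lambda>s. \<bar>\<theta> j i k s\<bar> ^ m)"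
proof -
  \<comment> \<open>With this choice all factors other than the \<open>i\<close>-th are
    eigenfunctions, which have norm 1; an image under \<open>\<delta>\<close> might be zero.\<close>
  define j' where "j' = (if j = Some i then j else None)"
  have "integrable (M i) (\<lambda>s. \<bar>\<theta> j' i ((\<lambda>_. k) i) s\<bar> ^ m)"
  proof (rule integrable_factor[where f = "\<lambda>l s. \<bar>\<theta> j' l ((\<lambda>_. k) l) s\<bar> ^ m", OF product_sigma_finite_axioms _ _ bb_Lp[OF m]])
    show "(\<integral>\<^sup>+ s. ennreal (\<bar>\<theta> j' l k s\<bar> ^ m) \<partial>M l) \<noteq> 0" if "l \<noteq> i" for l
      using \<phi>_nonzero[OF m, of l k] that by (simp add: \<theta>_def j'_def)
    show "(\<lambda>s. \<bar>\<theta> j' l k s\<bar> ^ m) \<in> borel_measurable (M l)" for l using \<theta>_measurable[of j' l k] by simp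
  qed auto
  then show ?thesis by (simp add: \<theta>_def j'_def split: if_splits)
qed

lemma decay:
  "vanishes_left (I i) (\<lambda>s. (pp i s)\<^sup>2 * w i s * (1 + \<bar>\<theta> j i k s\<bar> ^ m) * deriv (\<theta> j i k) s)"
  "vanishes_right (I i) (\<lambda>s. (pp i s)\<^sup>2 * w i s * (1 + \<bar>\<theta> j i k s\<bar> ^ m) * deriv (\<theta> j i k) s)"
proof -
  \<comment> \<open>The decay assumptions ask for positive exponents, hence the maximum with 1. For
    \<open>m = 0\<close> the weight is the constant 2 and is covered by the factor 2 in the
    comparison.\<close>
  define s1 where "s1 = real (max 1 m)"
  have s1: "s1 > 0" by (simp add: s1_def)
  define D where "D = (if j = Some i then deriv (\<psi> i k) else deriv (\<phi> i k))"
  define T where "T s = (1 + \<bar>\<phi> i k s\<bar> powr s1 + \<bar>\<psi> i k s\<bar> powr s1) * (pp i s)\<^sup>2 * w i s * D s" for s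
  have "vanishes_at_endpoints (\<sigma> i) (\<Sigma> i) T"
    using T2a[OF s1 s1, of i k] T2b[OF s1 s1, of i k] unfolding T_def[abs_def] D_def \<psi>_def by auto
  note T = vanishes_at_endpoints_imp[OF interval this, folded I_def]
  have "\<bar>(pp i s)\<^sup>2 * w i s * (1 + \<bar>\<theta> j i k s\<bar> ^ m) * deriv (\<theta> j i k) s\<bar> \<le> 2 * \<bar>T s\<bar>" if s: "s \<in> I i" for s
  proof -
    have pw: "1 + \<bar>y\<bar> ^ m \<le> 2 * (1 + \<bar>y\<bar> powr s1)" for y :: real
    proof (cases "m = 0")
      case False
      then have "\<bar>y\<bar> powr s1 = \<bar>y\<bar> ^ m" using powr_eq_power[of m y] by (simp add: s1_def max_def)
      then show ?thesis by simp
    qed simp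
    have "\<bar>\<theta> j i k s\<bar> powr s1 \<le> \<bar>\<phi> i k s\<bar> powr s1 + \<bar>\<psi> i k s\<bar> powr s1" by (simp add: \<theta>_def)
    then have "2 * (1 + \<bar>\<theta> j i k s\<bar> powr s1) \<le> 2 * (1 + \<bar>\<phi> i k s\<bar> powr s1 + \<bar>\<psi> i k s\<bar> powr s1)" by simp
    then have 1: "1 + \<bar>\<theta> j i k s\<bar> ^ m \<le> 2 * (1 + \<bar>\<phi> i k s\<bar> powr s1 + \<bar>\<psi> i k s\<bar> powr s1)"
      by (rule order.trans[OF pw])
    have D: "deriv (\<theta> j i k) s = D s" by (simp add: \<theta>_def D_def)
    have w0: "0 \<le> (pp i s)\<^sup>2 * w i s" using I_rules(2)[OF s] by simp
    have p0: "0 \<le> 1 + \<bar>\<phi> i k s\<bar> powr s1 + \<bar>\<psi> i k s\<bar> powr s1" by (intro add_nonneg_nonneg) auto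
    have "\<bar>(pp i s)\<^sup>2 * w i s * (1 + \<bar>\<theta> j i k s\<bar> ^ m) * deriv (\<theta> j i k) s\<bar> = ((pp i s)\<^sup>2 * w i s * \<bar>D s\<bar>) * (1 + \<bar>\<theta> j i k s\<bar> ^ m)"
      unfolding D using w0 I_rules(2)[OF s] by (simp add: abs_mult mult_ac)
    also have "\<dots> \<le> ((pp i s)\<^sup>2 * w i s * \<bar>D s\<bar>) * (2 * (1 + \<bar>\<phi> i k s\<bar> powr s1 + \<bar>\<psi> i k s\<bar> powr s1))"
      by (intro mult_left_mono 1 mult_nonneg_nonneg w0) auto
    also have "\<dots> = 2 * \<bar>T s\<bar>" unfolding T_def using p0 I_rules(2)[OF s] by (simp add: abs_mult mult_ac)
    finally show ?thesis .
  qed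
  note v = vanishes_dominated(1)[OF this zero_less_numeral T(1)] vanishes_dominated(2)[OF this zero_less_numeral T(2)]
  show "vanishes_left (I i) (\<lambda>s. (pp i s)\<^sup>2 * w i s * (1 + \<bar>\<theta> j i k s\<bar> ^ m) * deriv (\<theta> j i k) s)" by (rule v(1))
  show "vanishes_right (I i) (\<lambda>s. (pp i s)\<^sup>2 * w i s * (1 + \<bar>\<theta> j i k s\<bar> ^ m) * deriv (\<theta> j i k) s)" by (rule v(2))
qed

text \<open>For \<open>K > 0\<close> divide by \<open>K\<close>. For \<open>K = 0\<close> assumption
  \<open>A2\<close> forces every \<open>qq i\<close> to vanish identically, so its derivative
  vanishes too and \<open>r i\<close> reduces to the constant \<open>a i\<close>.\<close>

lemma r_nonneg:
  assumes "\<And>i. x i \<in> I i"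
  shows "0 \<le> (\<Sum>i\<in>UNIV. r i (x i))"
proof -
  have A2': "(\<Sum>i\<in>UNIV. (qq i (x i))\<^sup>2) \<le> K * (\<Sum>i\<in>UNIV. r i (x i))" if "\<And>i. x i \<in> I i" for x
    using A2[of x] that unfolding mu_eq space_mu potential_def r_def by simp
  have q0: "0 \<le> (\<Sum>i\<in>UNIV. (qq i (x i))\<^sup>2)" for x by (intro sum_nonneg) auto
  show ?thesis
  proof (cases "K = 0")
    case False
    then have "K > 0" using K_nonneg by simp
    moreover have "0 \<le> K * (\<Sum>i\<in>UNIV. r i (x i))" using A2'[OF assms] q0[of x] by (rule order.trans[rotated])
    ultimately show ?thesis by (simp add: zero_le_mult_iff)
  next
    case True
    have qz: "qq i s = 0" if s: "s \<in> I i" for i s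
    proof -
      have "(\<Sum>l\<in>UNIV. (qq l ((x(i := s)) l))\<^sup>2) \<le> 0"
        using A2'[of "x(i := s)"] assms s True by simp
      moreover have "(qq i ((x(i := s)) i))\<^sup>2 \<le> (\<Sum>l\<in>UNIV. (qq l ((x(i := s)) l))\<^sup>2)"
        by (rule member_le_sum) auto
      ultimately have "(qq i ((x(i := s)) i))\<^sup>2 \<le> 0" by linarith
      then show ?thesis by simp
    qed
    have "deriv (qq i) s = 0" if s: "s \<in> I i" for i s
    proof -
      have "(qq i has_real_derivative 0) (at s)"
        by (rule has_field_derivative_transform_within_open[OF _ I_props(1) s, of "\<lambda>_. 0"]) (auto simp: qz)
      then show ?thesis by (rule DERIV_imp_deriv)
    qed
    then have "r i (x i) = a i" for i unfolding r_def potential1_def using qz assms by simp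
    then show ?thesis using a_nonneg by (simp add: sum_nonneg)
  qed
qed

sublocale TS: tensor_system I w pp r lam \<theta> "\<lambda>j i k. deriv (\<theta> j i k)" V M
proof (rule tensor_system.intro)
  fix j i k m s x
  show "open (I i)" "is_interval (I i)" "I i \<noteq> {}" by (rule I_props)+
  show "s \<in> I i \<Longrightarrow> w i s > 0" by (rule I_rules)
  show "s \<in> I i \<Longrightarrow> pp i s \<noteq> 0" using pp_nonzero by (simp add: I_def)
  show "continuous_on (I i) (w i)" "continuous_on (I i) (pp i)" "continuous_on (I i) (deriv (\<theta> j i k))"
    "continuous_on (I i) (V j i)" "continuous_on (I i) (r i)" by (rule cont)+
  show "s \<in> I i \<Longrightarrow> (\<theta> j i k has_real_derivative deriv (\<theta> j i k) s) (at s)" by (rule \<theta>_deriv)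
  show "((\<lambda>s. (pp i s)\<^sup>2 * w i s * deriv (\<theta> j i k) s) has_real_derivative w i s * (V j i s - lam i k) * \<theta> j i k s) (at s)"
    if s: "s \<in> I i"
    using eigenfunction_ode[OF I_props(1) I_rules(1-6) s, of k] \<delta>_eigenfunction_ode[OF I_props(1) I_rules(1-6) s, of k]
    by (simp add: \<theta>_def V_def r_def \<psi>_def)
  show "s \<in> I i \<Longrightarrow> r i s \<le> V j i s" using A1 by (simp add: V_def I_def)
  show "(\<And>i. x i \<in> I i) \<Longrightarrow> 0 \<le> (\<Sum>i\<in>UNIV. r i (x i))" by (rule r_nonneg)
  show "0 \<le> lam i k" by (rule lam_nonneg)
  show "vanishes_left (I i) (\<lambda>s. (pp i s)\<^sup>2 * w i s * (1 + \<bar>\<theta> j i k s\<bar> ^ m) * deriv (\<theta> j i k) s)"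
    "vanishes_right (I i) (\<lambda>s. (pp i s)\<^sup>2 * w i s * (1 + \<bar>\<theta> j i k s\<bar> ^ m) * deriv (\<theta> j i k) s)" by (rule decay)+
  show "1 \<le> m \<Longrightarrow> integrable (density (restrict_space lborel (I i)) (\<lambda>s. ennreal (w i s))) (\<lambda>s. \<bar>\<theta> j i k s\<bar> ^ m)"
    using moments unfolding M_eq .
qed (simp add: M_eq)

end

lemma infsum_finite_support:
  fixes F :: "'k \<Rightarrow> real"
  assumes "finite S" "\<And>k. k \<in> A \<Longrightarrow> k \<notin> S \<Longrightarrow> F k = 0"
  shows "infsum F A = (\<Sum>k\<in>S. if k \<in> A then F k else 0)"
proof -
  have "infsum F A = infsum (\<lambda>k. if k \<in> A then F k else 0) S"
    by (rule infsum_cong_neutral) (use assms in auto)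
  then show ?thesis using assms(1) by simp
qed

text \<open>For \<open>p \<ge> 2\<close> conjugacy gives \<open>q - 1 = 1 / (p - 1)\<close>, which
  turns \<open>5 / 24 * (q - 1)\<close> into the stated constant. For \<open>p < 2\<close> the
  function for the exchanged exponents is used with its arguments swapped.\<close>

lemma exists_bellman:
  fixes p q :: real
  assumes p: "1 < p" and q: "q = p / (p - 1)"
  shows "\<exists>\<Phi> \<Phi>x \<Phi>y \<Phi>xx \<Phi>xy \<Phi>yy \<tau>. bellman \<Phi> \<Phi>x \<Phi>y \<Phi>xx \<Phi>xy \<Phi>yy \<tau> (5 / 24 / (max p q - 1)) \<and>
    (\<forall>X>0. \<forall>Y>0. \<Phi> X Y \<le> 5 / 4 * (X powr (p / 2) + Y powr (q / 2)))"
proof (cases "2 \<le> p")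
  case True
  note qb = q_bounds[OF True q]
  have m: "max p q = p" using qb True by simp
  have "5 / 24 * (q - 1) = 5 / 24 / (max p q - 1)" unfolding m using qb True by (simp add: field_simps)
  then show ?thesis using nt_bellman[OF True q] nt_upper[OF True q] by metis
next
  case False
  have q2: "2 \<le> q" using False p by (simp add: q field_simps)
  have pq: "p = q / (q - 1)" using p by (simp add: q field_simps)
  note qb = q_bounds[OF q2 pq]
  have m: "max p q = q" using qb q2 by simp
  have "5 / 24 * (p - 1) = 5 / 24 / (max p q - 1)" unfolding m using qb q2 by (simp add: field_simps)
  moreover have "\<forall>X>0. \<forall>Y>0. nt q p Y X \<le> 5 / 4 * (X powr (p / 2) + Y powr (q / 2))"
  proof (intro allI impI)
    fix X Y :: real assume "X > 0" "Y > 0"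
    then show "nt q p Y X \<le> 5 / 4 * (X powr (p / 2) + Y powr (q / 2))"
      using nt_upper[OF q2 pq, of Y X] by simp
  qed
  ultimately show ?thesis using bellman.swap[OF nt_bellman[OF q2 pq]] by metis
qed

section \<open>Spectral operators on finite combinations\<close>

context riesz_setting
begin

abbreviation "\<mu> \<equiv> PiM UNIV M"

lemma mem_space_mu: "x \<in> space \<mu> \<Longrightarrow> x i \<in> I i"
  by (simp add: space_mu)

lemma \<theta>_mult_integrable: "integrable (M i) (\<lambda>s. \<theta> j i k s * \<theta> j i m s)"
proof (rule Bochner_Integration.integrable_bound)
  show "integrable (M i) (\<lambda>s. (\<theta> j i k s)\<^sup>2 + (\<theta> j i m s)\<^sup>2)"
    using moments[of 2 i j k] moments[of 2 i j m] by simp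
  show "(\<lambda>s. \<theta> j i k s * \<theta> j i m s) \<in> borel_measurable (M i)"
    using \<theta>_measurable by (intro borel_measurable_times)
  have "\<bar>x * y\<bar> \<le> x\<^sup>2 + y\<^sup>2" for x y :: real
  proof -
    have "2 * (\<bar>x\<bar> * \<bar>y\<bar>) \<le> \<bar>x\<bar>\<^sup>2 + \<bar>y\<bar>\<^sup>2" using sum_squares_bound[of "\<bar>x\<bar>" "\<bar>y\<bar>"] by simp
    moreover have "0 \<le> \<bar>x\<bar> * \<bar>y\<bar>" by simp
    ultimately have "\<bar>x\<bar> * \<bar>y\<bar> \<le> \<bar>x\<bar>\<^sup>2 + \<bar>y\<bar>\<^sup>2" by linarith
    then show ?thesis by (simp add: abs_mult)
  qed
  then show "AE s in M i. norm (\<theta> j i k s * \<theta> j i m s) \<le> norm ((\<theta> j i k s)\<^sup>2 + (\<theta> j i m s)\<^sup>2)" by simp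
qed

lemma bb_mult: "bb j k x * bb j m x = (\<Prod>l\<in>UNIV. \<theta> j l (k l) (x l) * \<theta> j l (m l) (x l))"
  by (simp add: bb_def prod.distrib)

lemma bb_mult_integrable: "integrable \<mu> (\<lambda>x. bb j k x * bb j m x)"
  unfolding bb_mult by (intro product_integrable_prod \<theta>_mult_integrable) simp

lemma bb_inner: "L2_inner \<mu> (bb j k) (bb j m) = (\<Prod>l\<in>UNIV. L2_inner (M l) (\<theta> j l (k l)) (\<theta> j l (m l)))"
  unfolding L2_inner_def bb_mult by (intro product_integral_prod \<theta>_mult_integrable) simp

text \<open>For images under \<open>\<delta>\<close>, \<open>T1\<close> moves the operator to one
  side, and the eigenvalue equation says that the adjoint of \<open>\<delta>\<close> sends
  \<open>\<psi>\<close> to \<open>(lam - a) * \<phi>\<close>. The other factors are orthonormal by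
  assumption.\<close>

lemma \<theta>_orthogonal:
  assumes "k \<noteq> m"
  shows "L2_inner (M l) (\<theta> j l k) (\<theta> j l m) = 0"
proof (cases "j = Some l")
  case True
  have "L2_inner (M l) (\<theta> j l k) (\<theta> j l m) = L2_inner (M l) (\<delta>_adj (w l) (pp l) (qq l) (\<psi> l k)) (\<phi> l m)"
    using T1[of l k m] True by (simp add: \<theta>_def \<psi>_def M_def)
  also have "\<dots> = (\<integral>s. (lam l k - a l) * (\<phi> l k s * \<phi> l m s) \<partial>M l)"
    unfolding L2_inner_def
  proof (rule Bochner_Integration.integral_cong[OF refl])
    fix s assume "s \<in> space (M l)"
    then have "L_op (w l) (pp l) (qq l) (a l) (\<phi> l k) s = lam l k * \<phi> l k s" by (intro I_rules) (simp add: space_M)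
    then have "\<delta>_adj (w l) (pp l) (qq l) (\<psi> l k) s = (lam l k - a l) * \<phi> l k s"
      unfolding L_op_def \<psi>_def by (simp add: algebra_simps)
    then show "\<delta>_adj (w l) (pp l) (qq l) (\<psi> l k) s * \<phi> l m s = (lam l k - a l) * (\<phi> l k s * \<phi> l m s)" by simp
  qed
  also have "\<dots> = (lam l k - a l) * L2_inner (M l) (\<phi> l k) (\<phi> l m)" unfolding L2_inner_def by simp
  finally show ?thesis using orthonormal[of l k m] assms by simp
next
  case False
  then show ?thesis using orthonormal[of l k m] assms by (simp add: \<theta>_def)
qed

lemma bb_orthogonal: "k \<noteq> m \<Longrightarrow> L2_inner \<mu> (bb j k) (bb j m) = 0"
proof -
  assume "k \<noteq> m"
  then obtain l where "k l \<noteq> m l" by blast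
  then have "L2_inner (M l) (\<theta> j l (k l)) (\<theta> j l (m l)) = 0" by (rule \<theta>_orthogonal)
  then show ?thesis unfolding bb_inner by (intro prod_zero) auto
qed

text \<open>The squared norm of a basis function; it may be 0 for images under
  \<open>\<delta>\<close>.\<close>

definition "nrm j k = L2_inner \<mu> (bb j k) (bb j k)"

lemma nrm_None: "nrm None k = 1"
  unfolding nrm_def bb_inner by (simp add: \<theta>_def orthonormal)

lemma inner_sum:
  fixes A :: "('n \<Rightarrow> nat) set"
  assumes A: "finite A" and f: "\<And>x. x \<in> space \<mu> \<Longrightarrow> f x = (\<Sum>k\<in>A. c k * bb j k x)"
    and b: "\<And>x. x \<in> space \<mu> \<Longrightarrow> b x = e * bb j m x"
  shows "L2_inner \<mu> f b = e * (if m \<in> A then c m * nrm j m else 0)"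
proof -
  have "L2_inner \<mu> f b = (\<integral>x. (\<Sum>k\<in>A. (e * c k) * (bb j k x * bb j m x)) \<partial>\<mu>)"
    unfolding L2_inner_def using f b
    by (intro Bochner_Integration.integral_cong refl) (simp add: sum_distrib_left sum_distrib_right mult_ac)
  also have "\<dots> = (\<Sum>k\<in>A. (e * c k) * L2_inner \<mu> (bb j k) (bb j m))"
    unfolding L2_inner_def using bb_mult_integrable by simp
  also have "\<dots> = (\<Sum>k\<in>A. if k = m then (e * c k) * nrm j m else 0)"
    by (intro sum.cong refl) (auto simp: nrm_def bb_orthogonal)
  also have "\<dots> = e * (if m \<in> A then c m * nrm j m else 0)" using A by simp
  finally show ?thesis .
qed

text \<open>The projection merely masks coefficients, so the result is carried by the same finite
  set \<open>S\<close>.\<close>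

lemma projection_eq:
  assumes S: "finite S" and f: "\<And>x. x \<in> space \<mu> \<Longrightarrow> f x = (\<Sum>k\<in>S. c k * bb None k x)"
  shows "\<exists>c'. \<forall>x. proj_Pi \<mu> (tensor \<phi>) \<Lambda> f x = (\<Sum>k\<in>S. c' k * bb None k x)"
proof -
  define A where "A = (if \<Lambda> (\<lambda>_. 0) > 0 then UNIV else UNIV - {(\<lambda>_. 0) :: 'n \<Rightarrow> nat})"
  have in_f: "L2_inner \<mu> f (tensor \<phi> k) = (if k \<in> S then c k else 0)" for k
    using inner_sum[OF S f, of "tensor \<phi> k" 1 k] by (simp add: tensor_eq nrm_None)
  have "proj_Pi \<mu> (tensor \<phi>) \<Lambda> f x = (\<Sum>k\<in>S. (if k \<in> A then c k else 0) * bb None k x)" for x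
  proof -
    have "proj_Pi \<mu> (tensor \<phi>) \<Lambda> f x = (\<Sum>k\<in>S. if k \<in> A then L2_inner \<mu> f (tensor \<phi> k) * tensor \<phi> k x else 0)"
      unfolding proj_Pi_def A_def[symmetric] by (rule infsum_finite_support[OF S]) (simp add: in_f)
    also have "\<dots> = (\<Sum>k\<in>S. (if k \<in> A then c k else 0) * bb None k x)"
      by (intro sum.cong refl) (simp add: in_f tensor_eq)
    finally show ?thesis .
  qed
  then show ?thesis by (intro exI[of _ "\<lambda>k. if k \<in> A then c k else 0"]) simp
qed

lemma semigroup_P_eq:
  assumes S: "finite S" and f: "\<And>x. x \<in> space \<mu> \<Longrightarrow> f x = (\<Sum>k\<in>S. c k * bb None k x)"
  shows "semigroup_P \<mu> (tensor \<phi>) \<Lambda> t f x = (\<Sum>k\<in>S. c k * exp (- t * sqrt (\<Lambda> k)) * bb None k x)"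
proof -
  have in_f: "L2_inner \<mu> f (tensor \<phi> k) = (if k \<in> S then c k else 0)" for k
    using inner_sum[OF S f, of "tensor \<phi> k" 1 k] by (simp add: tensor_eq nrm_None)
  have "semigroup_P \<mu> (tensor \<phi>) \<Lambda> t f x = (\<Sum>k\<in>S. if k \<in> UNIV then exp (- t * sqrt (\<Lambda> k)) * L2_inner \<mu> f (tensor \<phi> k) * tensor \<phi> k x else 0)"
    unfolding semigroup_P_def by (rule infsum_finite_support[OF S]) (simp add: in_f)
  also have "\<dots> = (\<Sum>k\<in>S. c k * exp (- t * sqrt (\<Lambda> k)) * bb None k x)"
    by (intro sum.cong refl) (simp add: in_f tensor_eq)
  finally show ?thesis .
qed

text \<open>Each term of \<open>semigroup_Q\<close> contains the normaliser twice, which cancels the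
  squared norm. The normaliser tests for vanishing at every point, whereas the norm is already 0 for
  a function vanishing almost everywhere; in either case the product is 0.\<close>

lemma normalizer_eq: "(normalizer \<mu> b)\<^sup>2 * nrm j k = (if nrm j k = 0 then 0 else 1)"
  if b: "\<And>x. x \<in> space \<mu> \<Longrightarrow> b x = bb j k x"
proof (cases "nrm j k = 0")
  case False
  have nz: "\<exists>x\<in>space \<mu>. b x \<noteq> 0"
  proof (rule ccontr)
    assume "\<not> ?thesis"
    then have "nrm j k = (\<integral>x. 0 \<partial>\<mu>)"
      unfolding nrm_def L2_inner_def using b by (intro Bochner_Integration.integral_cong refl) auto
    then show False using False by simp
  qed
  have n0: "0 \<le> nrm j k" unfolding nrm_def L2_inner_def by (intro Bochner_Integration.integral_nonneg) auto
  have "(\<integral>x. norm (b x) powr 2 \<partial>\<mu>) = nrm j k"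
    unfolding nrm_def L2_inner_def using b
    by (intro Bochner_Integration.integral_cong refl) (simp add: power2_eq_square flip: abs_mult)
  then have "Lp_norm \<mu> 2 b = sqrt (nrm j k)" using n0 by (simp add: Lp_norm_def powr_half_sqrt)
  then show ?thesis using nz n0 False by (simp add: normalizer_def power_inverse)
qed simp

text \<open>Orthogonality keeps only the matching coefficient. Terms of norm 0 are dropped; since
  they vanish only almost everywhere, the sum at \<open>t = 0\<close> recovers \<open>g\<close> only
  almost everywhere.\<close>

lemma semigroup_Q_eq:
  assumes S: "finite S" and g: "\<And>x. x \<in> space \<mu> \<Longrightarrow> g x = (\<Sum>k\<in>S. c k * bb (Some i) k x)" and x: "x \<in> space \<mu>"
  shows "semigroup_Q \<mu> (\<lambda>k. in_var i (\<delta> (pp i) (qq i)) (tensor \<phi> k)) \<Lambda> t g x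
    = (\<Sum>k\<in>S. (if nrm (Some i) k = 0 then 0 else c k) * exp (- t * sqrt (\<Lambda> k)) * bb (Some i) k x)"
proof -
  define b where "b k = in_var i (\<delta> (pp i) (qq i)) (tensor \<phi> k)" for k
  have b: "b k x = bb (Some i) k x" if "x \<in> space \<mu>" for k x
    unfolding b_def by (rule \<delta>_tensor_eq[OF mem_space_mu[OF that]])
  have in_g: "L2_inner \<mu> g (\<lambda>y. normalizer \<mu> (b k) * b k y) = normalizer \<mu> (b k) * (if k \<in> S then c k * nrm (Some i) k else 0)" for k
    by (rule inner_sum[OF S g]) (simp_all add: b)
  have "semigroup_Q \<mu> b \<Lambda> t g x = (\<Sum>k\<in>S. if k \<in> UNIV then exp (- t * sqrt (\<Lambda> k))
     * L2_inner \<mu> g (\<lambda>y. normalizer \<mu> (b k) * b k y) * (normalizer \<mu> (b k) * b k x) else 0)"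
    unfolding semigroup_Q_def by (rule infsum_finite_support[OF S]) (simp add: in_g)
  also have "\<dots> = (\<Sum>k\<in>S. (if nrm (Some i) k = 0 then 0 else c k) * exp (- t * sqrt (\<Lambda> k)) * bb (Some i) k x)"
  proof (intro sum.cong refl)
    fix k assume k: "k \<in> S"
    have "exp (- t * sqrt (\<Lambda> k)) * L2_inner \<mu> g (\<lambda>y. normalizer \<mu> (b k) * b k y) * (normalizer \<mu> (b k) * b k x)
      = ((normalizer \<mu> (b k))\<^sup>2 * nrm (Some i) k) * c k * exp (- t * sqrt (\<Lambda> k)) * bb (Some i) k x"
      unfolding in_g b[OF x] using k by (simp add: power2_eq_square)
    also have "\<dots> = (if nrm (Some i) k = 0 then 0 else c k) * exp (- t * sqrt (\<Lambda> k)) * bb (Some i) k x"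
      by (subst normalizer_eq[OF b]) auto
    finally show "(if k \<in> UNIV then exp (- t * sqrt (\<Lambda> k)) * L2_inner \<mu> g (\<lambda>y. normalizer \<mu> (b k) * b k y) * (normalizer \<mu> (b k) * b k x) else 0)
      = (if nrm (Some i) k = 0 then 0 else c k) * exp (- t * sqrt (\<Lambda> k)) * bb (Some i) k x" by simp
  qed
  finally show ?thesis unfolding b_def[abs_def] .
qed

lemma bb_AE_zero: "nrm j k = 0 \<Longrightarrow> AE x in \<mu>. bb j k x = 0"
  using integral_nonneg_eq_0_iff_AE[OF bb_mult_integrable, of j k k] unfolding nrm_def L2_inner_def by simp

theorem embedding:
  fixes f :: "('n \<Rightarrow> real) \<Rightarrow> real" and g :: "'n \<Rightarrow> ('n \<Rightarrow> real) \<Rightarrow> real" and p q :: real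
  assumes p: "1 < p" "q = p / (p - 1)"
    and f: "f \<in> lin \<mu> (tensor \<phi>)"
    and g: "\<And>i. g i \<in> lin \<mu> (\<lambda>k. in_var i (\<delta> (pp i) (qq i)) (tensor \<phi> k))"
  defines "\<Lambda> \<equiv> (\<lambda>k::'n \<Rightarrow> nat. \<Sum>i\<in>UNIV. lam i (k i))"
  defines "\<Pi>f \<equiv> proj_Pi \<mu> (tensor \<phi>) \<Lambda> f"
  defines "F \<equiv> (\<lambda>x t. (\<chi> j. semigroup_P \<mu> (tensor \<phi>) \<Lambda> t \<Pi>f x) :: real ^ 1)"
    and "G \<equiv> (\<lambda>x t. (\<chi> j. semigroup_Q \<mu> (\<lambda>k. in_var j (\<delta> (pp j) (qq j)) (tensor \<phi> k)) \<Lambda> t (g j) x) :: real ^ 'n)"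
  shows "(\<integral>\<^sup>+ t\<in>{0<..}. (\<integral>\<^sup>+ x. ennreal (star_norm (potential w pp qq a) pp F x t * star_norm (potential w pp qq a) pp G x t) \<partial>\<mu>)
           * ennreal t \<partial>lborel)
    \<le> ennreal (6 * (max p q - 1) * Lp_norm \<mu> p \<Pi>f * Lp_norm \<mu> q (\<lambda>x. \<chi> i. g i x))"
proof -
  obtain Kf cf where Kf: "finite Kf" "\<And>x. x \<in> space \<mu> \<Longrightarrow> f x = (\<Sum>k\<in>Kf. cf k * tensor \<phi> k x)"
    using f unfolding lin_def by blast
  have "\<forall>i. \<exists>u. finite (fst u) \<and> (\<forall>x\<in>space \<mu>. g i x = (\<Sum>k\<in>fst u. snd u k * in_var i (\<delta> (pp i) (qq i)) (tensor \<phi> k) x))"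
  proof
    fix i
    obtain K c where "finite K" "\<forall>x\<in>space \<mu>. g i x = (\<Sum>k\<in>K. c k * in_var i (\<delta> (pp i) (qq i)) (tensor \<phi> k) x)"
      using g[of i] unfolding lin_def by blast
    then show "\<exists>u. finite (fst u) \<and> (\<forall>x\<in>space \<mu>. g i x = (\<Sum>k\<in>fst u. snd u k * in_var i (\<delta> (pp i) (qq i)) (tensor \<phi> k) x))"
      by (intro exI[of _ "(K, c)"]) simp
  qed
  from choice[OF this] obtain ug where ug: "\<And>i. finite (fst (ug i))"
    "\<And>i x. x \<in> space \<mu> \<Longrightarrow> g i x = (\<Sum>k\<in>fst (ug i). snd (ug i) k * in_var i (\<delta> (pp i) (qq i)) (tensor \<phi> k) x)"
    by blast
  \<comment> \<open>One finite index set for \<open>f\<close> and all \<open>g i\<close>; missing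
    coefficients are set to 0.\<close>
  define S where "S = Kf \<union> (\<Union>i. fst (ug i))"
  have S: "finite S" unfolding S_def using Kf(1) ug(1) by simp
  have ext: "(\<Sum>k\<in>K. c k * u k) = (\<Sum>k\<in>S. (if k \<in> K then c k else 0) * u k)" if "K \<subseteq> S" for K and c u :: "('n \<Rightarrow> nat) \<Rightarrow> real"
    using S that by (intro sum.mono_neutral_cong_left) auto
  have f': "f x = (\<Sum>k\<in>S. (if k \<in> Kf then cf k else 0) * bb None k x)" if "x \<in> space \<mu>" for x
    unfolding Kf(2)[OF that] tensor_eq by (rule ext) (auto simp: S_def)
  obtain cP where cP: "\<And>x. \<Pi>f x = (\<Sum>k\<in>S. cP k * bb None k x)"
    using projection_eq[OF S f', of \<Lambda>] unfolding \<Pi>f_def by blast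
  define cg where "cg i k = (if k \<in> fst (ug i) then snd (ug i) k else 0)" for i k
  have g': "g i x = (\<Sum>k\<in>S. cg i k * bb (Some i) k x)" if "x \<in> space \<mu>" for i x
  proof -
    have "g i x = (\<Sum>k\<in>fst (ug i). snd (ug i) k * bb (Some i) k x)"
      unfolding ug(2)[OF that] using \<delta>_tensor_eq[OF mem_space_mu[OF that]] by simp
    also have "\<dots> = (\<Sum>k\<in>S. cg i k * bb (Some i) k x)" unfolding cg_def by (rule ext) (auto simp: S_def)
    finally show ?thesis .
  qed
  \<comment> \<open>The coefficients at time 0, without the terms of norm 0 that drop out of the
    second semigroup.\<close>
  define C where "C j k = (case j of None \<Rightarrow> cP k | Some i \<Rightarrow> if nrm (Some i) k = 0 then 0 else cg i k)" for j k
  define m where "m = max p q - 1"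
  have m: "m > 0" using p by (auto simp: m_def)
  obtain \<Phi> \<Phi>x \<Phi>y \<Phi>xx \<Phi>xy \<Phi>yy \<tau> where bel: "bellman \<Phi> \<Phi>x \<Phi>y \<Phi>xx \<Phi>xy \<Phi>yy \<tau> (5 / 24 / m)"
    and up: "\<And>X Y. X > 0 \<Longrightarrow> Y > 0 \<Longrightarrow> \<Phi> X Y \<le> 5 / 4 * (X powr (p / 2) + Y powr (q / 2))"
    using exists_bellman[OF p] unfolding m_def by blast
  interpret bel: bellman \<Phi> \<Phi>x \<Phi>y \<Phi>xx \<Phi>xy \<Phi>yy \<tau> "5 / 24 / m" by (rule bel)
  \<comment> \<open>\<open>F\<close> is the single component \<open>None\<close> and
    \<open>G\<close> consists of the components \<open>Some i\<close>, so the two blocks are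
    disjoint, as the scaling argument requires.\<close>
  interpret B: bellman_flow I w pp r lam \<theta> "\<lambda>j i k. deriv (\<theta> j i k)" V M \<Phi> \<Phi>x \<Phi>y \<Phi>xx \<Phi>xy \<Phi>yy \<tau> "5 / 24 / m" S C "{None}" "range Some"
    by unfold_locales (rule S)
  have XX: "TS.XX = space \<mu>" by (simp add: TS.XX_def space_mu)
  have hF: "F x t $ j = B.h None x t" for x t j
    unfolding F_def B.h_def B.freq_def C_def vec_lambda_beta semigroup_P_eq[OF S cP] \<Lambda>_def bb_def by simp
  have hG: "G x t $ j = B.h (Some j) x t" if "x \<in> space \<mu>" for x t j
  proof -
    have "G x t $ j = semigroup_Q \<mu> (\<lambda>k. in_var j (\<delta> (pp j) (qq j)) (tensor \<phi> k)) \<Lambda> t (g j) x"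
      by (simp only: G_def vec_lambda_beta)
    also have "\<dots> = (\<Sum>k\<in>S. (if nrm (Some j) k = 0 then 0 else cg j k) * exp (- t * sqrt (\<Lambda> k)) * bb (Some j) k x)"
      by (rule semigroup_Q_eq[OF S _ that]) (rule g')
    also have "\<dots> = B.h (Some j) x t" unfolding B.h_def B.freq_def C_def \<Lambda>_def bb_def by simp
    finally show ?thesis .
  qed
  have r: "potential w pp qq a = (\<lambda>x. \<Sum>i\<in>UNIV. r i (x i))" by (simp add: fun_eq_iff potential_def r_def)
  have bF: "bij_betw (\<lambda>_ :: 1. None :: 'n option) UNIV {None}" by (auto simp: bij_betw_def inj_on_def)
  have bG: "bij_betw Some (UNIV :: 'n set) (range Some)" by (auto simp: bij_betw_def)
  have sF: "star_norm (potential w pp qq a) pp F x t = sqrt (B.energy {None} x t)" if "x \<in> space \<mu>" for x t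
    unfolding r using that by (intro B.star_norm_eq[OF hF bF]) (simp add: XX)
  have sG: "star_norm (potential w pp qq a) pp G x t = sqrt (B.energy (range Some) x t)" if "x \<in> space \<mu>" for x t
    unfolding r using that by (intro B.star_norm_eq[OF hG bG]) (simp_all add: XX)
  define E where "E z = sqrt (B.energy {None} (fst z) (snd z)) * sqrt (B.energy (range Some) (fst z) (snd z))" for z
  have E0: "0 \<le> E z" if "fst z \<in> space \<mu>" for z unfolding E_def using B.energy_nonneg that XX by simp
  have Em: "(\<lambda>z. E z) \<in> borel_measurable (\<mu> \<Otimes>\<^sub>M lborel)"
    using TS.nice_mult[OF TS.nice_sqrt[OF B.nice_energy[of "{None}"]] TS.nice_sqrt[OF B.nice_energy[of "range Some"]]]
    unfolding E_def TS.nice_def by blast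
  let ?u = "\<lambda>x t. ennreal (star_norm (potential w pp qq a) pp F x t * star_norm (potential w pp qq a) pp G x t)"
  let ?L = "\<integral>\<^sup>+ t\<in>{0<..}. (\<integral>\<^sup>+ x. ?u x t \<partial>\<mu>) * ennreal t \<partial>lborel"
  define N where "N z = ennreal (indicator {0<..} (snd z) * (snd z * E z))" for z
  have Nm: "N \<in> borel_measurable (\<mu> \<Otimes>\<^sub>M lborel)" unfolding N_def[abs_def] using Em by measurable
  have "(\<integral>\<^sup>+ x. ?u x t \<partial>\<mu>) * ennreal t * indicator {0<..} t = (\<integral>\<^sup>+ x. N (x, t) \<partial>\<mu>)" for t
  proof (cases "0 < t")
    case True
    have "(\<lambda>x. E (x, t)) \<in> borel_measurable \<mu>"
      using measurable_compose[OF _ Em, of "\<lambda>x. (x, t)" \<mu>] by simp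
    then have "(\<integral>\<^sup>+ x. ennreal (E (x, t)) * ennreal t \<partial>\<mu>) = (\<integral>\<^sup>+ x. ennreal (E (x, t)) \<partial>\<mu>) * ennreal t"
      by (intro nn_integral_multc) simp
    moreover have "(\<integral>\<^sup>+ x. ?u x t \<partial>\<mu>) = (\<integral>\<^sup>+ x. ennreal (E (x, t)) \<partial>\<mu>)"
      by (intro nn_integral_cong) (simp add: sF sG E_def)
    moreover have "(\<integral>\<^sup>+ x. N (x, t) \<partial>\<mu>) = (\<integral>\<^sup>+ x. ennreal (E (x, t)) * ennreal t \<partial>\<mu>)"
      using True by (intro nn_integral_cong) (simp add: N_def E0 ennreal_mult mult.commute)
    ultimately show ?thesis using True by simp
  qed (simp add: N_def)
  then have "?L = (\<integral>\<^sup>+ t. (\<integral>\<^sup>+ x. N (x, t) \<partial>\<mu>) \<partial>lborel)" by simp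
  also have "\<dots> = (\<integral>\<^sup>+ z. N z \<partial>(\<mu> \<Otimes>\<^sub>M lborel))" by (rule TS.nn_integral_snd[OF Nm])
  \<comment> \<open>\<open>5 / (12 * m)\<close> equals \<open>2 * \<kappa>\<close>.\<close>
  finally have "ennreal (5 / (12 * m)) * ?L = (\<integral>\<^sup>+ z. ennreal (5 / (12 * m)) * N z \<partial>(\<mu> \<Otimes>\<^sub>M lborel))"
    using nn_integral_cmult[OF Nm] by simp
  also have "\<dots> = (\<integral>\<^sup>+ z. ennreal (indicator {0<..} (snd z) * (snd z * (2 * (5 / 24 / m) * E z))) \<partial>(\<mu> \<Otimes>\<^sub>M lborel))"
  proof (intro nn_integral_cong)
    fix z :: "('n \<Rightarrow> real) \<times> real"
    have "ennreal (5 / (12 * m)) * N z = ennreal (5 / (12 * m) * (indicator {0<..} (snd z) * (snd z * E z)))"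
      unfolding N_def using m by (intro ennreal_mult'[symmetric]) simp
    also have "5 / (12 * m) * (indicator {0<..} (snd z) * (snd z * E z)) = indicator {0<..} (snd z) * (snd z * (2 * (5 / 24 / m) * E z))"
      using m by (simp add: field_simps)
    finally show "ennreal (5 / (12 * m)) * N z = ennreal (indicator {0<..} (snd z) * (snd z * (2 * (5 / 24 / m) * E z)))" .
  qed
  also have "\<dots> \<le> ennreal (2 * (5 / 4) * (\<integral>x. (\<Sum>j\<in>{None}. (B.h j x 0)\<^sup>2) powr (p / 2) \<partial>\<mu>) powr (1 / p)
        * (\<integral>x. (\<Sum>j\<in>range Some. (B.h j x 0)\<^sup>2) powr (q / 2) \<partial>\<mu>) powr (1 / q))"
    unfolding E_def
  proof (rule B.bilinear_embedding[OF up])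
    show "1 < q" "1 / p + 1 / q = 1" unfolding p(2) using p(1) by (simp_all add: field_simps)
  qed (use p in auto)
  also have "(\<integral>x. (\<Sum>j\<in>{None}. (B.h j x 0)\<^sup>2) powr (p / 2) \<partial>\<mu>) powr (1 / p) = Lp_norm \<mu> p \<Pi>f"
  proof -
    have "B.h None x 0 = \<Pi>f x" for x unfolding B.h_def C_def cP bb_def by simp
    moreover have "(y\<^sup>2) powr (p / 2) = \<bar>y\<bar> powr p" for y using power2_powr_half[of "\<bar>y\<bar>" p] by simp
    ultimately show ?thesis unfolding Lp_norm_def by simp
  qed
  also have "(\<integral>x. (\<Sum>j\<in>range Some. (B.h j x 0)\<^sup>2) powr (q / 2) \<partial>\<mu>) powr (1 / q) = Lp_norm \<mu> q (\<lambda>x. \<chi> i. g i x)"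
  proof -
    have nv: "norm (\<chi> i. g i x) powr q = (\<Sum>i\<in>UNIV. (g i x)\<^sup>2) powr (q / 2)" for x
    proof -
      have "(norm (\<chi> i. g i x))\<^sup>2 = (\<Sum>i\<in>UNIV. (g i x)\<^sup>2)" by (simp add: norm_vec_def L2_set_def sum_nonneg)
      then show ?thesis using power2_powr_half[of "norm (\<chi> i. g i x)" q] by simp
    qed
    \<comment> \<open>The dropped terms vanish almost everywhere, so the initial value of the second
      block and \<open>g\<close> have the same norm.\<close>
    have ae0: "AE x in \<mu>. \<forall>i\<in>UNIV. \<forall>k\<in>S. nrm (Some i) k = 0 \<longrightarrow> bb (Some i) k x = 0"
    proof (intro AE_finite_allI S)
      fix i k show "AE x in \<mu>. nrm (Some i) k = 0 \<longrightarrow> bb (Some i) k x = 0"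
        using bb_AE_zero[of "Some i" k] by (cases "nrm (Some i) k = 0") auto
    qed simp
    have gm: "g i \<in> borel_measurable \<mu>" for i
      using T3(2)[of 1 i] g[of i] unfolding dense_in_Lp_def mu_eq Lp_space_def by auto
    have hm: "(\<lambda>x. B.h j x 0) \<in> borel_measurable \<mu>" for j by (rule TS.nice_fixed_measurable[OF B.nice_h])
    note gm[measurable] hm[measurable]
    have "(\<integral>x. (\<Sum>j\<in>range Some. (B.h j x 0)\<^sup>2) powr (q / 2) \<partial>\<mu>) = (\<integral>x. (\<Sum>i\<in>UNIV. (g i x)\<^sup>2) powr (q / 2) \<partial>\<mu>)"
    proof (rule integral_cong_AE)
      show "AE x in \<mu>. (\<Sum>j\<in>range Some. (B.h j x 0)\<^sup>2) powr (q / 2) = (\<Sum>i\<in>UNIV. (g i x)\<^sup>2) powr (q / 2)"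
        using ae0 AE_space
      proof eventually_elim
        case (elim x)
        have "B.h (Some i) x 0 = g i x" for i
          unfolding g'[OF elim(2)] B.h_def bb_def[symmetric] using elim(1) by (intro sum.cong refl) (simp add: C_def)
        then show ?case by (simp add: sum.reindex)
      qed
    qed measurable
    then show ?thesis unfolding Lp_norm_def nv by simp
  qed
  finally have main: "ennreal (5 / (12 * m)) * ?L \<le> ennreal (2 * (5 / 4) * Lp_norm \<mu> p \<Pi>f * Lp_norm \<mu> q (\<lambda>x. \<chi> i. g i x))" .
  \<comment> \<open>Dividing \<open>2 * (5 / 4)\<close> by
    \<open>2 * \<kappa> = 5 / (12 * m)\<close> gives \<open>6 * m\<close>.\<close>
  have "?L = ennreal (12 * m / 5) * (ennreal (5 / (12 * m)) * ?L)"
    using m by (simp add: mult.assoc[symmetric] ennreal_mult[symmetric])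
  also have "\<dots> \<le> ennreal (12 * m / 5) * ennreal (2 * (5 / 4) * Lp_norm \<mu> p \<Pi>f * Lp_norm \<mu> q (\<lambda>x. \<chi> i. g i x))"
    by (intro mult_left_mono main) simp
  also have "\<dots> = ennreal (6 * (max p q - 1) * Lp_norm \<mu> p \<Pi>f * Lp_norm \<mu> q (\<lambda>x. \<chi> i. g i x))"
    using m unfolding m_def[symmetric]
    by (subst ennreal_mult[symmetric]) (auto simp: Lp_norm_def intro!: arg_cong[of _ _ ennreal])
  finally show ?thesis .
qed

end

theorem theorem4:
  fixes \<sigma> \<Sigma> :: "'n::finite \<Rightarrow> ereal"
    and w pp qq :: "'n \<Rightarrow> real \<Rightarrow> real"
    and a :: "'n \<Rightarrow> real"
    and \<phi> :: "'n \<Rightarrow> nat \<Rightarrow> real \<Rightarrow> real"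
    and lam :: "'n \<Rightarrow> nat \<Rightarrow> real"
    and K p q :: real
    and f :: "('n \<Rightarrow> real) \<Rightarrow> real"
    and g :: "'n \<Rightarrow> ('n \<Rightarrow> real) \<Rightarrow> real"
  defines "\<mu>1 \<equiv> (\<lambda>i. weighted_measure (\<sigma> i) (\<Sigma> i) (w i))"
    and "\<mu> \<equiv> product_weighted_measure \<sigma> \<Sigma> w"
    and "r \<equiv> potential w pp qq a"
    and "\<Lambda> \<equiv> (\<lambda>k::'n \<Rightarrow> nat. \<Sum>i\<in>UNIV. lam i (k i))"
    and "\<delta>\<phi> \<equiv> (\<lambda>i k. in_var i (\<delta> (pp i) (qq i)) (tensor \<phi> k))"
  defines "\<Pi>f \<equiv> proj_Pi \<mu> (tensor \<phi>) \<Lambda> f"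
  defines "F \<equiv> (\<lambda>x t. (\<chi> j. semigroup_P \<mu> (tensor \<phi>) \<Lambda> t \<Pi>f x) :: real ^ 1)"
    and "G \<equiv> (\<lambda>x t. (\<chi> j. semigroup_Q \<mu> (\<delta>\<phi> j) \<Lambda> t (g j) x) :: real ^ 'n)"
  assumes interval: "\<And>i. \<sigma> i < \<Sigma> i"
    and smooth_w: "\<And>i. smooth_on (einterval (\<sigma> i) (\<Sigma> i)) (w i)"
    and w_pos: "\<And>i x. x \<in> einterval (\<sigma> i) (\<Sigma> i) \<Longrightarrow> w i x > 0"
    and smooth_pp: "\<And>i. smooth_on (einterval (\<sigma> i) (\<Sigma> i)) (pp i)"
    and smooth_qq: "\<And>i. smooth_on (einterval (\<sigma> i) (\<Sigma> i)) (qq i)"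
    and pp_nonzero: "\<And>i x. x \<in> einterval (\<sigma> i) (\<Sigma> i) \<Longrightarrow> pp i x \<noteq> 0"
    and a_nonneg: "\<And>i. a i \<ge> 0"
    and smooth_\<phi>: "\<And>i k. smooth_on (einterval (\<sigma> i) (\<Sigma> i)) (\<phi> i k)"
    and basis: "\<And>i. orthonormal_basis_L2 (\<mu>1 i) (\<phi> i)"
    and eigen: "\<And>i k x. x \<in> einterval (\<sigma> i) (\<Sigma> i) \<Longrightarrow>
      L_op (w i) (pp i) (qq i) (a i) (\<phi> i k) x = lam i k * \<phi> i k x"
    and lam_nonneg: "\<And>i k. lam i k \<ge> 0"
    and lam_strict_mono: "\<And>i. strict_mono (lam i)"
    and lam_tendsto: "\<And>i. filterlim (lam i) at_top sequentially"
    and A1: "\<And>i x. x \<in> einterval (\<sigma> i) (\<Sigma> i) \<Longrightarrow> commutator_fun (w i) (pp i) (qq i) x \<ge> 0"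
    and K_nonneg: "K \<ge> 0"
    and A2: "\<And>x. x \<in> space \<mu> \<Longrightarrow> (\<Sum>i\<in>UNIV. (qq i (x i))\<^sup>2) \<le> K * r x"
    and T1: "\<And>i k m. L2_inner (\<mu>1 i) (\<delta> (pp i) (qq i) (\<phi> i k)) (\<delta> (pp i) (qq i) (\<phi> i m))
      = L2_inner (\<mu>1 i) (\<delta>_adj (w i) (pp i) (qq i) (\<delta> (pp i) (qq i) (\<phi> i k))) (\<phi> i m)"
    and T2a: "\<And>i k s1 s2. s1 > 0 \<Longrightarrow> s2 > 0 \<Longrightarrow> vanishes_at_endpoints (\<sigma> i) (\<Sigma> i)
      (\<lambda>x. (1 + \<bar>\<phi> i k x\<bar> powr s1 + \<bar>\<delta> (pp i) (qq i) (\<phi> i k) x\<bar> powr s2)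
         * (pp i x)\<^sup>2 * w i x * deriv (\<phi> i k) x)"
    and T2b: "\<And>i k s1 s2. s1 > 0 \<Longrightarrow> s2 > 0 \<Longrightarrow> vanishes_at_endpoints (\<sigma> i) (\<Sigma> i)
      (\<lambda>x. (1 + \<bar>\<phi> i k x\<bar> powr s1 + \<bar>\<delta> (pp i) (qq i) (\<phi> i k) x\<bar> powr s2)
         * (pp i x)\<^sup>2 * w i x * deriv (\<delta> (pp i) (qq i) (\<phi> i k)) x)"
    and T3: "\<And>s. s \<ge> 1 \<Longrightarrow> dense_in_Lp \<mu> s (lin \<mu> (tensor \<phi>))"
      "\<And>s i. s \<ge> 1 \<Longrightarrow> dense_in_Lp \<mu> s (lin \<mu> (\<delta>\<phi> i))"
    and p: "1 < p" "q = p / (p - 1)"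
    and f: "f \<in> lin \<mu> (tensor \<phi>)"
    and g: "\<And>i. g i \<in> lin \<mu> (\<delta>\<phi> i)"
  shows "(\<integral>\<^sup>+ t\<in>{0<..}. (\<integral>\<^sup>+ x. ennreal (star_norm r pp F x t * star_norm r pp G x t) \<partial>\<mu>)
           * ennreal t \<partial>lborel)
    \<le> ennreal (6 * (max p q - 1) * Lp_norm \<mu> p \<Pi>f * Lp_norm \<mu> q (\<lambda>x. \<chi> i. g i x))"
proof -
  interpret R: riesz_setting \<sigma> \<Sigma> w pp qq a \<phi> lam K
    by (rule riesz_setting.intro)
       (fact interval smooth_w w_pos smooth_pp smooth_qq pp_nonzero a_nonneg smooth_\<phi> basis[unfolded \<mu>1_def]
          eigen lam_nonneg A1 K_nonneg A2[unfolded \<mu>_def r_def] T1[unfolded \<mu>1_def] T2a T2b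
          T3(1)[unfolded \<mu>_def] T3(2)[unfolded \<mu>_def \<delta>\<phi>_def])+
  show ?thesis
    using R.embedding[OF p f[unfolded \<mu>_def R.mu_eq] g[unfolded \<mu>_def R.mu_eq \<delta>\<phi>_def]]
    unfolding F_def G_def \<Pi>f_def \<Lambda>_def \<delta>\<phi>_def r_def \<mu>_def R.mu_eq .
qed

end
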